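(* Let $0<k\le n-1$ and let $M_1,M_2\subset\mathbb{R}^{n+1}$ be two embedded connected $Q_k$-translators in the $x_{n+1}$-direction such that (1) $M_1$ is strictly convex; (2) the principal curvatures of $M_2$ belong to $\Gamma_{k+1}\cap\{\lambda\in\mathbb{R}^n:\lambda_i\geq 0 \text{ for all } i\}$. Then: (a) (Interior principle) Assume that there exists an interior point $p\in M_1\cap M_2$ such that the tangent spaces of $M_1$ and $M_2$ coincide at $p$. If $M_1$ lies at one side of $M_2$, then both hypersurfaces coincide. (b) (Boundary principle) Assume that the boundaries $\partial M_1,\partial M_2$ lie in the same hyperplane $\Pi$ and that the intersection of each $M_i$ with $\Pi$ is transversal. If $M_1$ lies at one side of $M_2$ and there exists $p\in\partial M_1\cap\partial M_2$ such that the tangent spaces of $M_1$ and $M_2$ coincide at $p$, then both hypersurfaces coincide.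
   Context: For $0\le l\le n$, $S_l(\lambda)$ denotes the elementary symmetric polynomial of order $l$ in $\lambda=(\lambda_1,\dots,\lambda_n)$ (with $S_0=1$), and $Q_k(\lambda)=S_{k+1}(\lambda)/S_k(\lambda)$ for $0\le k\le n-1$. The cone $\Gamma_{k+1}$ is $\{\lambda\in\mathbb{R}^n: S_l(\lambda)>0 \text{ for } l=0,\dots,k+1\}$. For a smooth hypersurface $M\subset\mathbb{R}^{n+1}$ with unit normal $\nu$, the second fundamental form is $h_{ij}=\langle D_{e_i}e_j,\nu\rangle$ and $\lambda$ is the vector of principal curvatures. $M$ is a $Q_k$-translator in the $x_{n+1}$-direction if $Q_k(\lambda)=\langle\nu,e_{n+1}\rangle$ at every point of $M$. Strictly convex means that all principal curvatures are positive.
   Formalization: "Coincide" means: equal near p, agreement continues until one hypersurface ends, and M1=M2 if both are closed and neither's boundary meets the other's interior (a small disc in M2 refutes plain equality); (b) also assumes M1, M2 lie near p on the same side of Π. *)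

theory Defs
  imports "HOL-Analysis.Analysis"
begin

text \<open>
  The ambient space is rendered as \<open>\<real>\<^sup>n \<times> \<real>\<close> with \<open>n = CARD('n)\<close>; the \<open>x\<^bsub>n+1\<^esub>\<close>-direction
  is the last factor.
\<close>

type_synonym 'n ambient = "(real ^ 'n) \<times> real"

definition e_last :: "'n::finite ambient" where
  "e_last = (0, 1)"


subsection \<open>Symmetric functions of the principal curvatures\<close>

definition S :: "nat \<Rightarrow> real ^ 'n::finite \<Rightarrow> real" where
  "S l lam = (\<Sum>A | card A = l. \<Prod>i\<in>A. lam $ i)"

definition Q :: "nat \<Rightarrow> real ^ 'n::finite \<Rightarrow> real" where
  "Q k lam = S (Suc k) lam / S k lam"

definition Gamma :: "nat \<Rightarrow> (real ^ 'n::finite) set" where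
  "Gamma m = {lam. \<forall>l\<le>m. 0 < S l lam}"


subsection \<open>Smooth embedded hypersurfaces with (possibly empty) boundary\<close>

text \<open>Only meant for open \<open>U\<close>, where \<open>frechet_derivative f (at x)\<close> is the derivative.\<close>

primrec Ck_on :: "nat \<Rightarrow> 'a::euclidean_space set \<Rightarrow> ('a \<Rightarrow> 'b::euclidean_space) \<Rightarrow> bool" where
  "Ck_on 0 U f \<longleftrightarrow> continuous_on U f"
| "Ck_on (Suc m) U f \<longleftrightarrow>
     f differentiable_on U \<and> (\<forall>v. Ck_on m U (\<lambda>x. frechet_derivative f (at x) v))"

definition smooth_on :: "'a::euclidean_space set \<Rightarrow> ('a \<Rightarrow> 'b::euclidean_space) \<Rightarrow> bool" where
  "smooth_on U f \<longleftrightarrow> (\<forall>m. Ck_on m U f)"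

text \<open>For \<open>a = 0\<close> this is the whole space.\<close>

definition halfspace :: "real ^ 'n::finite \<Rightarrow> (real ^ 'n) set" where
  "halfspace a = {u. 0 \<le> a \<bullet> u}"

text \<open>
  A local parametrization is defined on \<open>U \<inter> halfspace a\<close>: an ordinary one for \<open>a = 0\<close>, one
  adapted to a boundary for \<open>a \<noteq> 0\<close>. In the latter case \<open>phi\<close> is smooth up to the boundary in
  the sense that it is (the restriction of) a smooth immersion of the open set \<open>U\<close>.
  The homeomorphism and \<open>openin\<close> conditions are what makes the hypersurface embedded.
\<close>

definition parametrization ::
  "'n::finite ambient set \<Rightarrow> (real ^ 'n \<Rightarrow> 'n ambient) \<Rightarrow> (real ^ 'n) set \<Rightarrow> real ^ 'n \<Rightarrow> bool" where
  "parametrization M phi U a \<longleftrightarrow>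
     open U \<and> smooth_on U phi \<and> (\<forall>u\<in>U. inj (frechet_derivative phi (at u))) \<and>
     openin (top_of_set M) (phi ` (U \<inter> halfspace a)) \<and>
     (\<exists>psi. homeomorphism (U \<inter> halfspace a) (phi ` (U \<inter> halfspace a)) phi psi)"

definition embedded_hypersurface :: "'n::finite ambient set \<Rightarrow> bool" where
  "embedded_hypersurface M \<longleftrightarrow>
     (\<forall>p\<in>M. \<exists>phi U a. parametrization M phi U a \<and> p \<in> phi ` (U \<inter> halfspace a))"

definition interior_points :: "'n::finite ambient set \<Rightarrow> 'n ambient set" where
  "interior_points M = {p. \<exists>phi U. parametrization M phi U 0 \<and> p \<in> phi ` U}"

definition boundary_points :: "'n::finite ambient set \<Rightarrow> 'n ambient set" where
  "boundary_points M = M - interior_points M"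

text \<open>The full \<open>n\<close>-dimensional linear tangent space, also at boundary points.\<close>

definition tangent_space :: "'n::finite ambient set \<Rightarrow> 'n ambient \<Rightarrow> 'n ambient set" where
  "tangent_space M p =
     {v. \<exists>phi U a u. parametrization M phi U a \<and> u \<in> U \<inter> halfspace a \<and> phi u = p \<and>
        v \<in> range (frechet_derivative phi (at u))}"

text \<open>A continuous unit normal to a smooth hypersurface is automatically smooth.\<close>

definition unit_normal :: "'n::finite ambient set \<Rightarrow> ('n ambient \<Rightarrow> 'n ambient) \<Rightarrow> bool" where
  "unit_normal M \<nu> \<longleftrightarrow>
     continuous_on M \<nu> \<and>
     (\<forall>p\<in>M. norm (\<nu> p) = 1 \<and> (\<forall>v\<in>tangent_space M p. v \<bullet> \<nu> p = 0))"


subsection \<open>Principal curvatures and translators\<close>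

text \<open>
  A vector \<open>xi\<close> of the parameter space induces the tangent field \<open>push phi xi\<close> along \<open>phi\<close>.
  For \<open>e\<^sub>i = push phi xi\<^sub>i\<close> and \<open>e\<^sub>j = push phi xi\<^sub>j\<close>, the ambient derivative of \<open>e\<^sub>j\<close> in the direction
  \<open>e\<^sub>i\<close> is the derivative of \<open>push phi xi\<^sub>j\<close> in the parameter direction \<open>xi\<^sub>i\<close>.
\<close>

definition push ::
  "(real ^ 'n::finite \<Rightarrow> 'n ambient) \<Rightarrow> real ^ 'n \<Rightarrow> real ^ 'n \<Rightarrow> 'n ambient" where
  "push phi xi u = frechet_derivative phi (at u) xi"

definition second_fundamental_form ::
  "(real ^ 'n::finite \<Rightarrow> 'n ambient) \<Rightarrow> ('n ambient \<Rightarrow> 'n ambient) \<Rightarrow> real ^ 'n \<Rightarrow>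
     real ^ 'n \<Rightarrow> real ^ 'n \<Rightarrow> real" where
  "second_fundamental_form phi \<nu> u xi eta =
     frechet_derivative (push phi eta) (at u) xi \<bullet> \<nu> (phi u)"

text \<open>
  \<open>lam\<close> lists the eigenvalues, with multiplicity, of the second fundamental form with respect to
  the induced metric: some orthonormal frame \<open>e\<^sub>i = push phi (b i) u\<close> at \<open>p\<close> diagonalizes it. Such
  a \<open>lam\<close> exists and is unique up to a permutation of its entries.
\<close>

definition principal_curvatures ::
  "'n::finite ambient set \<Rightarrow> ('n ambient \<Rightarrow> 'n ambient) \<Rightarrow> 'n ambient \<Rightarrow> real ^ 'n \<Rightarrow> bool" where
  "principal_curvatures M \<nu> p lam \<longleftrightarrow>
     (\<exists>phi U a u (b :: 'n \<Rightarrow> real ^ 'n).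
        parametrization M phi U a \<and> u \<in> U \<inter> halfspace a \<and> phi u = p \<and>
        (\<forall>i j. push phi (b i) u \<bullet> push phi (b j) u = (if i = j then 1 else 0)) \<and>
        (\<forall>i j. second_fundamental_form phi \<nu> u (b i) (b j) = (if i = j then lam $ i else 0)))"

definition translator ::
  "nat \<Rightarrow> 'n::finite ambient set \<Rightarrow> ('n ambient \<Rightarrow> 'n ambient) \<Rightarrow> bool" where
  "translator k M \<nu> \<longleftrightarrow>
     (\<forall>p\<in>M. \<exists>lam. principal_curvatures M \<nu> p lam \<and> S k lam \<noteq> 0 \<and> Q k lam = \<nu> p \<bullet> e_last)"

definition strictly_convex ::
  "'n::finite ambient set \<Rightarrow> ('n ambient \<Rightarrow> 'n ambient) \<Rightarrow> bool" where
  "strictly_convex M \<nu> \<longleftrightarrow>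
     (\<forall>p\<in>M. \<exists>lam. principal_curvatures M \<nu> p lam \<and> (\<forall>i. 0 < lam $ i))"

definition curvatures_in ::
  "'n::finite ambient set \<Rightarrow> ('n ambient \<Rightarrow> 'n ambient) \<Rightarrow> (real ^ 'n) set \<Rightarrow> bool" where
  "curvatures_in M \<nu> C \<longleftrightarrow> (\<forall>p\<in>M. \<exists>lam. principal_curvatures M \<nu> p lam \<and> lam \<in> C)"


subsection \<open>Relative position of two hypersurfaces\<close>

text \<open>
  \<open>M\<close> may touch \<open>N\<close> but never passes to its other side: near each common point \<open>q\<close>, along every
  line parallel to the normal of \<open>N\<close> at \<open>q\<close>, the points of \<open>M\<close> lie beyond those of \<open>N\<close>, always on
  the side of the same orientation \<open>sigma * \<nu>\<close> of \<open>N\<close>. (Writing both as graphs over the tangent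
  space of \<open>N\<close> at \<open>q\<close>, this is \<open>u\<^sub>M \<ge> u\<^sub>N\<close>, resp. \<open>u\<^sub>M \<le> u\<^sub>N\<close>, on the common domain.) It holds
  in particular if \<open>N\<close> is closed, separates the space, and \<open>M\<close> is in the closure of one component.
\<close>

definition at_one_side ::
  "'n::finite ambient set \<Rightarrow> 'n ambient set \<Rightarrow> ('n ambient \<Rightarrow> 'n ambient) \<Rightarrow> bool" where
  "at_one_side M N \<nu> \<longleftrightarrow>
     (\<exists>sigma\<in>{-1, 1::real}. \<forall>q\<in>M \<inter> N. \<exists>W. open W \<and> q \<in> W \<and>
        (\<forall>x\<in>M \<inter> W. \<forall>y\<in>N \<inter> W. \<forall>t. x = y + t *\<^sub>R \<nu> q \<longrightarrow> 0 \<le> sigma * t))"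

definition hyperplane :: "'n::finite ambient \<Rightarrow> real \<Rightarrow> 'n ambient set" where
  "hyperplane a c = {x. a \<bullet> x = c}"

definition transversal :: "'n::finite ambient set \<Rightarrow> 'n ambient \<Rightarrow> real \<Rightarrow> bool" where
  "transversal M a c \<longleftrightarrow>
     (\<forall>x\<in>M \<inter> hyperplane a c. {v + w | v w. v \<in> tangent_space M x \<and> a \<bullet> w = 0} = UNIV)"

text \<open>The points where a hypersurface ends: its boundary, and the limit points missing from it.\<close>

definition edge :: "'n::finite ambient set \<Rightarrow> 'n ambient set" where
  "edge M = closure M - interior_points M"

text \<open>
  Two hypersurfaces that coincide need not be equal as sets when one of them simply stops earlier
  (a small disc inside a translator satisfies every hypothesis of the interior principle).
  Coinciding therefore means: they agree near \<open>p\<close>; starting from there, either one stays inside the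
  other until the latter ends; and they are equal as sets if both are closed subsets of the ambient
  space and neither has its boundary in the interior of the other (e.g. no boundary at all).
\<close>

definition coincide :: "'n::finite ambient \<Rightarrow> 'n ambient set \<Rightarrow> 'n ambient set \<Rightarrow> bool" where
  "coincide p M N \<longleftrightarrow>
     (\<exists>W. open W \<and> p \<in> W \<and> M \<inter> W = N \<inter> W \<and>
        (\<forall>C. connected C \<and> C \<inter> W \<noteq> {} \<and> C \<subseteq> M - edge N \<longrightarrow> C \<subseteq> N) \<and>
        (\<forall>C. connected C \<and> C \<inter> W \<noteq> {} \<and> C \<subseteq> N - edge M \<longrightarrow> C \<subseteq> M)) \<and>
     (closed M \<and> closed N \<and>
        interior_points M \<inter> boundary_points N = {} \<and>
        interior_points N \<inter> boundary_points M = {} \<longrightarrow> M = N)"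

end

(*
  Since the curvature quotient of either hypersurface is positive, both normals point upwards, so
  that they agree wherever the tangent spaces do. Over the tangent hyperplane at such a point both
  hypersurfaces are graphs, and by homogeneity of Q_k the translator equation of a graph u with
  gradient g says that Q_k of the eigenvalues of the Hessian with respect to the induced metric is
  an affine function of g. No linearization is needed for the strong maximum principle: comparing
  with Hopf's barrier, the only quantitative input is that Q_k of a positive definite form grows
  linearly under rank-one updates, which follows from the log-concavity of elementary symmetric
  polynomials and the monotonicity of eigenvalues. Coincidence then spreads along connected sets
  up to the edge of the other hypersurface. At a common boundary point the hyperplane forces both
  graph domains to contain a common ball touching that point, and Hopf's lemma at the touching
  point produces an interior contact point inside the ball.
*)

theory Submission
  imports Defs
begin


subsection \<open>Elementary symmetric polynomials\<close>

text \<open>Strict convexity is available for \<open>M1\<close> only: the Hessian of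
  \<open>M2\<close> may degenerate, and \<open>Q\<close> may fail to grow there. So the barrier is
  always added to the Hessian of \<open>M1\<close>, with a sign chosen by the side on which
  \<open>M1\<close> lies, and \<open>M2\<close> enters only through monotonicity of \<open>Q\<close>
  on nonnegative forms. At the point of comparison the two gradients differ by that of the barrier,
  hence so do the two metrics and the two right-hand sides. As \<open>Q\<close> is homogeneous of
  degree one, the change of metric costs a factor \<open>1 + O(\<eta>)\<close>, which a large
  exponent \<open>\<alpha>\<close> outweighs. On the level of sets, agreement is carried through
  interior points, where the normals stay equal by continuity; boundary points are recovered as
  limits. The boundary principle ends the same way: the contact found in the tangent ball is only
  close to \<open>p\<close>, and agreement is transported back to \<open>p\<close>, while
  transversality keeps the boundary of either hypersurface away from the interior of the
  other.\<close>

definition esym :: "nat \<Rightarrow> 'a set \<Rightarrow> ('a \<Rightarrow> real) \<Rightarrow> real" where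
  "esym l I x = (\<Sum>A | A \<subseteq> I \<and> card A = l. \<Prod>i\<in>A. x i)"

lemma S_eq_esym: "S l lam = esym l UNIV (($) lam)"
  by (simp add: S_def esym_def)

lemma esym_0 [simp]: "finite I \<Longrightarrow> esym 0 I x = 1"
proof -
  assume "finite I"
  then have "{A. A \<subseteq> I \<and> card A = 0} = {{}}"
    by (auto simp: card_eq_0_iff dest: finite_subset)
  then show ?thesis by (simp add: esym_def)
qed

lemma esym_empty [simp]: "esym (Suc l) {} x = 0"
  by (simp add: esym_def)

text \<open>A subset of \<open>insert j I\<close> either avoids \<open>j\<close> or contains it.
  Splitting off one coordinate in this way is the reason for working with an arbitrary index set
  \<open>I\<close>.\<close>

lemma esym_insert:
  assumes "finite I" "j \<notin> I"
  shows "esym (Suc l) (insert j I) x = esym (Suc l) I x + x j * esym l I x"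
proof -
  have split: "{A. A \<subseteq> insert j I \<and> card A = Suc l} =
      {A. A \<subseteq> I \<and> card A = Suc l} \<union> insert j ` {A. A \<subseteq> I \<and> card A = l}" (is "?L = ?R1 \<union> ?R2")
  proof (intro set_eqI iffI)
    fix A assume A: "A \<in> ?L"
    then have "finite A" using assms finite_subset by fastforce
    show "A \<in> ?R1 \<union> ?R2"
    proof (cases "j \<in> A")
      case True
      then have "A = insert j (A - {j})" "A - {j} \<subseteq> I" "card (A - {j}) = l"
        using A \<open>finite A\<close> by auto
      then show ?thesis by blast
    next
      case False then show ?thesis using A by auto
    qed
  next
    fix A assume "A \<in> ?R1 \<union> ?R2"
    then consider "A \<in> ?R1" | B where "A = insert j B" "B \<subseteq> I" "card B = l" by blast
    then show "A \<in> ?L"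
    proof cases
      case 2
      then have "finite B" "j \<notin> B" using assms finite_subset by auto
      then show ?thesis using 2 by auto
    qed auto
  qed
  have inj: "inj_on (insert j) {A. A \<subseteq> I \<and> card A = l}"
    using assms(2) by (auto simp: inj_on_def)
  have "esym (Suc l) (insert j I) x =
      (\<Sum>A\<in>?R1. \<Prod>i\<in>A. x i) + (\<Sum>A\<in>?R2. \<Prod>i\<in>A. x i)"
    unfolding esym_def split using assms by (intro sum.union_disjoint) auto
  also have "(\<Sum>A\<in>?R2. \<Prod>i\<in>A. x i) = (\<Sum>A | A \<subseteq> I \<and> card A = l. \<Prod>i\<in>insert j A. x i)"
    by (simp add: sum.reindex[OF inj])
  also have "\<dots> = (\<Sum>A | A \<subseteq> I \<and> card A = l. x j * (\<Prod>i\<in>A. x i))"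
  proof (rule sum.cong[OF refl])
    fix A assume "A \<in> {A. A \<subseteq> I \<and> card A = l}"
    then have "finite A" "j \<notin> A" using assms finite_subset by auto
    then show "(\<Prod>i\<in>insert j A. x i) = x j * (\<Prod>i\<in>A. x i)" by simp
  qed
  finally show ?thesis by (simp add: esym_def sum_distrib_left)
qed

lemma esym_nonneg: "(\<And>i. i \<in> I \<Longrightarrow> 0 \<le> x i) \<Longrightarrow> 0 \<le> esym l I x"
  unfolding esym_def by (intro sum_nonneg prod_nonneg) blast

lemma esym_mono:
  assumes "\<And>i. i \<in> I \<Longrightarrow> 0 \<le> x i" "\<And>i. i \<in> I \<Longrightarrow> x i \<le> y i"
  shows "esym l I x \<le> esym l I y"
  unfolding esym_def using assms by (intro sum_mono prod_mono) blast

lemma esym_pos: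
  assumes "finite I" "\<And>i. i \<in> I \<Longrightarrow> 0 < x i" "l \<le> card I"
  shows "0 < esym l I x"
proof -
  obtain A where A: "A \<subseteq> I" "card A = l"
    using assms(3) obtain_subset_with_card_n by blast
  have fin: "finite {A. A \<subseteq> I \<and> card A = l}" using assms(1) by simp
  have "\<And>A. A \<subseteq> I \<Longrightarrow> 0 < (\<Prod>i\<in>A. x i)" using assms(2) by (intro prod_pos) blast
  then show ?thesis
    unfolding esym_def using A fin by (intro sum_pos) auto
qed

text \<open>Both sides are quadratic polynomials in the new coordinate \<open>x j\<close> and are
  compared coefficient by coefficient. The linear coefficient involves the indices
  \<open>a - 1\<close> and \<open>b + 2\<close>, which are further apart than those of the goal;
  hence the induction over all \<open>a \<le> b\<close>, although only \<open>a = b\<close> is used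
  for \<open>Q\<close>.\<close>

lemma esym_log_concave:
  assumes "finite I" "\<And>i. i \<in> I \<Longrightarrow> 0 \<le> x i" "a \<le> b"
  shows "esym a I x * esym (Suc (Suc b)) I x \<le> esym (Suc a) I x * esym (Suc b) I x"
  using assms
proof (induction I arbitrary: a b rule: finite_induct)
  case empty
  then show ?case by simp
next
  case (insert j I)
  let ?e = "\<lambda>l. esym l I x"
  have xj: "0 \<le> x j" and nn: "\<And>l. 0 \<le> ?e l"
    using insert.prems by (auto intro: esym_nonneg)
  have IH: "\<And>a b. a \<le> b \<Longrightarrow> ?e a * ?e (Suc (Suc b)) \<le> ?e (Suc a) * ?e (Suc b)"
    using insert by auto
  note ins = esym_insert[OF insert.hyps]
  show ?case
  proof (cases a)
    case 0
    have "?e (Suc (Suc b)) \<le> ?e 1 * ?e (Suc b)" using IH[of 0 b] insert.hyps by simp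
    moreover have "0 \<le> x j * (?e 1 * ?e b)" "0 \<le> x j * (x j * ?e b)"
      using xj nn by simp_all
    ultimately show ?thesis
      using 0 insert.hyps by (simp add: ins algebra_simps)
  next
    case (Suc a')
    then obtain b' where b: "b = Suc b'" "a' \<le> b'" using \<open>a \<le> b\<close> by (cases b) auto
    have 1: "?e (Suc a') * ?e (Suc (Suc (Suc b'))) \<le> ?e (Suc (Suc a')) * ?e (Suc (Suc b'))"
      using IH[of "Suc a'" "Suc b'"] b by simp
    have "?e a' * ?e (Suc (Suc (Suc b'))) \<le> ?e (Suc a') * ?e (Suc (Suc b'))"
      using IH[of a' "Suc b'"] b by simp
    \<comment> \<open>For \<open>a' = b'\<close> both products agree up to order; otherwise
      \<open>Suc a' \<le> b'\<close> and the induction hypothesis applies a second time.\<close>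
    also have "\<dots> \<le> ?e (Suc (Suc a')) * ?e (Suc b')"
      using IH[of "Suc a'" b'] b by (cases "a' = b'") (auto simp: mult.commute)
    finally have 2: "x j * (?e a' * ?e (Suc (Suc (Suc b')))) \<le> x j * (?e (Suc (Suc a')) * ?e (Suc b'))"
      using xj by (rule mult_left_mono)
    have 3: "(x j)\<^sup>2 * (?e a' * ?e (Suc (Suc b'))) \<le> (x j)\<^sup>2 * (?e (Suc a') * ?e (Suc b'))"
      using IH[of a' b'] b by (intro mult_left_mono) auto
    show ?thesis
      unfolding Suc b(1) ins using 1 2 3 by (simp add: algebra_simps power2_eq_square)
  qed
qed

text \<open>In the expansion for \<open>a = b\<close> the coefficient of
  \<open>(x j)\<^sup>2\<close> is again a deficit of this kind, with the order lowered by one.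
  Lowering the order step by step collects \<open>Suc k\<close> factors \<open>c\<^sup>2\<close>;
  the other terms are nonnegative by \<open>esym_log_concave\<close>.\<close>

lemma esym_log_concave_strict:
  assumes "finite I" "\<And>i. i \<in> I \<Longrightarrow> c \<le> x i" "0 < c" "Suc k \<le> card I"
  shows "c ^ (2 * Suc k) \<le> (esym (Suc k) I x)\<^sup>2 - esym k I x * esym (Suc (Suc k)) I x"
  using assms
proof (induction I arbitrary: k rule: finite_induct)
  case empty
  then show ?case by simp
next
  case (insert j I)
  let ?e = "\<lambda>l. esym l I x"
  have x0: "0 \<le> x i" if "i \<in> insert j I" for i using insert.prems(1)[OF that] insert.prems(2) by simp
  then have xj: "0 \<le> x j" and nn: "\<And>l. 0 \<le> ?e l"
    by (auto intro: esym_nonneg)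
  have LC: "\<And>a b. a \<le> b \<Longrightarrow> ?e a * ?e (Suc (Suc b)) \<le> ?e (Suc a) * ?e (Suc b)"
    using insert.hyps x0 by (intro esym_log_concave) auto
  have xc: "c\<^sup>2 \<le> (x j)\<^sup>2" using insert.prems by (intro power_mono) auto
  note ins = esym_insert[OF insert.hyps]
  define D where "D = (\<lambda>k. (?e (Suc k))\<^sup>2 - ?e k * ?e (Suc (Suc k)))"
  have D0: "0 \<le> D k" for k using LC[of k k] by (simp add: D_def power2_eq_square)
  have IH: "Suc k \<le> card I \<Longrightarrow> c ^ (2 * Suc k) \<le> D k" for k
    using insert unfolding D_def by auto
  show ?case
  proof (cases k)
    case 0
    have eq: "(esym (Suc k) (insert j I) x)\<^sup>2 - esym k (insert j I) x * esym (Suc (Suc k)) (insert j I) x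
      = D 0 + x j * ?e 1 + (x j)\<^sup>2"
      using 0 insert.hyps by (simp add: D_def ins algebra_simps power2_eq_square)
    have "0 \<le> x j * ?e 1" using xj nn by simp
    then show ?thesis using eq D0[of 0] xc 0 by simp
  next
    case (Suc k')
    have eq: "(esym (Suc k) (insert j I) x)\<^sup>2 - esym k (insert j I) x * esym (Suc (Suc k)) (insert j I) x
      = D k + x j * (?e (Suc (Suc k')) * ?e (Suc k') - ?e k' * ?e (Suc (Suc (Suc k')))) + (x j)\<^sup>2 * D k'"
      unfolding Suc by (simp add: D_def ins algebra_simps power2_eq_square)
    have m: "0 \<le> x j * (?e (Suc (Suc k')) * ?e (Suc k') - ?e k' * ?e (Suc (Suc (Suc k'))))"
      using LC[of k' "Suc k'"] xj by (simp add: mult.commute)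
    have p: "c\<^sup>2 * c ^ (2 * Suc k') \<le> (x j)\<^sup>2 * D k'"
      using insert.prems insert.hyps xc IH[of k'] Suc by (intro mult_mono) auto
    have "c\<^sup>2 * c ^ (2 * Suc k') = c ^ (2 * Suc k)" unfolding Suc by (simp add: power2_eq_square)
    then show ?thesis using eq m p D0[of k] by linarith
  qed
qed

section \<open>Growth of the curvature quotient in each coordinate\<close>

definition Qf :: "nat \<Rightarrow> 'a set \<Rightarrow> ('a \<Rightarrow> real) \<Rightarrow> real" where
  "Qf k I x = esym (Suc k) I x / esym k I x"

lemma Q_eq_Qf: "Q k lam = Qf k UNIV (($) lam)"
  by (simp add: Q_def Qf_def S_eq_esym)

lemma esym_cong: "(\<And>i. i \<in> I \<Longrightarrow> x i = y i) \<Longrightarrow> esym l I x = esym l I y"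
  unfolding esym_def by (intro sum.cong prod.cong) auto

text \<open>As a function of the single coordinate \<open>j\<close> the quotient is a Moebius
  function whose coefficients are symmetric functions of the other coordinates. Its determinant is
  the log-concavity deficit over \<open>I\<close>.\<close>

lemma Qf_coordinate_diff:
  assumes "finite I" "j \<notin> I" "\<And>i. i \<in> I \<Longrightarrow> x i = y i"
    and "esym (Suc k) (insert j I) x \<noteq> 0" "esym (Suc k) (insert j I) y \<noteq> 0"
  shows "Qf (Suc k) (insert j I) y - Qf (Suc k) (insert j I) x =
    (y j - x j) * ((esym (Suc k) I x)\<^sup>2 - esym k I x * esym (Suc (Suc k)) I x)
      / (esym (Suc k) (insert j I) x * esym (Suc k) (insert j I) y)"
proof -
  have e: "esym l I y = esym l I x" for l using assms(3) by (intro esym_cong) auto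
  show ?thesis
    using assms(4,5) unfolding Qf_def esym_insert[OF assms(1,2)] e
    by (simp add: divide_simps) (simp add: algebra_simps power2_eq_square)
qed

lemma Q_mono:
  fixes lam mu :: "real ^ 'n::finite"
  assumes k: "0 < k" and mu: "\<And>i. 0 \<le> mu $ i" and le: "\<And>i. mu $ i \<le> lam $ i" and S: "0 < S k mu"
  shows "Q k mu \<le> Q k lam"
proof -
  obtain k' where k': "k = Suc k'" using k by (cases k) auto
  \<comment> \<open>A hybrid vector: the coordinates in \<open>T\<close> have already been
    raised.\<close>
  define v where "v = (\<lambda>T i. if i \<in> T then lam $ i else mu $ i)"
  have v: "mu $ i \<le> v T i" "0 \<le> v T i" for T i using mu le order_trans[OF mu le] by (auto simp: v_def)
  have pos: "0 < esym k UNIV (v T)" for T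
    using S esym_mono[of UNIV "($) mu" "v T" k] v mu by (force simp: S_eq_esym)
  have "Qf k UNIV (($) mu) \<le> Qf k UNIV (v T)" for T
  proof (induction T rule: finite_induct[OF finite])
    case 1
    have "v {} = ($) mu" by (simp add: v_def)
    then show ?case by simp
  next
    case (2 j T)
    let ?I = "UNIV - {j}"
    have U: "UNIV = insert j ?I" by auto
    have fin: "finite ?I" "j \<notin> ?I" by auto
    have eq: "\<And>i. i \<in> ?I \<Longrightarrow> v T i = v (insert j T) i" by (auto simp: v_def)
    have d: "Qf k UNIV (v (insert j T)) - Qf k UNIV (v T) =
      (v (insert j T) j - v T j) * ((esym (Suc k') ?I (v T))\<^sup>2 - esym k' ?I (v T) * esym (Suc (Suc k')) ?I (v T))
        / (esym k UNIV (v T) * esym k UNIV (v (insert j T)))"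
      using Qf_coordinate_diff[OF fin eq, where k=k'] pos[of T] pos[of "insert j T"]
      unfolding k' U[symmetric] by simp
    have "v T j \<le> v (insert j T) j" using le by (simp add: v_def)
    moreover have "0 \<le> (esym (Suc k') ?I (v T))\<^sup>2 - esym k' ?I (v T) * esym (Suc (Suc k')) ?I (v T)"
      using esym_log_concave[of ?I "v T" k' k'] v by (simp add: power2_eq_square)
    ultimately have "0 \<le> Qf k UNIV (v (insert j T)) - Qf k UNIV (v T)"
      unfolding d using pos[of T] pos[of "insert j T"]
      by (intro divide_nonneg_pos mult_nonneg_nonneg mult_pos_pos) auto
    then show ?case using 2 by linarith
  qed
  from this[of UNIV] show ?thesis by (simp add: Q_eq_Qf v_def)
qed

text \<open>The deficit lives on the \<open>n - 1\<close> coordinates that stay fixed, so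
  \<open>k \<le> n - 1\<close> is exactly what \<open>esym_log_concave_strict\<close> requires for a
  positive lower bound.\<close>

lemma Q_gain:
  fixes c C :: real
  assumes k: "0 < k" "k \<le> CARD('n::finite) - 1" and c: "0 < c" "c \<le> C"
  obtains \<gamma> where "0 < \<gamma>"
    "\<And>lam mu :: real ^ 'n. (\<And>i. c \<le> mu $ i) \<Longrightarrow> (\<And>i. mu $ i \<le> lam $ i) \<Longrightarrow> (\<And>i. lam $ i \<le> C)
      \<Longrightarrow> Q k mu + \<gamma> * (\<Sum>i\<in>UNIV. lam $ i - mu $ i) \<le> Q k lam"
proof -
  obtain k' where k': "k = Suc k'" using k by (cases k) auto
  \<comment> \<open>The value at the constant vector \<open>C\<close> bounds every denominator. Thus
    \<open>\<gamma>\<close> is the least possible deficit divided by the largest possible product of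
    two denominators.\<close>
  define E where "E = esym k (UNIV::'n set) (\<lambda>i. C)"
  have E: "0 < E" unfolding E_def using k c by (intro esym_pos) auto
  define \<gamma> where "\<gamma> = c ^ (2 * k) / (E * E)"
  have \<gamma>: "0 < \<gamma>" using c E by (simp add: \<gamma>_def)
  have main: "Q k mu + \<gamma> * (\<Sum>i\<in>UNIV. lam $ i - mu $ i) \<le> Q k lam"
    if mu: "\<And>i. c \<le> mu $ i" and le: "\<And>i. mu $ i \<le> lam $ i" and lam: "\<And>i. lam $ i \<le> C"
    for lam mu :: "real ^ 'n"
  proof -
    define v where "v = (\<lambda>T i. if i \<in> T then lam $ i else mu $ i)"
    have v: "c \<le> v T i" "v T i \<le> C" for T i
      using mu[of i] le[of i] lam[of i] by (auto simp: v_def)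
    have v0: "0 < v T i" for T i using v(1)[of T i] c by linarith
    have pos: "0 < esym k UNIV (v T)" for T
      using v0 k by (intro esym_pos) auto
    have ub: "esym k UNIV (v T) \<le> E" for T
      unfolding E_def using v v0 by (intro esym_mono) (auto simp: less_imp_le)
    have "Qf k UNIV (($) mu) + \<gamma> * (\<Sum>i\<in>T. lam $ i - mu $ i) \<le> Qf k UNIV (v T)" for T
    proof (induction T rule: finite_induct[OF finite])
      case 1
      have "v {} = ($) mu" by (simp add: v_def)
      then show ?case by simp
    next
      case (2 j T)
      let ?I = "UNIV - {j}"
      have U: "UNIV = insert j ?I" by auto
      have fin: "finite ?I" "j \<notin> ?I" by auto
      have eq: "\<And>i. i \<in> ?I \<Longrightarrow> v T i = v (insert j T) i" by (auto simp: v_def)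
      let ?N = "(esym (Suc k') ?I (v T))\<^sup>2 - esym k' ?I (v T) * esym (Suc (Suc k')) ?I (v T)"
      have d: "Qf k UNIV (v (insert j T)) - Qf k UNIV (v T) =
        (v (insert j T) j - v T j) * ?N / (esym k UNIV (v T) * esym k UNIV (v (insert j T)))"
        using Qf_coordinate_diff[OF fin eq, where k=k'] pos[of T] pos[of "insert j T"]
        unfolding k' U[symmetric] by simp
      have vj: "v (insert j T) j - v T j = lam $ j - mu $ j" using 2 by (simp add: v_def)
      have N: "c ^ (2 * k) \<le> ?N"
        unfolding k' using v c k k' by (intro esym_log_concave_strict) (auto simp: card_Diff_singleton)
      have "\<gamma> * (lam $ j - mu $ j) = (lam $ j - mu $ j) * c ^ (2 * k) / (E * E)"
        by (simp add: \<gamma>_def)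
      also have "\<dots> \<le> (lam $ j - mu $ j) * ?N / (esym k UNIV (v T) * esym k UNIV (v (insert j T)))"
        using N le[of j] pos ub c less_imp_le[OF pos] less_imp_le[OF E]
        by (intro frac_le mult_left_mono mult_mono mult_pos_pos mult_nonneg_nonneg order_trans[OF _ N]) auto
      finally have "\<gamma> * (lam $ j - mu $ j) \<le> Qf k UNIV (v (insert j T)) - Qf k UNIV (v T)"
        unfolding d vj .
      then show ?case using 2 by (simp add: algebra_simps)
    qed
    from this[of UNIV] show ?thesis by (simp add: Q_eq_Qf v_def)
  qed
  show ?thesis using that[OF \<gamma> main] by blast
qed

section \<open>Positivity, symmetry and homogeneity of \<open>S\<close> and \<open>Q\<close>\<close>

lemma S_nonneg: "(\<And>i. 0 \<le> lam $ i) \<Longrightarrow> 0 \<le> S l lam"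
  by (simp add: S_eq_esym esym_nonneg)

lemma S_pos: "(\<And>i. 0 < lam $ i) \<Longrightarrow> l \<le> CARD('n) \<Longrightarrow> 0 < S l (lam :: real ^ 'n::finite)"
  by (simp add: S_eq_esym esym_pos)

lemma S_mono: "(\<And>i. 0 \<le> mu $ i) \<Longrightarrow> (\<And>i. mu $ i \<le> lam $ i) \<Longrightarrow> S l mu \<le> S l lam"
  by (simp add: S_eq_esym esym_mono)

lemma S_permute:
  assumes "\<pi> permutes (UNIV :: 'n::finite set)"
  shows "S l (\<chi> i. lam $ \<pi> i) = S l (lam :: real ^ 'n)"
proof -
  have b: "bij \<pi>" using assms by (rule permutes_bij)
  then have inj: "inj_on \<pi> A" for A using bij_is_inj inj_on_subset by blast
  have "S l (\<chi> i. lam $ \<pi> i) = (\<Sum>A | card A = l. \<Prod>i\<in>\<pi> ` A. lam $ i)"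
    unfolding S_def by (simp add: prod.reindex[OF inj])
  also have "\<dots> = S l lam"
    unfolding S_def
  proof (rule sum.reindex_bij_betw[where h="(`) \<pi>"])
    show "bij_betw ((`) \<pi>) {A. card A = l} {A :: 'n set. card A = l}"
      unfolding bij_betw_def
    proof (intro conjI set_eqI iffI)
      show "inj_on ((`) \<pi>) {A. card A = l}" 
        using inj_image_eq_iff[OF bij_is_inj[OF b]] by (auto simp: inj_on_def)
      fix B :: "'n set" assume "B \<in> {A. card A = l}"
      then have "B = \<pi> ` (inv \<pi> ` B)" "card (inv \<pi> ` B) = l"
        using b by (auto simp: image_comp bij_is_surj surj_iff[THEN iffD1] card_image
            bij_imp_bij_inv[THEN bij_is_inj, THEN inj_on_subset])
      then show "B \<in> (`) \<pi> ` {A. card A = l}" by blast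
    qed (auto simp: card_image[OF inj])
  qed
  finally show ?thesis .
qed

lemma Q_permute: "\<pi> permutes UNIV \<Longrightarrow> Q k (\<chi> i. lam $ \<pi> i) = Q k lam"
  by (simp add: Q_def S_permute)

lemma S_scale: "S l (r *\<^sub>R lam) = r ^ l * S l lam"
proof -
  have "(\<Prod>i\<in>A. (r *\<^sub>R lam) $ i) = r ^ card A * (\<Prod>i\<in>A. lam $ i)" for A
    by (simp add: prod.distrib)
  then show ?thesis by (simp add: S_def sum_distrib_left)
qed

lemma Q_scale: "r \<noteq> 0 \<Longrightarrow> Q k (r *\<^sub>R lam) = r * Q k lam"
  by (simp add: Q_def S_scale)


subsection \<open>Eigenvalues of a form with respect to a metric\<close>

definition symform :: "('a::euclidean_space \<Rightarrow> 'a \<Rightarrow> real) \<Rightarrow> bool" where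
  "symform B \<longleftrightarrow> bilinear B \<and> (\<forall>x y. B x y = B y x)"

definition inner_form :: "('a::euclidean_space \<Rightarrow> 'a \<Rightarrow> real) \<Rightarrow> bool" where
  "inner_form G \<longleftrightarrow> symform G \<and> (\<forall>x. x \<noteq> 0 \<longrightarrow> 0 < G x x)"

text \<open>The generalized eigenvalue problem, phrased through a diagonalizing frame as in
  \<open>principal_curvatures\<close>, so that a frame of the hypersurface can be transferred as it
  stands.\<close>

definition eigs ::
  "(real ^ 'n::finite \<Rightarrow> real ^ 'n \<Rightarrow> real) \<Rightarrow> (real ^ 'n \<Rightarrow> real ^ 'n \<Rightarrow> real) \<Rightarrow> real ^ 'n \<Rightarrow> bool" where
  "eigs G H lam \<longleftrightarrow> (\<exists>b :: 'n \<Rightarrow> real ^ 'n. \<forall>i j.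
     G (b i) (b j) = (if i = j then 1 else 0) \<and> H (b i) (b j) = (if i = j then lam $ i else 0))"

lemma symform_bb: "symform B \<Longrightarrow> bounded_bilinear B"
  by (simp add: symform_def bilinear_conv_bounded_bilinear)

lemma inner_form_bb: "inner_form B \<Longrightarrow> bounded_bilinear B"
  by (simp add: inner_form_def symform_bb)

lemma inner_form_nonneg: "inner_form G \<Longrightarrow> 0 \<le> G x x"
  by (cases "x = 0") (auto simp: inner_form_def less_imp_le bounded_bilinear.zero_left[OF symform_bb])

lemma symform_upper:
  assumes "symform B"
  obtains C where "0 < C" "\<And>x. \<bar>B x x\<bar> \<le> C * (x \<bullet> x)"
proof -
  obtain K where K: "0 < K" "\<And>x y. norm (B x y) \<le> norm x * norm y * K"
    using bounded_bilinear.pos_bounded[OF symform_bb[OF assms]] by blast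
  show ?thesis
    using that[OF K(1)] K(2)[of x x for x] by (simp add: dot_square_norm power2_eq_square mult.commute)
qed

lemma inner_form_lower:
  assumes G: "inner_form (G :: 'a::euclidean_space \<Rightarrow> 'a \<Rightarrow> real)"
  obtains c where "0 < c" "\<And>x. c * (x \<bullet> x) \<le> G x x"
proof -
  note bb = inner_form_bb[OF G]
  have ne: "sphere (0::'a) 1 \<noteq> {}" using vector_choose_size[of 1] by (force simp: dist_norm)
  have "continuous_on (sphere 0 1) (\<lambda>x. G x x)"
    by (intro bounded_bilinear.continuous_on[OF bb] continuous_intros)
  then obtain z where z: "z \<in> sphere 0 1" "\<And>x. x \<in> sphere 0 1 \<Longrightarrow> G z z \<le> G x x"
    using continuous_attains_inf[OF compact_sphere ne] by blast
  have "G z z * (x \<bullet> x) \<le> G x x" for x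
  proof (cases "x = 0")
    case False
    have "G z z \<le> G (x /\<^sub>R norm x) (x /\<^sub>R norm x)" using False by (intro z(2)) simp
    also have "\<dots> = G x x / (x \<bullet> x)"
      by (simp add: bounded_bilinear.scaleR_left[OF bb] bounded_bilinear.scaleR_right[OF bb]
          dot_square_norm power2_eq_square divide_inverse)
    finally show ?thesis using False by (simp add: pos_le_divide_eq)
  qed (simp add: bounded_bilinear.zero_left[OF bb])
  moreover have "0 < G z z"
    using G z(1) unfolding inner_form_def by (metis mem_sphere_0 norm_zero zero_neq_one)
  ultimately show ?thesis using that by blast
qed

text \<open>Pairing with the \<open>b j\<close> recovers the coefficients of a combination, so the
  combination map \<open>T\<close> is injective, hence surjective since there are \<open>n\<close>
  coefficients.\<close>

lemma inner_form_expand: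
  fixes b :: "'n::finite \<Rightarrow> real ^ 'n"
  assumes G: "inner_form G" and b: "\<And>i j. G (b i) (b j) = (if i = j then 1 else 0)"
  shows "v = (\<Sum>i\<in>UNIV. G v (b i) *\<^sub>R b i)"
proof -
  note bb = inner_form_bb[OF G]
  define T :: "real ^ 'n \<Rightarrow> real ^ 'n" where "T = (\<lambda>c. \<Sum>i\<in>UNIV. (c $ i) *\<^sub>R b i)"
  have GT: "G (T c) (b j) = c $ j" for c j
    by (simp add: T_def bounded_bilinear.sum_left[OF bb] bounded_bilinear.scaleR_left[OF bb] b
        if_distrib cong: if_cong)
  have lin: "linear T"
    by (rule linearI) (simp_all add: T_def algebra_simps sum.distrib scaleR_sum_right)
  have "inj T"
    by (rule injI) (metis GT vec_eq_iff)
  then have "surj T" using lin linear_injective_imp_surjective by blast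
  then obtain c where "v = T c" by blast
  then show ?thesis using GT[of c] by (simp add: T_def)
qed

lemma form_expand:
  fixes b :: "'n::finite \<Rightarrow> real ^ 'n"
  assumes G: "inner_form G" and b: "\<And>i j. G (b i) (b j) = (if i = j then 1 else 0)"
    and H: "symform H" and d: "\<And>i j. H (b i) (b j) = (if i = j then lam $ i else 0)"
  shows "H v v = (\<Sum>i\<in>UNIV. lam $ i * (G v (b i))\<^sup>2)"
proof -
  note bb = symform_bb[OF H]
  have "H (\<Sum>i\<in>UNIV. G v (b i) *\<^sub>R b i) (\<Sum>i\<in>UNIV. G v (b i) *\<^sub>R b i) = (\<Sum>i\<in>UNIV. lam $ i * (G v (b i))\<^sup>2)"
    by (simp add: bounded_bilinear.sum_left[OF bb] bounded_bilinear.scaleR_left[OF bb] d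
        bounded_bilinear.sum_right[OF bb] bounded_bilinear.scaleR_right[OF bb] if_distrib
        power2_eq_square algebra_simps cong: if_cong)
  then show ?thesis using inner_form_expand[OF G b, of v] by simp
qed

lemma norm_expand:
  fixes b :: "'n::finite \<Rightarrow> real ^ 'n"
  assumes G: "inner_form G" and b: "\<And>i j. G (b i) (b j) = (if i = j then 1 else 0)"
  shows "G v v = (\<Sum>i\<in>UNIV. (G v (b i))\<^sup>2)"
  using form_expand[OF G b, of G "\<chi> i. 1"] G b by (simp add: inner_form_def)

text \<open>A dimension count: \<open>T\<close> maps \<open>V\<close> into the span of at most
  \<open>card J\<close> vectors and so cannot be injective on \<open>V\<close>.\<close>

lemma exists_orthogonal:
  fixes b :: "'i \<Rightarrow> 'a::euclidean_space"
  assumes G: "inner_form G" and fin: "finite J"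
    and b: "\<And>i j. i \<in> J \<Longrightarrow> j \<in> J \<Longrightarrow> G (b i) (b j) = (if i = j then 1 else 0)"
    and V: "subspace V" "card J < dim V"
  obtains v where "v \<in> V" "v \<noteq> 0" "\<And>j. j \<in> J \<Longrightarrow> G v (b j) = 0"
proof -
  note bb = inner_form_bb[OF G]
  define T where "T = (\<lambda>v. \<Sum>j\<in>J. G v (b j) *\<^sub>R b j)"
  have lin: "linear T"
    by (rule linearI) (simp_all add: T_def bounded_bilinear.add_left[OF bb]
        bounded_bilinear.scaleR_left[OF bb] algebra_simps sum.distrib scaleR_sum_right)
  have "T ` V \<subseteq> span (b ` J)"
    by (auto simp: T_def intro!: span_sum span_scale intro: span_base)
  then have "dim (T ` V) \<le> card (b ` J)"
    using fin by (intro dim_le_card) auto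
  then have "dim (T ` V) < dim V" using card_image_le[OF fin, of b] V(2) by linarith
  then have "\<not> inj_on T (span V)" using dim_image_eq[OF lin, of V] by auto
  then have "\<not> inj_on T V" using V(1) by (metis span_eq_iff)
  then obtain x y where xy: "x \<in> V" "y \<in> V" "x \<noteq> y" "T x = T y" by (auto simp: inj_on_def)
  have T0: "T (x - y) = 0" using xy(4) linear_diff[OF lin] by simp
  have "G (x - y) (b j) = 0" if j: "j \<in> J" for j
  proof -
    have "G (T (x - y)) (b j) = (\<Sum>i\<in>J. G (x - y) (b i) * (if i = j then 1 else 0))"
      unfolding T_def bounded_bilinear.sum_left[OF bb] bounded_bilinear.scaleR_left[OF bb]
      using b j by (intro sum.cong) auto
    also have "\<dots> = G (x - y) (b j)" using fin j by (simp add: if_distrib cong: if_cong)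
    finally show ?thesis using T0 bounded_bilinear.zero_left[OF bb] by simp
  qed
  then show ?thesis using that[of "x - y"] xy V(1) by (simp add: subspace_diff)
qed

text \<open>Turns a comparison of counts above each threshold into a pairing, without sorting: a
  minimum of \<open>f\<close> is paired with a minimum of \<open>g\<close> and both are
  removed.\<close>

lemma count_matching:
  fixes f :: "'a \<Rightarrow> real" and g :: "'b \<Rightarrow> real"
  assumes "finite A" "finite B" "card A = card B"
    and "\<And>i. i \<in> A \<Longrightarrow> card {j\<in>A. f i \<le> f j} \<le> card {j\<in>B. f i \<le> g j}"
  shows "\<exists>h. bij_betw h B A \<and> (\<forall>i\<in>B. f (h i) \<le> g i)"
  using assms
proof (induction "card A" arbitrary: A B)
  case 0
  then show ?case by (intro exI[of _ "\<lambda>_. undefined"]) (auto simp: bij_betw_def)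
next
  case (Suc m)
  then have ne: "A \<noteq> {}" "B \<noteq> {}" by auto
  obtain i0 where i0: "i0 \<in> A" "\<And>i. i \<in> A \<Longrightarrow> f i0 \<le> f i"
    using ex_min_if_finite[of "f ` A"] Suc.prems(1) ne(1)
    by (metis (no_types, lifting) arg_min_if_finite(1) arg_min_least)
  obtain j0 where j0: "j0 \<in> B" "\<And>j. j \<in> B \<Longrightarrow> g j0 \<le> g j"
    using Suc.prems(2) ne(2) by (metis (no_types, lifting) arg_min_if_finite(1) arg_min_least)
  have all: "\<And>j. j \<in> B \<Longrightarrow> f i0 \<le> g j"
  proof -
    have "{j\<in>A. f i0 \<le> f j} = A" using i0 by auto
    then have "card B \<le> card {j\<in>B. f i0 \<le> g j}" using Suc.prems(3,4) i0(1) by metis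
    then have "{j\<in>B. f i0 \<le> g j} = B" using Suc.prems(2) by (intro card_seteq) auto
    then show "\<And>j. j \<in> B \<Longrightarrow> f i0 \<le> g j" by blast
  qed
  let ?A = "A - {i0}" and ?B = "B - {j0}"
  have cards: "card ?A = m" "card ?B = m" using Suc.hyps(2) Suc.prems i0 j0 by simp_all
  have "\<exists>h. bij_betw h ?B ?A \<and> (\<forall>i\<in>?B. f (h i) \<le> g i)"
  proof (rule Suc.hyps(1))
    fix i assume i: "i \<in> ?A"
    have sub: "card {j\<in>?A. f i \<le> f j} \<le> m"
      using cards(1) Suc.prems(1) card_mono[of ?A "{j\<in>?A. f i \<le> f j}"] by auto
    show "card {j\<in>?A. f i \<le> f j} \<le> card {j\<in>?B. f i \<le> g j}"
    \<comment> \<open>Either the threshold is so low that all of \<open>?B\<close> exceeds it, or it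
      lies above both removed values and the two counts are the old ones.\<close>
    proof (cases "f i \<le> f i0 \<or> f i \<le> g j0")
      case True
      then have "f i \<le> g j" if "j \<in> B" for j using all[OF that] j0(2)[OF that] by linarith
      then have "{j\<in>?B. f i \<le> g j} = ?B" by auto
      then show ?thesis using sub cards by simp
    next
      case False
      then have "{j\<in>?A. f i \<le> f j} = {j\<in>A. f i \<le> f j}" "{j\<in>?B. f i \<le> g j} = {j\<in>B. f i \<le> g j}" by auto
      then show ?thesis using Suc.prems(4) i by simp
    qed
  qed (use cards Suc.prems in auto)
  then obtain h where h: "bij_betw h ?B ?A" "\<forall>i\<in>?B. f (h i) \<le> g i" by blast
  define h' where "h' = (\<lambda>i. if i = j0 then i0 else h i)"
  have "bij_betw h' ?B ?A" using h(1) by (rule bij_betw_cong[THEN iffD1, rotated]) (auto simp: h'_def)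
  then have "bij_betw h' (insert j0 ?B) (insert (h' j0) ?A)"
    using notIn_Un_bij_betw[of j0 ?B h' ?A] by (simp add: h'_def)
  then have "bij_betw h' B A" using i0(1) j0(1) by (simp add: h'_def insert_absorb)
  moreover have "\<forall>i\<in>B. f (h' i) \<le> g i" using h(2) all j0(1) by (auto simp: h'_def)
  ultimately show ?case by blast
qed

text \<open>
  Compare the numbers of eigenvalues above each threshold \<open>t\<close>; that \<open>t \<ge> 0\<close> suffices is what allows
  the two metrics to differ.
\<close>

lemma eigs_mono:
  fixes lam mu :: "real ^ 'n::finite"
  assumes G: "inner_form G" "inner_form G'" "\<And>v. G v v \<le> G' v v"
    and H: "symform H" "symform H'" "\<And>v. H' v v \<le> H v v"
    and e: "eigs G H lam" "eigs G' H' mu" and mu: "\<And>i. 0 \<le> mu $ i"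
  obtains \<pi> where "\<pi> permutes UNIV" "\<And>i. mu $ \<pi> i \<le> lam $ i"
proof -
  obtain b where b: "\<And>i j. G (b i) (b j) = (if i = j then 1 else 0)"
      "\<And>i j. H (b i) (b j) = (if i = j then lam $ i else 0)" using e(1) unfolding eigs_def by blast
  obtain b' where b': "\<And>i j. G' (b' i) (b' j) = (if i = j then 1 else 0)"
      "\<And>i j. H' (b' i) (b' j) = (if i = j then mu $ i else 0)" using e(2) unfolding eigs_def by blast
  note bb' = inner_form_bb[OF G(2)]
  have count: "card {j. t \<le> mu $ j} \<le> card {j. t \<le> lam $ j}" if t: "0 \<le> t" for t
  proof (rule ccontr)
    assume "\<not> ?thesis"
    then have less: "card {j. t \<le> lam $ j} < card {j. t \<le> mu $ j}" by simp
    let ?I = "{j. t \<le> mu $ j}" and ?J = "{j. t \<le> lam $ j}"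
    have inj: "inj b'" by (rule injI) (metis b'(1) zero_neq_one)
    have ind: "independent (b' ` ?I)"
      unfolding independent_explicit
    proof (intro conjI allI impI ballI)
      fix c v assume s: "(\<Sum>v\<in>b' ` ?I. c v *\<^sub>R v) = 0" and v: "v \<in> b' ` ?I"
      then obtain i where i: "v = b' i" "i \<in> ?I" by blast
      have inj': "inj_on b' ?I" using inj inj_on_subset by blast
      have "(\<Sum>j\<in>?I. c (b' j) *\<^sub>R b' j) = 0" using s unfolding sum.reindex[OF inj'] by simp
      then have "0 = G' (\<Sum>j\<in>?I. c (b' j) *\<^sub>R b' j) (b' i)" by (simp add: bounded_bilinear.zero_left[OF bb'])
      also have "\<dots> = c (b' i)"
        using i(2) by (simp add: bounded_bilinear.sum_left[OF bb'] bounded_bilinear.scaleR_left[OF bb'] b'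
            if_distrib cong: if_cong)
      finally show "c v = 0" using i by simp
    qed auto
    have dim: "dim (span (b' ` ?I)) = card ?I"
      using dim_eq_card_independent[OF ind] card_image[OF inj_on_subset[OF inj]] by simp
    \<comment> \<open>With too few \<open>lam\<close> above \<open>t\<close>, some nonzero
      \<open>v\<close> is spanned by the eigenvectors for \<open>mu $ i \<ge> t\<close> and
      orthogonal to those for \<open>lam $ j \<ge> t\<close>. It yields the contradictory chain
      \<open>t * G' v v \<le> H' v v \<le> H v v < t * G v v \<le> t * G' v v\<close>.\<close>
    obtain v where v: "v \<in> span (b' ` ?I)" "v \<noteq> 0" "\<And>j. j \<in> ?J \<Longrightarrow> G v (b j) = 0"
      using exists_orthogonal[OF G(1), of ?J b "span (b' ` ?I)"] b(1) less dim by auto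
    have z: "G' v (b' i) = 0" if "i \<notin> ?I" for i
      using v(1)
    proof (induction rule: span_induct)
      case base
      show ?case
        by (auto simp: subspace_def bounded_bilinear.zero_left[OF bb'] bounded_bilinear.add_left[OF bb']
            bounded_bilinear.scaleR_left[OF bb'])
    next
      case (step x)
      then show ?case using that b'(1) by auto
    qed
    have "t * G' v v \<le> H' v v"
      unfolding norm_expand[OF G(2) b'(1), of v] form_expand[OF G(2) b'(1) H(2) b'(2), of v] sum_distrib_left
    proof (rule sum_mono)
      fix i show "t * (G' v (b' i))\<^sup>2 \<le> mu $ i * (G' v (b' i))\<^sup>2"
        using z[of i] by (cases "i \<in> ?I") (auto intro: mult_right_mono)
    qed
    moreover have "t * G v v \<le> t * G' v v" using G(3) t by (simp add: mult_left_mono)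
    moreover have "H v v < t * G v v"
    proof -
      have "0 < G v v" using G(1) v(2) by (simp add: inner_form_def)
      then obtain i where i: "(G v (b i))\<^sup>2 \<noteq> 0"
        unfolding norm_expand[OF G(1) b(1), of v] by (metis less_irrefl sum.neutral)
      show ?thesis
        unfolding norm_expand[OF G(1) b(1), of v] form_expand[OF G(1) b(1) H(1) b(2), of v] sum_distrib_left
      proof (rule sum_strict_mono_ex1)
        show "\<forall>i\<in>UNIV. lam $ i * (G v (b i))\<^sup>2 \<le> t * (G v (b i))\<^sup>2"
          using v(3) by (metis linorder_le_cases mem_Collect_eq mult_right_mono mult_zero_right power_zero_numeral zero_le_power2 order_refl)
        show "\<exists>i\<in>UNIV. lam $ i * (G v (b i))\<^sup>2 < t * (G v (b i))\<^sup>2"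
          using i v(3)[of i] by (intro bexI[of _ i] mult_strict_right_mono) force+
      qed simp
    qed
    ultimately show False using H(3)[of v] by linarith
  qed
  obtain h where h: "bij h" "\<And>i. mu $ h i \<le> lam $ i"
    using count_matching[of "UNIV::'n set" "UNIV::'n set" "($) mu" "($) lam"] count mu by auto
  then show ?thesis using that[of h] by (simp add: permutes_univ bij_iff)
qed

lemma eigs_bounds:
  assumes "inner_form G" "eigs G H lam" "\<And>v. c * G v v \<le> H v v" "\<And>v. H v v \<le> C * G v v"
  shows "c \<le> lam $ i" "lam $ i \<le> C"
  using assms unfolding eigs_def by (metis mult.right_neutral)+

lemma eigs_nonneg: "eigs G H lam \<Longrightarrow> (\<And>v. 0 \<le> H v v) \<Longrightarrow> 0 \<le> lam $ i"
  unfolding eigs_def by metis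

lemma form_nonneg_of_eigs:
  assumes "inner_form G" "symform H" "eigs G H lam" "\<And>i. 0 \<le> lam $ i"
  shows "0 \<le> H v v"
proof -
  obtain b where b: "\<And>i j. G (b i) (b j) = (if i = j then 1 else 0)"
      "\<And>i j. H (b i) (b j) = (if i = j then lam $ i else 0)" using assms(3) unfolding eigs_def by blast
  show ?thesis
    unfolding form_expand[OF assms(1) b(1) assms(2) b(2)] using assms(4) by (intro sum_nonneg) simp
qed

lemma eigs_scale: "eigs G H lam \<Longrightarrow> eigs G (\<lambda>x y. r * H x y) (r *\<^sub>R lam)"
proof -
  assume "eigs G H lam"
  then obtain b where "\<And>i j. G (b i) (b j) = (if i = j then 1 else 0)"
      "\<And>i j. H (b i) (b j) = (if i = j then lam $ i else 0)" unfolding eigs_def by blast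
  then show ?thesis unfolding eigs_def by (intro exI[of _ b]) simp
qed

text \<open>The spectral theorem by successive maximization of \<open>H\<close> on the unit sphere
  of \<open>G\<close>, restricted to the orthogonal complement of the vectors found so far. The
  induction stores the eigenvector equation against all \<open>v\<close>, not merely the diagonal
  shape, in order to leave that complement later.\<close>

lemma eigs_exists:
  fixes G H :: "real ^ 'n::finite \<Rightarrow> real ^ 'n \<Rightarrow> real"
  assumes G: "inner_form G" and H: "symform H"
  obtains lam where "eigs G H lam"
proof -
  note bG = inner_form_bb[OF G] and bH = symform_bb[OF H]
  have Gs: "G x y = G y x" and Hs: "H x y = H y x" for x y using G H by (auto simp: inner_form_def symform_def)
  have "\<exists>b l. \<forall>i<m. (\<forall>j<m. G (b i) (b j) = (if i = j then 1 else 0)) \<and> (\<forall>v. H (b i) v = l i * G (b i) v)"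
    if "m \<le> CARD('n)" for m :: nat
    using that
  proof (induction m)
    case 0
    then show ?case by simp
  next
    case (Suc m)
    then obtain b l where b: "\<And>i j. i < m \<Longrightarrow> j < m \<Longrightarrow> G (b i) (b j) = (if i = j then 1 else 0)"
        "\<And>i v. i < m \<Longrightarrow> H (b i) v = l i * G (b i) v"
      by (metis Suc_leD)
    define V where "V = {v. \<forall>i<m. G v (b i) = 0}"
    define K where "K = {v\<in>V. G v v = 1}"
    obtain w where w: "w \<noteq> 0" "w \<in> V"
      using exists_orthogonal[OF G, of "{..<m}" b UNIV] b(1) Suc.prems by (auto simp: V_def)
    have cont: "continuous_on S (\<lambda>v. G v v)" "continuous_on S (\<lambda>v. H v v)"
      "continuous_on S (\<lambda>v. G v y)" for S y
      by (intro bounded_bilinear.continuous_on[OF bG] bounded_bilinear.continuous_on[OF bH] continuous_intros)+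
    have "K = (\<Inter>i\<in>{..<m}. {v. G v (b i) = 0}) \<inter> {v. G v v = 1}" by (auto simp: K_def V_def)
    then have "closed K"
      using cont by (auto intro!: closed_Int closed_INT closed_Collect_eq)
    moreover have "bounded K"
    proof -
      obtain c where c: "0 < c" "\<And>x. c * (x \<bullet> x) \<le> G x x" using inner_form_lower[OF G] by blast
      have "norm v \<le> sqrt (1 / c)" if "v \<in> K" for v
      proof (rule real_le_rsqrt)
        have "c * (v \<bullet> v) \<le> 1" using c(2)[of v] that by (simp add: K_def)
        then show "(norm v)\<^sup>2 \<le> 1 / c" using c(1) by (simp add: dot_square_norm field_simps)
      qed
      then show ?thesis using bounded_iff by blast
    qed
    ultimately have "compact K" by (simp add: compact_eq_bounded_closed)
    have scaleK: "v /\<^sub>R sqrt (G v v) \<in> K" if "v \<noteq> 0" "v \<in> V" for v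
    proof -
      have "0 < G v v" using G that by (simp add: inner_form_def)
      then show ?thesis using that
        by (simp add: K_def V_def bounded_bilinear.scaleR_left[OF bG] bounded_bilinear.scaleR_right[OF bG]
            field_simps)
    qed
    then have "K \<noteq> {}" using w by blast
    then obtain u where u: "u \<in> K" "\<And>v. v \<in> K \<Longrightarrow> H v v \<le> H u u"
      using continuous_attains_sup[OF \<open>compact K\<close> _ cont(2)] by blast
    define L where "L = H u u"
    have phi: "H v v \<le> L * G v v" if "v \<in> V" for v
    proof (cases "v = 0")
      case False
      have pos: "0 < G v v" using G False by (simp add: inner_form_def)
      have "H (v /\<^sub>R sqrt (G v v)) (v /\<^sub>R sqrt (G v v)) \<le> L"
        using u(2)[OF scaleK[OF False that]] by (simp add: L_def)
      then show ?thesis using pos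
        by (simp add: bounded_bilinear.scaleR_left[OF bH] bounded_bilinear.scaleR_right[OF bH] field_simps)
    qed (simp add: bounded_bilinear.zero_left[OF bH] bounded_bilinear.zero_left[OF bG])
    have uV: "u \<in> V" "G u u = 1" using u(1) by (auto simp: K_def)
    have first: "H u v = L * G u v" if v: "v \<in> V" for v
    proof (rule ccontr)
      define p q where "p = L * G u v - H u v" and "q = L * G v v - H v v"
      assume "H u v \<noteq> L * G u v"
      then have p: "p \<noteq> 0" by (simp add: p_def)
      have q: "0 \<le> q" using phi[OF v] by (simp add: q_def)
      have ge: "0 \<le> 2 * t * p + t\<^sup>2 * q" for t
      proof -
        have "u + t *\<^sub>R v \<in> V" using uV v
          by (simp add: V_def bounded_bilinear.add_left[OF bG] bounded_bilinear.scaleR_left[OF bG])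
        from phi[OF this] show ?thesis
          unfolding p_def q_def using uV Hs[of v u] Gs[of v u]
          by (simp add: bounded_bilinear.add_left[OF bG] bounded_bilinear.scaleR_left[OF bG]
              bounded_bilinear.add_right[OF bG] bounded_bilinear.scaleR_right[OF bG]
              bounded_bilinear.add_left[OF bH] bounded_bilinear.scaleR_left[OF bH]
              bounded_bilinear.add_right[OF bH] bounded_bilinear.scaleR_right[OF bH]
              L_def[symmetric] power2_eq_square algebra_simps)
      qed
      \<comment> \<open>This \<open>t\<close> is close to the minimizer \<open>- p / q\<close> of
        the quadratic; the added 1 covers \<open>q = 0\<close>.\<close>
      have "2 * (- p / (q + 1)) * p + (- p / (q + 1))\<^sup>2 * q = - (p\<^sup>2 / (q + 1)\<^sup>2) * (q + 2)"
        using q by (simp add: divide_simps) (simp add: power2_eq_square algebra_simps)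
      also have "\<dots> < 0" using p q by (simp add: mult_neg_pos)
      finally show False using ge[of "- p / (q + 1)"] by linarith
    qed
    have eig: "H u v = L * G u v" for v
    proof -
      \<comment> \<open>The part of \<open>v\<close> along the earlier eigenvectors, on which both
        \<open>G u\<close> and \<open>H u\<close> vanish; the rest lies in \<open>V\<close>, where
        \<open>first\<close> applies.\<close>
      define s where "s = (\<Sum>i<m. G v (b i) *\<^sub>R b i)"
      have "G s (b j) = G v (b j)" if j: "j < m" for j
      proof -
        have "G s (b j) = (\<Sum>i<m. G v (b i) * (if i = j then 1 else 0))"
          unfolding s_def bounded_bilinear.sum_left[OF bG] bounded_bilinear.scaleR_left[OF bG]
          using b(1) j by (intro sum.cong) auto
        then show ?thesis using j by (simp add: if_distrib cong: if_cong)
      qed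
      then have "v - s \<in> V" by (simp add: V_def bounded_bilinear.diff_left[OF bG])
      then have 1: "H u (v - s) = L * G u (v - s)" by (rule first)
      have "G u (b i) = 0" "H u (b i) = 0" if "i < m" for i
        using uV that b(2)[OF that, of u] Gs[of u "b i"] Hs[of u "b i"] by (auto simp: V_def)
      then have "G u s = 0" "H u s = 0"
        by (simp_all add: s_def bounded_bilinear.sum_right[OF bG] bounded_bilinear.scaleR_right[OF bG]
            bounded_bilinear.sum_right[OF bH] bounded_bilinear.scaleR_right[OF bH])
      then show ?thesis using 1 by (simp add: bounded_bilinear.diff_right[OF bG] bounded_bilinear.diff_right[OF bH])
    qed
    show ?case
    proof (intro exI allI impI conjI)
      fix i assume i: "i < Suc m"
      show "G ((b(m := u)) i) ((b(m := u)) j) = (if i = j then 1 else 0)" if "j < Suc m" for j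
        using i that b(1) uV Gs by (auto simp: V_def less_Suc_eq)
      show "H ((b(m := u)) i) v = (l(m := L)) i * G ((b(m := u)) i) v" for v
        using i b(2) eig by (auto simp: less_Suc_eq)
    qed
  qed
  from this[OF order_refl] obtain b l where
    b: "\<And>i j. i < CARD('n) \<Longrightarrow> j < CARD('n) \<Longrightarrow> G (b i) (b j) = (if i = j then 1 else 0)"
      "\<And>i v. i < CARD('n) \<Longrightarrow> H (b i) v = l i * G (b i) v" by blast
  obtain f :: "'n \<Rightarrow> nat" where f: "bij_betw f UNIV {..<CARD('n)}"
    using ex_bij_betw_finite_nat[of "UNIV :: 'n set"] by (auto simp: atLeast0LessThan)
  have fl: "f i < CARD('n)" and fi: "f i = f j \<longleftrightarrow> i = j" for i j
    using f by (auto simp: bij_betw_def inj_eq)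
  have "eigs G H (\<chi> i. l (f i))"
    unfolding eigs_def by (rule exI[of _ "b \<circ> f"]) (simp add: b fl fi)
  then show ?thesis using that by blast
qed

text \<open>The trace relative to \<open>G\<close> does not depend on the orthonormal basis: expand
  each \<open>b' j\<close> in the eigenbasis, exchange the sums and apply Parseval.\<close>

lemma eigs_sum:
  fixes b' :: "'n::finite \<Rightarrow> real ^ 'n"
  assumes G: "inner_form G" and H: "symform H" and e: "eigs G H lam"
    and b': "\<And>i j. G (b' i) (b' j) = (if i = j then 1 else 0)"
  shows "(\<Sum>j\<in>UNIV. H (b' j) (b' j)) = (\<Sum>i\<in>UNIV. lam $ i)"
proof -
  obtain b where b: "\<And>i j. G (b i) (b j) = (if i = j then 1 else 0)"
      "\<And>i j. H (b i) (b j) = (if i = j then lam $ i else 0)" using e unfolding eigs_def by blast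
  have "(\<Sum>j\<in>UNIV. H (b' j) (b' j)) = (\<Sum>j\<in>UNIV. \<Sum>i\<in>UNIV. lam $ i * (G (b' j) (b i))\<^sup>2)"
    by (simp add: form_expand[OF G b(1) H b(2)])
  also have "\<dots> = (\<Sum>i\<in>UNIV. lam $ i * (\<Sum>j\<in>UNIV. (G (b i) (b' j))\<^sup>2))"
  proof -
    have "G x y = G y x" for x y using G by (simp add: inner_form_def symform_def)
    then show ?thesis by (subst sum.swap) (simp add: sum_distrib_left)
  qed
  finally show ?thesis by (simp add: norm_expand[OF G b', symmetric] b(1))
qed

text \<open>A smaller metric and a larger form both raise the ordered eigenvalues. The rearrangement
  supplied by \<open>eigs_mono\<close> is invisible to the symmetric function
  \<open>Q\<close>.\<close>

lemma Q_eigs_mono: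
  fixes lam mu :: "real ^ 'n::finite"
  assumes G: "inner_form G" "inner_form G'" "\<And>v. G v v \<le> G' v v"
    and H: "symform H" "symform H'" "\<And>v. H' v v \<le> H v v" "\<And>v. 0 \<le> H' v v"
    and e: "eigs G H lam" "eigs G' H' mu" and k: "0 < k" "0 < S k mu"
  shows "Q k mu \<le> Q k lam"
proof -
  have mu: "0 \<le> mu $ i" for i using eigs_nonneg[OF e(2) H(4)] .
  obtain \<pi> where p: "\<pi> permutes UNIV" "\<And>i. mu $ \<pi> i \<le> lam $ i"
    using eigs_mono[OF G H(1-3) e mu] by blast
  have "Q k mu = Q k (\<chi> i. mu $ \<pi> i)" using Q_permute[OF p(1)] by simp
  also have "\<dots> \<le> Q k lam"
    using k mu p S_permute[OF p(1), of k mu] by (intro Q_mono) auto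
  finally show ?thesis .
qed

lemma symform_inner_prod: "symform (\<lambda>x z. s * (y \<bullet> x) * (y \<bullet> z))"
  by (auto simp: symform_def bilinear_def algebra_simps intro!: linearI)

lemma symform_add: "symform A \<Longrightarrow> symform B \<Longrightarrow> symform (\<lambda>x y. A x y + B x y)"
  by (auto simp: symform_def bilinear_def intro: linear_compose_add)

lemma symform_scale: "symform A \<Longrightarrow> symform (\<lambda>x y. r * A x y)"
  unfolding symform_def bilinear_def
  by (auto intro: linear_compose_scale_right[where f="A x" and c=r for x, simplified]
      linear_compose_scale_right[where f="\<lambda>x. A x y" and c=r for y, simplified])

text \<open>How the rank-one term distributes over the individual eigenvalues need not be known:
  none of them drops, and the total increase is the trace of the term. \<open>Q_gain\<close> depends
  on the total only.\<close>

lemma Q_eigs_gain: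
  fixes c C CG :: real
  assumes k: "0 < k" "k \<le> CARD('n::finite) - 1" and c: "0 < c" "c \<le> C" and CG: "0 < CG"
  obtains \<gamma> where "0 < \<gamma>"
    "\<And>G H lam mu s y. inner_form G \<Longrightarrow> symform H \<Longrightarrow> (\<And>v. G v v \<le> CG * (v \<bullet> v)) \<Longrightarrow>
      (\<And>v. c * G v v \<le> H v v) \<Longrightarrow> (\<And>v. H v v + s * (y \<bullet> v) * (y \<bullet> v) \<le> C * G v v) \<Longrightarrow> 0 \<le> s \<Longrightarrow>
      eigs G H lam \<Longrightarrow> eigs G (\<lambda>x z. H x z + s * (y \<bullet> x) * (y \<bullet> z)) (mu :: real ^ 'n) \<Longrightarrow>
      Q k lam + \<gamma> * s * (y \<bullet> y) \<le> Q k mu"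
proof -
  obtain \<gamma> where g: "0 < \<gamma>"
    "\<And>lam mu :: real ^ 'n. (\<And>i. c \<le> mu $ i) \<Longrightarrow> (\<And>i. mu $ i \<le> lam $ i) \<Longrightarrow> (\<And>i. lam $ i \<le> C)
      \<Longrightarrow> Q k mu + \<gamma> * (\<Sum>i\<in>UNIV. lam $ i - mu $ i) \<le> Q k lam"
    using Q_gain[OF k c] by blast
  have main: "Q k lam + \<gamma> / CG * s * (y \<bullet> y) \<le> Q k mu"
    if G: "inner_form G" and H: "symform H" and GC: "\<And>v. G v v \<le> CG * (v \<bullet> v)"
      and lo: "\<And>v. c * G v v \<le> H v v" and hi: "\<And>v. H v v + s * (y \<bullet> v) * (y \<bullet> v) \<le> C * G v v"
      and s: "0 \<le> s" and e: "eigs G H lam" and f: "eigs G (\<lambda>x z. H x z + s * (y \<bullet> x) * (y \<bullet> z)) mu"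
    for G H s y and lam mu :: "real ^ 'n"
  proof -
    note bG = inner_form_bb[OF G]
    let ?K = "\<lambda>x z. H x z + s * (y \<bullet> x) * (y \<bullet> z)"
    have K: "symform ?K" using symform_add[OF H symform_inner_prod] by simp
    have le: "H v v \<le> ?K v v" for v using s by (simp add: mult.assoc)
    have Hhi: "H v v \<le> C * G v v" for v using le[of v] hi[of v] by linarith
    have lamb: "c \<le> lam $ i" for i using eigs_bounds(1)[OF G e lo Hhi] .
    have mub: "mu $ i \<le> C" for i
      using eigs_bounds(2)[OF G f, of c C] lo le hi order_trans by blast
    have lam0: "0 \<le> lam $ i" for i using lamb[of i] c by linarith
    obtain \<pi> where p: "\<pi> permutes UNIV" "\<And>i. lam $ \<pi> i \<le> mu $ i"
      using eigs_mono[OF G G _ K H le f e lam0] by blast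
    obtain b where b: "\<And>i j. G (b i) (b j) = (if i = j then 1 else 0)"
      "\<And>i j. ?K (b i) (b j) = (if i = j then mu $ i else 0)" using f unfolding eigs_def by blast
    have "(\<Sum>i\<in>UNIV. mu $ i) = (\<Sum>i\<in>UNIV. ?K (b i) (b i))" by (simp only: b) simp
    also have "\<dots> = (\<Sum>i\<in>UNIV. lam $ i) + s * (\<Sum>i\<in>UNIV. (y \<bullet> b i)\<^sup>2)"
      using eigs_sum[OF G H e b(1)] by (simp add: sum.distrib sum_distrib_left power2_eq_square mult.assoc)
    finally have tr: "(\<Sum>i\<in>UNIV. mu $ i) = (\<Sum>i\<in>UNIV. lam $ i) + s * (\<Sum>i\<in>UNIV. (y \<bullet> b i)\<^sup>2)" .
    have perm: "(\<Sum>i\<in>UNIV. lam $ \<pi> i) = (\<Sum>i\<in>UNIV. lam $ i)"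
      using sum.permute[OF p(1), of "($) lam"] by (simp add: o_def)
    let ?P = "\<Sum>i\<in>UNIV. (y \<bullet> b i)\<^sup>2"
    \<comment> \<open>Cauchy-Schwarz for the expansion of \<open>y\<close> in \<open>b\<close>,
      together with the upper bound of \<open>G\<close>, compares the trace of the rank-one term
      with the Euclidean length of \<open>y\<close>.\<close>
    have P: "y \<bullet> y \<le> CG * ?P"
    proof (cases "y = 0")
      case False
      have "y \<bullet> y = y \<bullet> (\<Sum>i\<in>UNIV. G y (b i) *\<^sub>R b i)" using inner_form_expand[OF G b(1), of y] by simp
      also have "\<dots> = (\<Sum>i\<in>UNIV. G y (b i) * (y \<bullet> b i))" by (simp add: inner_sum_right)
      finally have "(y \<bullet> y)\<^sup>2 = (\<Sum>i\<in>UNIV. G y (b i) * (y \<bullet> b i))\<^sup>2" by simp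
      also have "\<dots> \<le> (\<Sum>i\<in>UNIV. (G y (b i))\<^sup>2) * ?P" by (rule Cauchy_Schwarz_ineq_sum)
      also have "\<dots> = G y y * ?P" by (simp add: norm_expand[OF G b(1)])
      also have "\<dots> \<le> CG * (y \<bullet> y) * ?P" using GC by (intro mult_right_mono sum_nonneg) auto
      finally have "(y \<bullet> y) * (y \<bullet> y) \<le> (y \<bullet> y) * (CG * ?P)" by (simp add: power2_eq_square algebra_simps)
      then show ?thesis using False by (simp add: mult_le_cancel_left)
    qed (simp add: CG)
    have "s * (y \<bullet> y) \<le> s * (CG * ?P)" using P s by (rule mult_left_mono)
    then have "\<gamma> * (s * (y \<bullet> y) / CG) \<le> \<gamma> * (s * ?P)" using g(1) CG by (intro mult_left_mono) (auto simp: field_simps)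
    also have "\<dots> = \<gamma> * (\<Sum>i\<in>UNIV. mu $ i - (\<chi> i. lam $ \<pi> i) $ i)"
      using tr perm by (simp add: sum_subtractf)
    also have "Q k (\<chi> i. lam $ \<pi> i) + \<dots> \<le> Q k mu"
      using p lamb mub by (intro g(2)) auto
    finally show ?thesis using Q_permute[OF p(1), of k lam] by simp
  qed
  show ?thesis using that[of "\<gamma> / CG"] main g(1) CG by simp
qed


subsection \<open>Perturbation by a barrier\<close>

text \<open>The first fundamental form of a graph with gradient \<open>g\<close>, pulled back to the
  hyperplane.\<close>

definition graph_metric :: "'a::euclidean_space \<Rightarrow> 'a \<Rightarrow> 'a \<Rightarrow> real" where
  "graph_metric g x y = x \<bullet> y + (g \<bullet> x) * (g \<bullet> y)"

lemma inner_form_graph_metric: "inner_form (graph_metric g)"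
  by (auto simp: inner_form_def symform_def bilinear_def graph_metric_def algebra_simps inner_commute
      intro!: linearI add_pos_nonneg)

lemma graph_metric_ge: "x \<bullet> x \<le> graph_metric g x x"
  by (simp add: graph_metric_def)

lemma inner_bound: "norm g \<le> B \<Longrightarrow> \<bar>g \<bullet> x\<bar> \<le> B * norm x"
  by (meson Cauchy_Schwarz_ineq2 mult_right_mono norm_ge_zero order_trans)

lemma graph_metric_le:
  assumes "norm g \<le> B" shows "graph_metric g x x \<le> (1 + B\<^sup>2) * (x \<bullet> x)"
proof -
  have "(g \<bullet> x)\<^sup>2 \<le> (B * norm x)\<^sup>2"
    using inner_bound[OF assms, of x] by (metis abs_ge_zero power2_abs power_mono)
  then show ?thesis
    by (simp add: graph_metric_def dot_square_norm power_mult_distrib algebra_simps power2_eq_square)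
qed

text \<open>The difference of the two metrics factors as
  \<open>((g - h) \<bullet> x) * ((g + h) \<bullet> x)\<close>. The estimate is kept multiplicative
  because a factor on the metric becomes a factor on \<open>Q\<close>.\<close>

lemma graph_metric_perturb:
  assumes "norm g \<le> B" "norm h \<le> B" "norm (g - h) \<le> e"
  shows "graph_metric g x x \<le> (1 + 2 * B * e) * graph_metric h x x"
proof -
  have B: "0 \<le> B" "0 \<le> e" using assms norm_ge_zero order_trans by blast+
  have a: "\<bar>(g - h) \<bullet> x\<bar> \<le> e * norm x" using inner_bound[OF assms(3)] .
  have "norm (g + h) \<le> 2 * B" using norm_triangle_ineq[of g h] assms by linarith
  then have b: "\<bar>(g + h) \<bullet> x\<bar> \<le> 2 * B * norm x" by (rule inner_bound)
  have "graph_metric g x x - graph_metric h x x = ((g - h) \<bullet> x) * ((g + h) \<bullet> x)"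
    by (simp add: graph_metric_def algebra_simps)
  also have "\<dots> \<le> \<bar>(g - h) \<bullet> x\<bar> * \<bar>(g + h) \<bullet> x\<bar>" by (metis abs_ge_self abs_mult)
  also have "\<dots> \<le> (e * norm x) * (2 * B * norm x)" using a b B by (intro mult_mono) auto
  also have "\<dots> = 2 * B * e * (x \<bullet> x)" by (simp add: dot_square_norm power2_eq_square)
  also have "\<dots> \<le> 2 * B * e * graph_metric h x x" using B graph_metric_ge by (intro mult_left_mono) auto
  finally show ?thesis by (simp add: algebra_simps)
qed

lemma inner_form_scale: "inner_form G \<Longrightarrow> 0 < r \<Longrightarrow> inner_form (\<lambda>x y. r * G x y)"
  using symform_scale[of G r] by (simp add: inner_form_def)

lemma eigs_scale_metric:
  assumes "eigs G H lam" "inner_form G" "symform H" "0 < r"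
  shows "eigs (\<lambda>x y. r * G x y) H ((1 / r) *\<^sub>R lam)"
proof -
  note bG = inner_form_bb[OF assms(2)] and bH = symform_bb[OF assms(3)]
  obtain b where "\<And>i j. G (b i) (b j) = (if i = j then 1 else 0)"
      "\<And>i j. H (b i) (b j) = (if i = j then lam $ i else 0)" using assms(1) unfolding eigs_def by blast
  then show ?thesis
    unfolding eigs_def using assms(4)
    by (intro exI[of _ "\<lambda>i. b i /\<^sub>R sqrt r"])
      (simp add: bounded_bilinear.scaleR_left[OF bG] bounded_bilinear.scaleR_right[OF bG]
        bounded_bilinear.scaleR_left[OF bH] bounded_bilinear.scaleR_right[OF bH] field_simps)
qed

text \<open>After scaling, \<open>G / r\<close> lies below \<open>G'\<close> and
  \<open>\<rho> * H\<close> above \<open>H'\<close>, so monotonicity applies; the eigenvalues of the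
  scaled pair are \<open>r * \<rho> * lam\<close> and \<open>Q\<close> has degree one.\<close>

lemma Q_eigs_ratio:
  fixes lam mu :: "real ^ 'n::finite"
  assumes G: "inner_form G" "inner_form G'" "\<And>v. G v v \<le> r * G' v v" "0 < r"
    and H: "symform H" "symform H'" "\<And>v. H' v v \<le> \<rho> * H v v" "\<And>v. 0 \<le> H' v v" "0 < \<rho>"
    and e: "eigs G H lam" "eigs G' H' mu" and k: "0 < k" "0 < S k mu"
  shows "Q k mu \<le> r * \<rho> * Q k lam"
proof -
  have "eigs (\<lambda>x y. (1 / r) * G x y) (\<lambda>x y. \<rho> * H x y) ((1 / (1 / r)) *\<^sub>R (\<rho> *\<^sub>R lam))"
    using G H e by (intro eigs_scale_metric eigs_scale symform_scale) auto
  then have "Q k mu \<le> Q k ((1 / (1 / r)) *\<^sub>R (\<rho> *\<^sub>R lam))"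
    by (rule Q_eigs_mono[OF inner_form_scale[OF G(1)] G(2) _ symform_scale[OF H(1)] H(2-4) _ e(2) k, rotated 2])
      (use G(3,4) in \<open>auto simp: field_simps\<close>)
  also have "\<dots> = r * \<rho> * Q k lam" using G(4) H(5) by (simp add: Q_scale)
  finally show ?thesis .
qed

lemma symform_inner: "symform (\<lambda>x y. r * (x \<bullet> (y :: 'a::euclidean_space)))"
  by (auto simp: symform_def bilinear_def algebra_simps inner_commute intro!: linearI)

text \<open>
  Perturbing a strictly convex solution \<open>(g, H)\<close> by minus (plus) the one-jet of \<open>\<epsilon> exp (-\<alpha> |y|\<^sup>2)\<close>
  makes it a strict supersolution (subsolution): the gain in the direction \<open>y\<close> is of order \<open>\<alpha> \<eta>\<close>,
  all other effects are of order \<open>\<eta>\<close>.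
\<close>

lemma barrier_strict:
  fixes c C B r1 r2 \<Lambda> :: real and \<phi> :: "real ^ 'n::finite \<Rightarrow> real"
  assumes k: "0 < k" "k \<le> CARD('n) - 1"
    and c: "0 < c" "c \<le> C" and B: "0 \<le> B" and r: "0 < r1" "r1 \<le> r2" and L: "0 \<le> \<Lambda>"
    and lip: "\<And>g h. \<bar>\<phi> g - \<phi> h\<bar> \<le> \<Lambda> * norm (g - h)"
  obtains \<alpha> \<eta>0 where "0 < \<alpha>" "0 < \<eta>0"
    "\<And>g H lam y \<eta> \<sigma> H2 mu. norm g \<le> B \<Longrightarrow> symform H \<Longrightarrow> (\<And>v. c * (v \<bullet> v) \<le> H v v) \<Longrightarrow>
      (\<And>v. H v v \<le> C * (v \<bullet> v)) \<Longrightarrow> eigs (graph_metric g) H lam \<Longrightarrow> Q k lam = \<phi> g \<Longrightarrow>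
      r1 \<le> norm y \<Longrightarrow> norm y \<le> r2 \<Longrightarrow> 0 < \<eta> \<Longrightarrow> \<eta> < \<eta>0 \<Longrightarrow> \<sigma> = 1 \<or> \<sigma> = -1 \<Longrightarrow>
      symform H2 \<Longrightarrow> (\<And>v. 0 \<le> H2 v v) \<Longrightarrow>
      (\<And>v. \<sigma> * H2 v v \<le> \<sigma> * H v v - \<eta> * (2 * \<alpha> * (y \<bullet> v)\<^sup>2 - v \<bullet> v)) \<Longrightarrow>
      eigs (graph_metric (g + (\<sigma> * \<eta>) *\<^sub>R y)) H2 mu \<Longrightarrow> 0 < S k mu \<Longrightarrow>
      Q k mu = \<phi> (g + (\<sigma> * \<eta>) *\<^sub>R y) \<Longrightarrow> False"
proof -
  \<comment> \<open>Bounds the perturbed gradient as well, since \<open>\<eta>\<close> will be at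
    most 1; \<open>M\<close> then bounds the perturbed metric by the Euclidean one.\<close>
  define B' where "B' = B + r2"
  define M where "M = 1 + B'\<^sup>2"
  have B': "0 \<le> B'" using B r by (simp add: B'_def)
  have M: "1 \<le> M" by (simp add: M_def)
  have c': "0 < c / (2 * M)" "c / (2 * M) \<le> C + 1 + c"
  proof -
    show "0 < c / (2 * M)" using c M by simp
    have "c / (2 * M) \<le> c" using c M by (simp add: divide_le_eq)
    then show "c / (2 * M) \<le> C + 1 + c" using c by linarith
  qed
  have M0: "0 < M" using M by linarith
  \<comment> \<open>The growth constant depends on \<open>c\<close>, \<open>C\<close> and
    \<open>M\<close> but not on the barrier, so \<open>\<alpha>\<close> may be chosen in terms of
    it. The bounds \<open>c / (2 * M)\<close> and \<open>C + 1 + c\<close> leave room for the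
    perturbed Hessian.\<close>
  obtain \<gamma> where \<gamma>: "0 < \<gamma>"
    "\<And>G H lam mu s y. inner_form G \<Longrightarrow> symform H \<Longrightarrow> (\<And>v. G v v \<le> M * (v \<bullet> v)) \<Longrightarrow>
      (\<And>v. c / (2 * M) * G v v \<le> H v v) \<Longrightarrow> (\<And>v. H v v + s * (y \<bullet> v) * (y \<bullet> v) \<le> (C + 1 + c) * G v v) \<Longrightarrow> 0 \<le> s \<Longrightarrow>
      eigs G H lam \<Longrightarrow> eigs G (\<lambda>x z. H x z + s * (y \<bullet> x) * (y \<bullet> z)) (mu :: real ^ 'n) \<Longrightarrow>
      Q k lam + \<gamma> * s * (y \<bullet> y) \<le> Q k mu"
    using Q_eigs_gain[OF k c' M0] by blast
  \<comment> \<open>\<open>L0\<close> bounds the right-hand side at \<open>g\<close>,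
    \<open>D * \<eta>\<close> is the relative change of the metric, \<open>2 / c * \<eta>\<close>
    that of the Hessian when a multiple \<open>\<eta>\<close> of the identity is added or removed.
    \<open>E * \<eta>\<close> bounds their combined effect for
    \<open>\<eta> \<le> 1\<close>.\<close>
  define L0 where "L0 = \<bar>\<phi> 0\<bar> + \<Lambda> * B"
  define D where "D = 2 * B' * r2"
  define E where "E = D + 2 / c + D * (2 / c)"
  have L0: "0 \<le> L0" and D: "0 \<le> D" using L B B' r by (auto simp: L0_def D_def)
  have E: "0 \<le> E" using D c by (simp add: E_def)
  \<comment> \<open>Chosen so that the gain
    \<open>\<gamma> * (2 * \<alpha> * \<eta>) * (y \<bullet> y)\<close> beats both the change
    \<open>\<eta> * \<Lambda> * r2\<close> of the right-hand side and the relative error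
    \<open>\<eta> * E * L0\<close>, with a margin \<open>\<eta>\<close>.\<close>
  define \<alpha> where "\<alpha> = (\<Lambda> * r2 + E * L0 + 1) / (2 * \<gamma> * r1\<^sup>2)"
  have num: "0 < \<Lambda> * r2 + E * L0 + 1" using L r E L0 by (intro add_nonneg_pos add_nonneg_nonneg) auto
  have \<alpha>: "0 < \<alpha>" unfolding \<alpha>_def using num \<gamma> r by simp
  have \<alpha>_eq: "\<gamma> * (2 * \<alpha>) * r1\<^sup>2 = \<Lambda> * r2 + E * L0 + 1" using \<gamma> r by (simp add: \<alpha>_def)
  \<comment> \<open>Besides \<open>\<eta> \<le> 1\<close>, this keeps at least half of the lower
    bound \<open>c\<close> of the Hessian and limits the rank-one term to
    \<open>min 1 (c / 2)\<close>.\<close>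
  define \<eta>0 where "\<eta>0 = Min {1, c / 2, min 1 (c / 2) / (2 * \<alpha> * r2\<^sup>2)}"
  have r20: "0 < 2 * \<alpha> * r2\<^sup>2" using \<alpha> r by simp
  have \<eta>0: "0 < \<eta>0" using c r20 by (simp add: \<eta>0_def)
  have main: False
    if g: "norm g \<le> B" and H: "symform H" and lo: "\<And>v. c * (v \<bullet> v) \<le> H v v"
      and hi: "\<And>v. H v v \<le> C * (v \<bullet> v)" and e: "eigs (graph_metric g) H lam" and q: "Q k lam = \<phi> g"
      and y: "r1 \<le> norm y" "norm y \<le> r2" and \<eta>: "0 < \<eta>" "\<eta> < \<eta>0" and \<sigma>: "\<sigma> = 1 \<or> \<sigma> = -1"
      and H2: "symform H2" "\<And>v. 0 \<le> H2 v v"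
      and cmp: "\<And>v. \<sigma> * H2 v v \<le> \<sigma> * H v v - \<eta> * (2 * \<alpha> * (y \<bullet> v)\<^sup>2 - v \<bullet> v)"
      and e2: "eigs (graph_metric (g + (\<sigma> * \<eta>) *\<^sub>R y)) H2 mu" and S2: "0 < S k mu"
      and q2: "Q k mu = \<phi> (g + (\<sigma> * \<eta>) *\<^sub>R y)"
    for g H lam y \<eta> \<sigma> H2 and mu :: "real ^ 'n"
  proof -
    let ?g2 = "g + (\<sigma> * \<eta>) *\<^sub>R y"
    let ?G = "graph_metric g" and ?G2 = "graph_metric ?g2"
    note iG = inner_form_graph_metric[of g] and iG2 = inner_form_graph_metric[of ?g2]
    have \<eta>1: "\<eta> \<le> 1" "\<eta> \<le> c / 2" "\<eta> * (2 * \<alpha> * r2\<^sup>2) \<le> 1" "\<eta> * (2 * \<alpha> * r2\<^sup>2) \<le> c / 2"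
      using \<eta> r20 unfolding \<eta>0_def by (auto simp: pos_less_divide_eq)
    have abs\<sigma>: "\<bar>\<sigma>\<bar> = 1" using \<sigma> by auto
    have ny: "norm ((\<sigma> * \<eta>) *\<^sub>R y) \<le> \<eta> * r2" using y \<eta> abs\<sigma> by (simp add: abs_mult)
    have "\<eta> * r2 \<le> r2" using \<eta>1 r \<eta> by (simp add: mult_left_le_one_le)
    then have g2: "norm ?g2 \<le> B'" using norm_triangle_ineq[of g "(\<sigma> * \<eta>) *\<^sub>R y"] ny g unfolding B'_def by linarith
    have g1: "norm g \<le> B'" using g r by (simp add: B'_def)
    have rat1: "?G x x \<le> (1 + D * \<eta>) * ?G2 x x" for x
      using graph_metric_perturb[OF g1 g2, of "\<eta> * r2" x] ny by (simp add: D_def algebra_simps)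
    have rat2: "?G2 x x \<le> (1 + D * \<eta>) * ?G x x" for x
      using graph_metric_perturb[OF g2 g1, of "\<eta> * r2" x] ny by (simp add: D_def algebra_simps)
    have GM: "?G2 v v \<le> M * (v \<bullet> v)" for v using graph_metric_le[OF g2] by (simp add: M_def)
    have D1: "0 < 1 + D * \<eta>" using D \<eta> by (simp add: add_pos_nonneg)
    have lpos: "0 < Q k lam" "0 < S k lam" "\<And>i. 0 < lam $ i"
    proof -
      have "0 < c / (1 + B\<^sup>2)" using c by (simp add: add_pos_nonneg)
      moreover have "c / (1 + B\<^sup>2) * ?G v v \<le> H v v" for v
      proof -
        have "c / (1 + B\<^sup>2) * ?G v v \<le> c / (1 + B\<^sup>2) * ((1 + B\<^sup>2) * (v \<bullet> v))"
          using c graph_metric_le[OF g] by (intro mult_left_mono) (auto simp: add_nonneg_nonneg)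
        also have "\<dots> = c * (v \<bullet> v)" using B by (simp add: add_nonneg_eq_0_iff)
        finally show ?thesis using lo[of v] by linarith
      qed
      moreover have "H v v \<le> C * ?G v v" for v
        using hi[of v] graph_metric_ge[of v g] c mult_left_mono[of "v \<bullet> v" "?G v v" C] by linarith
      ultimately show p: "\<And>i. 0 < lam $ i" using eigs_bounds(1)[OF iG e] by (metis less_le_trans)
      show "0 < S k lam" using p k by (intro S_pos) auto
      moreover have "0 < S (Suc k) lam" using p k by (intro S_pos) auto
      ultimately show "0 < Q k lam" by (simp add: Q_def)
    qed
    have "\<bar>\<phi> g\<bar> \<le> L0"
      using lip[of g 0] mult_left_mono[OF g L] unfolding L0_def by simp
    then have lg: "\<phi> g \<le> L0" "0 < \<phi> g" using lpos q by auto
    have "\<bar>\<phi> ?g2 - \<phi> g\<bar> \<le> \<Lambda> * (\<eta> * r2)"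
      using lip[of ?g2 g] mult_left_mono[OF ny L] by simp
    then have lg2: "\<bar>\<phi> ?g2 - \<phi> g\<bar> \<le> \<eta> * (\<Lambda> * r2)" by (simp add: algebra_simps)
    have yv: "(y \<bullet> v)\<^sup>2 \<le> r2\<^sup>2 * (v \<bullet> v)" for v
    proof -
      have "(y \<bullet> v)\<^sup>2 \<le> (r2 * norm v)\<^sup>2" using inner_bound[OF y(2), of v] by (metis abs_ge_zero power2_abs power_mono)
      then show ?thesis by (simp add: power_mult_distrib dot_square_norm)
    qed
    have sy: "2 * \<alpha> * \<eta> * (y \<bullet> v)\<^sup>2 \<le> t * (v \<bullet> v)" if t: "\<eta> * (2 * \<alpha> * r2\<^sup>2) \<le> t" for v t
    proof -
      have "2 * \<alpha> * \<eta> * (y \<bullet> v)\<^sup>2 \<le> 2 * \<alpha> * \<eta> * (r2\<^sup>2 * (v \<bullet> v))" using yv \<alpha> \<eta> by (intro mult_left_mono) auto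
      also have "\<dots> = (\<eta> * (2 * \<alpha> * r2\<^sup>2)) * (v \<bullet> v)" by (simp add: algebra_simps)
      also have "\<dots> \<le> t * (v \<bullet> v)" using t by (rule mult_right_mono) simp
      finally show ?thesis .
    qed
    have yy: "r1\<^sup>2 \<le> y \<bullet> y" using y r by (simp add: dot_square_norm power_mono)
    have s0: "0 \<le> 2 * \<alpha> * \<eta>" using \<alpha> \<eta> by simp
    have half: "c / (2 * M) * ?G2 v v \<le> c / 2 * (v \<bullet> v)" for v
    proof -
      have "c / (2 * M) * ?G2 v v \<le> c / (2 * M) * (M * (v \<bullet> v))" using GM c' by (intro mult_left_mono) auto
      then show ?thesis using M0 by simp
    qed
    have CG: "(C + 1 + c) * (v \<bullet> v) \<le> (C + 1 + c) * ?G2 v v" for v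
      using graph_metric_ge c by (intro mult_left_mono) auto
    have gain: "\<gamma> * (2 * \<alpha> * \<eta>) * (y \<bullet> y) \<ge> \<eta> * (\<Lambda> * r2 + E * L0 + 1)"
    proof -
      have "\<eta> * (\<gamma> * (2 * \<alpha>) * r1\<^sup>2) \<le> \<eta> * (\<gamma> * (2 * \<alpha>) * (y \<bullet> y))"
        using \<eta> \<gamma> \<alpha> yy by (intro mult_left_mono) auto
      then show ?thesis unfolding \<alpha>_eq by (simp add: algebra_simps)
    qed
    have prod: "(1 + D * \<eta>) * (1 + 2 / c * \<eta>) \<le> 1 + E * \<eta>"
    proof -
      have "D * (2 / c) * (\<eta> * \<eta>) \<le> D * (2 / c) * \<eta>" using D c \<eta> \<eta>1 by (intro mult_left_mono) auto
      then show ?thesis by (simp add: E_def algebra_simps add_divide_distrib)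
    qed
    consider "\<sigma> = 1" | "\<sigma> = -1" using \<sigma> by blast
    then show False
    proof cases
      case 1
      \<comment> \<open>For \<open>\<sigma> = 1\<close> the form \<open>K\<close> lies above
        \<open>H2\<close>. Adding the rank-one term back gives \<open>K'\<close>, which is
        \<open>H\<close> up to a factor, so \<open>Q\<close> of \<open>H2\<close> falls short of
        \<open>\<phi> g\<close> by more than the right-hand side can change.\<close>
      define K where "K = (\<lambda>x z. (H x z + \<eta> * (x \<bullet> z)) + (- 2 * \<alpha> * \<eta>) * (y \<bullet> x) * (y \<bullet> z))"
      define K' where "K' = (\<lambda>x z. K x z + (2 * \<alpha> * \<eta>) * (y \<bullet> x) * (y \<bullet> z))"
      have sK: "symform K" unfolding K_def by (intro symform_add H symform_inner symform_inner_prod)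
      have sK': "symform K'" unfolding K'_def by (intro symform_add sK symform_inner_prod)
      have K'v: "K' v v = H v v + \<eta> * (v \<bullet> v)" for v by (simp add: K'_def K_def)
      have Kv: "K v v = H v v + \<eta> * (v \<bullet> v) - 2 * \<alpha> * \<eta> * (y \<bullet> v)\<^sup>2" for v
        by (simp add: K_def power2_eq_square)
      obtain \<kappa> where \<kappa>: "eigs ?G2 K \<kappa>" using eigs_exists[OF iG2 sK] by blast
      obtain \<kappa>' where \<kappa>': "eigs ?G2 K' \<kappa>'" using eigs_exists[OF iG2 sK'] by blast
      have H2K: "H2 v v \<le> K v v" for v using cmp[of v] 1 Kv[of v] by (simp add: algebra_simps)
      have le1: "Q k mu \<le> Q k \<kappa>"
        by (rule Q_eigs_mono[OF iG2 iG2 order_refl sK H2(1) H2K H2(2) \<kappa> e2 k(1) S2])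
      have lower: "c / (2 * M) * ?G2 v v \<le> K v v" for v
      proof -
        have "0 \<le> \<eta> * (v \<bullet> v)" using \<eta> by simp
        moreover have "c * (v \<bullet> v) = c / 2 * (v \<bullet> v) + c / 2 * (v \<bullet> v)" by simp
        ultimately show ?thesis using half[of v] lo[of v] sy[OF \<eta>1(4), of v] Kv[of v] by linarith
      qed
      have upper: "K v v + (2 * \<alpha> * \<eta>) * (y \<bullet> v) * (y \<bullet> v) \<le> (C + 1 + c) * ?G2 v v" for v
      proof -
        have "\<eta> * (v \<bullet> v) \<le> (1 + c) * (v \<bullet> v)" using \<eta>1 c by (intro mult_right_mono) auto
        then have "K' v v \<le> (C + 1 + c) * (v \<bullet> v)" using hi[of v] K'v[of v] by (simp add: algebra_simps)
        then show ?thesis using CG[of v] by (simp add: K'_def)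
      qed
      have le2: "Q k \<kappa> + \<gamma> * (2 * \<alpha> * \<eta>) * (y \<bullet> y) \<le> Q k \<kappa>'"
        by (rule \<gamma>(2)[OF iG2 sK GM lower upper s0 \<kappa> \<kappa>'[unfolded K'_def]])
      have K'K: "K v v \<le> K' v v" for v
      proof -
        have "0 \<le> 2 * \<alpha> * \<eta> * (y \<bullet> v)\<^sup>2" by (rule mult_nonneg_nonneg[OF s0 zero_le_power2])
        then show ?thesis by (simp add: K'_def power2_eq_square mult.assoc)
      qed
      have K'0: "0 \<le> K' v v" for v using lo[of v] c \<eta> K'v[of v] by (simp add: add_nonneg_nonneg order_trans[OF _ lo])
      have "0 < S k \<kappa>'"
      proof (rule S_pos)
        have "c / (2 * M) * ?G2 v v \<le> K' v v" for v using lower[of v] K'K[of v] by linarith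
        then have "c / (2 * M) \<le> \<kappa>' $ i" for i
          using eigs_bounds(1)[OF iG2 \<kappa>', of "c / (2 * M)" "C + 1 + c"] upper by (simp add: K'_def)
        then show "0 < \<kappa>' $ i" for i using c' less_le_trans by blast
      qed (use k in auto)
      then have "Q k \<kappa>' \<le> (1 + D * \<eta>) * (1 + 2 / c * \<eta>) * Q k lam"
      proof (rule Q_eigs_ratio[OF iG iG2 rat1 D1 H sK' _ K'0 _ e \<kappa>' k(1), rotated 2])
        show "0 < 1 + 2 / c * \<eta>" using c \<eta> by (simp add: add_pos_nonneg)
        have "\<eta> * (v \<bullet> v) \<le> 2 / c * \<eta> * H v v" for v
        proof -
          have "\<eta> * (c * (v \<bullet> v)) \<le> \<eta> * H v v" "0 \<le> \<eta> * H v v"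
            using lo[of v] \<eta> c order_trans[OF _ lo[of v]] by (auto intro!: mult_nonneg_nonneg)
          then have "\<eta> * (c * (v \<bullet> v)) \<le> 2 * (\<eta> * H v v)" by linarith
          then show ?thesis using c by (simp add: field_simps)
        qed
        then show "K' v v \<le> (1 + 2 / c * \<eta>) * H v v" for v using K'v[of v] by (simp add: algebra_simps)
      qed
      also have "\<dots> \<le> (1 + E * \<eta>) * Q k lam" using prod lpos by (intro mult_right_mono) auto
      also have "\<dots> \<le> Q k lam + \<eta> * (E * L0)"
        using mult_left_mono[OF lg(1), of "\<eta> * E"] \<eta> E q by (simp add: algebra_simps)
      finally have "Q k \<kappa>' \<le> \<phi> g + \<eta> * (E * L0)" using q by simp
      then have "\<phi> ?g2 + \<eta> * (\<Lambda> * r2 + E * L0 + 1) \<le> \<phi> g + \<eta> * (E * L0)"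
        using le1 le2 gain q2 by linarith
      then show False using lg2 \<eta>(1) by (simp add: algebra_simps)
    next
      case 2
      \<comment> \<open>For \<open>\<sigma> = -1\<close> the order is reversed: \<open>K\<close> is
        \<open>H\<close> up to a factor and the rank-one term lifts it to \<open>K'\<close>, which
        lies below \<open>H2\<close>.\<close>
      define K where "K = (\<lambda>x z. H x z + (- \<eta>) * (x \<bullet> z))"
      define K' where "K' = (\<lambda>x z. K x z + (2 * \<alpha> * \<eta>) * (y \<bullet> x) * (y \<bullet> z))"
      have sK: "symform K" unfolding K_def by (intro symform_add H symform_inner)
      have sK': "symform K'" unfolding K'_def by (intro symform_add sK symform_inner_prod)
      have K'v: "K' v v = H v v - \<eta> * (v \<bullet> v) + 2 * \<alpha> * \<eta> * (y \<bullet> v)\<^sup>2" for v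
        by (simp add: K'_def K_def power2_eq_square)
      have Kv: "K v v = H v v - \<eta> * (v \<bullet> v)" for v by (simp add: K_def)
      obtain \<kappa> where \<kappa>: "eigs ?G2 K \<kappa>" using eigs_exists[OF iG2 sK] by blast
      obtain \<kappa>' where \<kappa>': "eigs ?G2 K' \<kappa>'" using eigs_exists[OF iG2 sK'] by blast
      have lower: "c / (2 * M) * ?G2 v v \<le> K v v" for v
      proof -
        have "\<eta> * (v \<bullet> v) \<le> c / 2 * (v \<bullet> v)" using \<eta>1(2) by (rule mult_right_mono) simp
        moreover have "c * (v \<bullet> v) = c / 2 * (v \<bullet> v) + c / 2 * (v \<bullet> v)" by simp
        ultimately show ?thesis using half[of v] lo[of v] Kv[of v] by linarith
      qed
      have upper: "K v v + (2 * \<alpha> * \<eta>) * (y \<bullet> v) * (y \<bullet> v) \<le> (C + 1 + c) * ?G2 v v" for v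
      proof -
        have "0 \<le> \<eta> * (v \<bullet> v)" "0 \<le> c * (v \<bullet> v)" using \<eta> c by auto
        then have "K' v v \<le> (C + 1 + c) * (v \<bullet> v)"
          using hi[of v] K'v[of v] sy[OF \<eta>1(3), of v] by (simp add: algebra_simps)
        then show ?thesis using CG[of v] by (simp add: K'_def)
      qed
      have K'K: "K v v \<le> K' v v" for v
      proof -
        have "0 \<le> 2 * \<alpha> * \<eta> * (y \<bullet> v)\<^sup>2" by (rule mult_nonneg_nonneg[OF s0 zero_le_power2])
        then show ?thesis by (simp add: K'_def power2_eq_square mult.assoc)
      qed
      have K0: "0 \<le> K v v" for v
        using lower[of v] order_trans[OF _ lower[of v]] c' inner_form_nonneg[OF iG2] by (metis less_imp_le mult_nonneg_nonneg)
      have pos: "0 < S k \<kappa>'" "\<And>i. 0 < \<kappa> $ i"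
      proof -
        have "c / (2 * M) \<le> \<kappa>' $ i" for i
          using eigs_bounds(1)[OF iG2 \<kappa>', of "c / (2 * M)" "C + 1 + c"] upper order_trans[OF lower K'K] by (simp add: K'_def)
        then have "0 < \<kappa>' $ i" for i using c' less_le_trans by blast
        then show "0 < S k \<kappa>'" using k by (intro S_pos) auto
        have "c / (2 * M) \<le> \<kappa> $ i" for i
          using eigs_bounds(1)[OF iG2 \<kappa>, of "c / (2 * M)" "C + 1 + c"] upper lower order_trans[OF K'K]
          by (simp add: K'_def)
        then show "0 < \<kappa> $ i" for i using c' less_le_trans by blast
      qed
      have K'H2: "K' v v \<le> H2 v v" for v using cmp[of v] 2 K'v[of v] by (simp add: algebra_simps)
      have le1: "Q k \<kappa>' \<le> Q k mu"
        by (rule Q_eigs_mono[OF iG2 iG2 order_refl H2(1) sK' K'H2 order_trans[OF K0 K'K] e2 \<kappa>' k(1) pos(1)])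
      have le2: "Q k \<kappa> + \<gamma> * (2 * \<alpha> * \<eta>) * (y \<bullet> y) \<le> Q k \<kappa>'"
        by (rule \<gamma>(2)[OF iG2 sK GM lower upper s0 \<kappa> \<kappa>'[unfolded K'_def]])
      have Hnn: "0 \<le> H v v" for v using lo[of v] c order_trans[OF _ lo[of v]] by simp
      have "Q k lam \<le> (1 + D * \<eta>) * (1 + 2 / c * \<eta>) * Q k \<kappa>"
      proof (rule Q_eigs_ratio[OF iG2 iG rat2 D1 sK H _ Hnn _ \<kappa> e k(1) lpos(2)])
        show "0 < 1 + 2 / c * \<eta>" using c \<eta> by (simp add: add_pos_nonneg)
        show "H v v \<le> (1 + 2 / c * \<eta>) * K v v" for v
        proof -
          have "c / 2 * (v \<bullet> v) \<le> K v v"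
          proof -
            have "\<eta> * (v \<bullet> v) \<le> c / 2 * (v \<bullet> v)" using \<eta>1(2) by (rule mult_right_mono) simp
            moreover have "c * (v \<bullet> v) = c / 2 * (v \<bullet> v) + c / 2 * (v \<bullet> v)" by simp
            ultimately show ?thesis using lo[of v] Kv[of v] by linarith
          qed
          then have "2 / c * \<eta> * (c / 2 * (v \<bullet> v)) \<le> 2 / c * \<eta> * K v v"
            using \<eta> c by (intro mult_left_mono) auto
          moreover have "2 / c * \<eta> * (c / 2 * (v \<bullet> v)) = \<eta> * (v \<bullet> v)" using c by simp
          moreover have "(1 + 2 / c * \<eta>) * K v v = K v v + 2 / c * \<eta> * K v v" by (simp only: distrib_right mult_1)
          ultimately show ?thesis using Kv[of v] by linarith
        qed
      qed
      also have "\<dots> \<le> (1 + E * \<eta>) * Q k \<kappa>"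
      proof (rule mult_right_mono[OF prod])
        show "0 \<le> Q k \<kappa>" unfolding Q_def using pos(2) by (intro divide_nonneg_nonneg S_nonneg) (auto simp: less_imp_le)
      qed
      finally have a: "\<phi> g \<le> Q k \<kappa> + \<eta> * E * Q k \<kappa>" using q by (simp add: algebra_simps)
      \<comment> \<open>The relative error now multiplies \<open>Q k \<kappa>\<close> instead of
        \<open>\<phi> g\<close>. The gain inequality itself first shows
        \<open>Q k \<kappa> \<le> L0\<close>, after which the error is controlled as before.\<close>
      have b: "Q k \<kappa> + \<eta> * (\<Lambda> * r2 + E * L0 + 1) \<le> \<phi> g + \<eta> * (\<Lambda> * r2)"
        using le1 le2 gain q2 lg2 by linarith
      then have b': "Q k \<kappa> + \<eta> * (E * L0) + \<eta> \<le> \<phi> g" by (simp add: algebra_simps)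
      have "0 \<le> \<eta> * (E * L0)" using \<eta> E L0 by simp
      then have "Q k \<kappa> \<le> L0" using b' lg \<eta> by linarith
      then have "\<eta> * E * Q k \<kappa> \<le> \<eta> * E * L0" using \<eta> E by (intro mult_left_mono) auto
      then show False using a b' \<eta> by (simp add: algebra_simps)
    qed
  qed
  show ?thesis using that[OF \<alpha> \<eta>0] main by blast
qed


subsection \<open>Hopf lemma and strong maximum principle\<close>

lemma gradient_along_line:
  fixes u :: "'a::euclidean_space \<Rightarrow> real"
  assumes "(u has_derivative (\<lambda>\<xi>. g \<bullet> \<xi>)) (at (y + t *\<^sub>R \<xi>))"
  shows "((\<lambda>t. u (y + t *\<^sub>R \<xi>)) has_real_derivative g \<bullet> \<xi>) (at t)"
proof -
  have "((\<lambda>t. y + t *\<^sub>R \<xi>) has_derivative (\<lambda>t. t *\<^sub>R \<xi>)) (at t)" by (auto intro!: derivative_eq_intros)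
  from has_derivative_compose[OF this assms] show ?thesis
    by (rule has_derivative_imp_has_field_derivative) (simp add: mult.commute)
qed

text \<open>If the Hessian were negative in a direction \<open>\<xi>\<close>, the vanishing gradient
  would turn negative along \<open>\<xi>\<close> and, by the mean value theorem, \<open>u\<close>
  would drop below its minimum. Differentiability of \<open>g\<close> at the single point
  \<open>y\<close> is enough for this.\<close>

lemma second_order_min:
  fixes u :: "'a::euclidean_space \<Rightarrow> real"
  assumes y: "0 < r" "\<And>x. x \<in> ball y r \<Longrightarrow> u y \<le> u x"
    and du: "\<And>x. x \<in> ball y r \<Longrightarrow> (u has_derivative (\<lambda>\<xi>. g x \<bullet> \<xi>)) (at x)"
    and dg: "(g has_derivative H) (at y)"
  shows "g y = 0" "0 \<le> H \<xi> \<bullet> \<xi>"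
proof -
  have yin: "y \<in> ball y r" using y(1) by simp
  have "(\<lambda>\<xi>. g y \<bullet> \<xi>) = (\<lambda>\<xi>. 0)"
    by (rule has_derivative_local_min[OF du[OF yin]])
      (use y in \<open>auto simp: eventually_at_ball eventually_at_topological intro!: exI[of _ "ball y r"]\<close>)
  then have "g y \<bullet> g y = 0" by (rule fun_cong)
  then show g0: "g y = 0" by simp
  show "0 \<le> H \<xi> \<bullet> \<xi>"
  proof (rule ccontr)
    assume "\<not> 0 \<le> H \<xi> \<bullet> \<xi>"
    then have neg: "H \<xi> \<bullet> \<xi> < 0" by simp
    then have nz: "\<xi> \<noteq> 0" by auto
    define \<psi> where "\<psi> = (\<lambda>t. g (y + t *\<^sub>R \<xi>) \<bullet> \<xi>)"
    have lin: "linear H" using dg by (rule has_derivative_linear)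
    have "((\<lambda>t. y + t *\<^sub>R \<xi>) has_derivative (\<lambda>t. t *\<^sub>R \<xi>)) (at 0)" by (auto intro!: derivative_eq_intros)
    moreover have "(g has_derivative H) (at (y + 0 *\<^sub>R \<xi>))" using dg by simp
    ultimately have "((\<lambda>t. g (y + t *\<^sub>R \<xi>)) has_derivative (\<lambda>t. H (t *\<^sub>R \<xi>))) (at 0)"
      by (rule has_derivative_compose)
    then have "(\<psi> has_derivative (\<lambda>t. H (t *\<^sub>R \<xi>) \<bullet> \<xi>)) (at 0)"
      unfolding \<psi>_def by (rule has_derivative_inner_left)
    then have "(\<psi> has_real_derivative H \<xi> \<bullet> \<xi>) (at 0)"
      by (rule has_derivative_imp_has_field_derivative) (simp add: linear_scale[OF lin])
    from DERIV_neg_dec_right[OF this neg] obtain d where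
      d: "0 < d" "\<And>h. 0 < h \<Longrightarrow> h < d \<Longrightarrow> \<psi> h < 0" by (auto simp: \<psi>_def g0)
    define h where "h = min (d / 2) (r / (2 * norm \<xi>))"
    have h: "0 < h" "h < d" "h * norm \<xi> < r"
    proof -
      show "0 < h" "h < d" using d y nz by (auto simp: h_def min_less_iff_disj)
      have "h * norm \<xi> \<le> r / (2 * norm \<xi>) * norm \<xi>" by (intro mult_right_mono) (auto simp: h_def)
      also have "\<dots> < r" using nz y by simp
      finally show "h * norm \<xi> < r" .
    qed
    have inb: "y + t *\<^sub>R \<xi> \<in> ball y r" if "0 \<le> t" "t \<le> h" for t
      using that h mult_right_mono[of t h "norm \<xi>"] by (simp add: dist_norm)
    have "\<exists>z>0. z < h \<and> u (y + h *\<^sub>R \<xi>) - u (y + 0 *\<^sub>R \<xi>) = (h - 0) * \<psi> z"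
      unfolding \<psi>_def by (rule MVT2[OF h(1)]) (intro gradient_along_line du inb)
    then obtain z where z: "0 < z" "z < h" "u (y + h *\<^sub>R \<xi>) - u y = h * \<psi> z" by auto
    have "h * \<psi> z < 0" using d(2)[of z] z h by (intro mult_pos_neg) auto
    moreover have "u y \<le> u (y + h *\<^sub>R \<xi>)" using inb[of h] h by (intro y(2)) simp
    ultimately show False using z(3) by linarith
  qed
qed

lemma norm_le_axis_sum:
  fixes T :: "real ^ 'n::finite \<Rightarrow> 'b::real_normed_vector"
  assumes "linear T"
  shows "norm (T \<xi>) \<le> norm \<xi> * (\<Sum>i\<in>UNIV. norm (T (axis i 1)))"
proof -
  have "T \<xi> = T (\<Sum>i\<in>UNIV. \<xi> $ i *\<^sub>R axis i 1)"
    using basis_expansion[of \<xi>] by (simp add: scalar_mult_eq_scaleR)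
  also have "\<dots> = (\<Sum>i\<in>UNIV. \<xi> $ i *\<^sub>R T (axis i 1))"
    by (simp add: linear_sum[OF assms] linear_scale[OF assms])
  finally have "norm (T \<xi>) \<le> (\<Sum>i\<in>UNIV. norm (\<xi> $ i *\<^sub>R T (axis i 1)))" by (metis norm_sum)
  also have "\<dots> \<le> (\<Sum>i\<in>UNIV. norm \<xi> * norm (T (axis i 1)))"
    by (intro sum_mono) (simp add: mult_right_mono component_le_norm_cart)
  finally show ?thesis by (simp add: sum_distrib_left)
qed

text \<open>Positivity at \<open>x0\<close> persists nearby. Since continuity of \<open>H\<close> is
  known for each fixed direction only, the variation of the form is controlled by the finite sum
  over the axes in \<open>norm_le_axis_sum\<close>.\<close>

lemma hessian_locally_bounded:
  fixes H :: "real ^ 'n::finite \<Rightarrow> real ^ 'n \<Rightarrow> real ^ 'n"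
  assumes \<Omega>: "open \<Omega>" "x0 \<in> \<Omega>" and lin: "\<And>y. y \<in> \<Omega> \<Longrightarrow> linear (H y)"
    and cont: "\<And>\<xi>. continuous_on \<Omega> (\<lambda>y. H y \<xi>)"
    and pos: "inner_form (\<lambda>\<xi> \<eta>. H x0 \<xi> \<bullet> \<eta>)"
  obtains \<delta> c C where "0 < \<delta>" "0 < c" "c \<le> C" "cball x0 \<delta> \<subseteq> \<Omega>"
    "\<And>y \<xi>. y \<in> cball x0 \<delta> \<Longrightarrow> c * (\<xi> \<bullet> \<xi>) \<le> H y \<xi> \<bullet> \<xi>" "\<And>y \<xi>. y \<in> cball x0 \<delta> \<Longrightarrow> H y \<xi> \<bullet> \<xi> \<le> C * (\<xi> \<bullet> \<xi>)"
proof -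
  obtain c where c: "0 < c" "\<And>\<xi>. c * (\<xi> \<bullet> \<xi>) \<le> H x0 \<xi> \<bullet> \<xi>" using inner_form_lower[OF pos] by blast
  obtain C where C: "0 < C" "\<And>\<xi>. \<bar>H x0 \<xi> \<bullet> \<xi>\<bar> \<le> C * (\<xi> \<bullet> \<xi>)"
    using symform_upper pos unfolding inner_form_def by blast
  define s where "s = (\<lambda>y. \<Sum>i\<in>UNIV. norm (H y (axis i 1) - H x0 (axis i 1)))"
  have "continuous_on \<Omega> s" unfolding s_def by (intro continuous_intros cont)
  moreover have s0: "s x0 = 0" by (simp add: s_def)
  ultimately have "open (\<Omega> \<inter> s -` {..<c / 2})" "x0 \<in> \<Omega> \<inter> s -` {..<c / 2}"
    using \<Omega> c by (auto intro: continuous_open_preimage)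
  then obtain \<delta> where \<delta>: "0 < \<delta>" "cball x0 \<delta> \<subseteq> \<Omega> \<inter> s -` {..<c / 2}"
    using open_contains_cball by blast
  have diff: "\<bar>H y \<xi> \<bullet> \<xi> - H x0 \<xi> \<bullet> \<xi>\<bar> \<le> c / 2 * (\<xi> \<bullet> \<xi>)" if "y \<in> cball x0 \<delta>" for y \<xi>
  proof -
    have y: "y \<in> \<Omega>" "s y < c / 2" using that \<delta> by auto
    have "linear (\<lambda>\<xi>. H y \<xi> - H x0 \<xi>)" using lin y \<Omega> by (intro linear_compose_sub) auto
    from norm_le_axis_sum[OF this, of \<xi>] have n: "norm (H y \<xi> - H x0 \<xi>) \<le> norm \<xi> * s y" by (simp add: s_def)
    have "\<bar>H y \<xi> \<bullet> \<xi> - H x0 \<xi> \<bullet> \<xi>\<bar> \<le> norm (H y \<xi> - H x0 \<xi>) * norm \<xi>"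
      by (metis Cauchy_Schwarz_ineq2 inner_diff_left)
    also have "\<dots> \<le> (norm \<xi> * (c / 2)) * norm \<xi>"
      using n y by (intro mult_right_mono order_trans[OF n] mult_left_mono) auto
    finally show ?thesis by (simp add: dot_square_norm power2_eq_square algebra_simps)
  qed
  show ?thesis
  proof (rule that[OF \<delta>(1)])
    show "0 < c / 2" "c / 2 \<le> max (C + c) (c / 2)" "cball x0 \<delta> \<subseteq> \<Omega>" using c \<delta> by auto
    fix y \<xi> assume y: "y \<in> cball x0 \<delta>"
    show "c / 2 * (\<xi> \<bullet> \<xi>) \<le> H y \<xi> \<bullet> \<xi>"
    proof -
      have "c * (\<xi> \<bullet> \<xi>) = c / 2 * (\<xi> \<bullet> \<xi>) + c / 2 * (\<xi> \<bullet> \<xi>)" by simp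
      then show ?thesis using diff[OF y, of \<xi>] c(2)[of \<xi>] by linarith
    qed
    have "H y \<xi> \<bullet> \<xi> \<le> (C + c) * (\<xi> \<bullet> \<xi>)"
    proof -
      have "c / 2 * (\<xi> \<bullet> \<xi>) \<le> c * (\<xi> \<bullet> \<xi>)" using c(1) by (intro mult_right_mono) auto
      moreover have "(C + c) * (\<xi> \<bullet> \<xi>) = C * (\<xi> \<bullet> \<xi>) + c * (\<xi> \<bullet> \<xi>)" by (rule distrib_right)
      ultimately show ?thesis using diff[OF y, of \<xi>] C(2)[of \<xi>] by linarith
    qed
    also have "\<dots> \<le> max (C + c) (c / 2) * (\<xi> \<bullet> \<xi>)" by (intro mult_right_mono) auto
    finally show "H y \<xi> \<bullet> \<xi> \<le> max (C + c) (c / 2) * (\<xi> \<bullet> \<xi>)" .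
  qed
qed

text \<open>\<open>H y\<close> is the Hessian as an operator, continuous direction by direction. Its
  symmetry is not part of the notion; \<open>eigs_imp_symform\<close> obtains it from the principal
  frame.\<close>

definition C2_graph ::
  "'a::euclidean_space set \<Rightarrow> ('a \<Rightarrow> real) \<Rightarrow> ('a \<Rightarrow> 'a) \<Rightarrow> ('a \<Rightarrow> 'a \<Rightarrow> 'a) \<Rightarrow> bool" where
  "C2_graph \<Omega> u g H \<longleftrightarrow> open \<Omega> \<and>
     (\<forall>y\<in>\<Omega>. (u has_derivative (\<lambda>\<xi>. g y \<bullet> \<xi>)) (at y)) \<and>
     (\<forall>y\<in>\<Omega>. (g has_derivative H y) (at y)) \<and> (\<forall>\<xi>. continuous_on \<Omega> (\<lambda>y. H y \<xi>))"

text \<open>Only nonnegative eigenvalues with \<open>S k\<close> positive are demanded, so that the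
  notion also covers the hypersurface that may be degenerate.\<close>

definition graph_equation ::
  "nat \<Rightarrow> (real ^ 'n::finite \<Rightarrow> real) \<Rightarrow> real ^ 'n \<Rightarrow> (real ^ 'n \<Rightarrow> real ^ 'n) \<Rightarrow> bool" where
  "graph_equation k \<phi> g H \<longleftrightarrow> symform (\<lambda>\<xi> \<eta>. H \<xi> \<bullet> \<eta>) \<and>
     (\<exists>lam. eigs (graph_metric g) (\<lambda>\<xi> \<eta>. H \<xi> \<bullet> \<eta>) lam \<and> (\<forall>i. 0 \<le> lam $ i) \<and> 0 < S k lam \<and> Q k lam = \<phi> g)"

text \<open>In a smaller ball tangent at \<open>x0\<close>, near \<open>x0\<close>, the difference
  dominates a small multiple of \<open>v\<close>: a negative minimum would be interior, where
  \<open>barrier_strict\<close> forbids it. Hence the difference has a nonzero inward derivative at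
  \<open>x0\<close>, against the equality of the gradients.\<close>

lemma hopf:
  fixes u1 u2 :: "real ^ 'n::finite \<Rightarrow> real" and \<phi> :: "real ^ 'n \<Rightarrow> real"
  assumes k: "0 < k" "k \<le> CARD('n) - 1"
    and C2: "C2_graph \<Omega> u1 g1 H1" "C2_graph \<Omega> u2 g2 H2"
    and x0: "x0 \<in> \<Omega>" "dist x0 z = R" "0 < R"
    and lip: "0 \<le> \<Lambda>" "\<And>g h. \<bar>\<phi> g - \<phi> h\<bar> \<le> \<Lambda> * norm (g - h)"
    and pos: "inner_form (\<lambda>\<xi> \<eta>. H1 x0 \<xi> \<bullet> \<eta>)"
    and eq: "\<And>y. y \<in> \<Omega> \<inter> ball z R \<Longrightarrow> graph_equation k \<phi> (g1 y) (H1 y)"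
            "\<And>y. y \<in> \<Omega> \<inter> ball z R \<Longrightarrow> graph_equation k \<phi> (g2 y) (H2 y)"
    and \<sigma>: "\<sigma> = 1 \<or> \<sigma> = -1"
    and w: "\<And>y. y \<in> \<Omega> \<inter> ball z R \<Longrightarrow> 0 < \<sigma> * (u1 y - u2 y)"
    and touch: "u1 x0 = u2 x0" "g1 x0 = g2 x0"
  shows False
proof -
  have \<Omega>: "open \<Omega>" and du1: "\<And>y. y \<in> \<Omega> \<Longrightarrow> (u1 has_derivative (\<lambda>\<xi>. g1 y \<bullet> \<xi>)) (at y)"
    and du2: "\<And>y. y \<in> \<Omega> \<Longrightarrow> (u2 has_derivative (\<lambda>\<xi>. g2 y \<bullet> \<xi>)) (at y)"
    and dg1: "\<And>y. y \<in> \<Omega> \<Longrightarrow> (g1 has_derivative H1 y) (at y)"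
    and dg2: "\<And>y. y \<in> \<Omega> \<Longrightarrow> (g2 has_derivative H2 y) (at y)"
    and cH1: "\<And>\<xi>. continuous_on \<Omega> (\<lambda>y. H1 y \<xi>)"
    using C2 by (auto simp: C2_graph_def)
  obtain \<delta>1 c C where \<delta>1: "0 < \<delta>1" "0 < c" "c \<le> C" "cball x0 \<delta>1 \<subseteq> \<Omega>"
    "\<And>y \<xi>. y \<in> cball x0 \<delta>1 \<Longrightarrow> c * (\<xi> \<bullet> \<xi>) \<le> H1 y \<xi> \<bullet> \<xi>"
    "\<And>y \<xi>. y \<in> cball x0 \<delta>1 \<Longrightarrow> H1 y \<xi> \<bullet> \<xi> \<le> C * (\<xi> \<bullet> \<xi>)"
    using hessian_locally_bounded[OF \<Omega> x0(1) has_derivative_linear[OF dg1] cH1 pos] by blast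
  \<comment> \<open>Centre of the internally tangent ball of half the radius: apart from
    \<open>x0\<close> its closure lies in the open ball \<open>ball z R\<close>, where the
    difference is strictly positive.\<close>
  define z' where "z' = (1 / 2) *\<^sub>R (x0 + z)"
  define R' where "R' = R / 2"
  have R': "0 < R'" using x0 by (simp add: R'_def)
  have x0z': "x0 - z' = (1 / 2) *\<^sub>R (x0 - z)" by (simp add: z'_def algebra_simps scaleR_left_distrib[symmetric])
  have dz': "dist x0 z' = R'" using x0 by (simp add: dist_norm x0z' R'_def)
  \<comment> \<open>At distance at most \<open>R' / 2\<close> from \<open>x0\<close> the vector
    \<open>y - z'\<close> keeps length at least \<open>R' / 2\<close>, which is the lower radius
    \<open>r1\<close> for the barrier.\<close>
  define \<delta> where "\<delta> = min \<delta>1 (R' / 2)"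
  have \<delta>: "0 < \<delta>" "\<delta> \<le> \<delta>1" "\<delta> \<le> R' / 2" using \<delta>1 R' by (auto simp: \<delta>_def)
  have sub: "cball x0 \<delta> \<subseteq> cball x0 \<delta>1" using \<delta> by auto
  then have subO: "cball x0 \<delta> \<subseteq> \<Omega>" using \<delta>1 by blast
  define A where "A = cball z' R' \<inter> cball x0 \<delta>"
  have AO: "A \<subseteq> \<Omega>" using subO by (auto simp: A_def)
  have cA: "compact A" by (simp add: A_def compact_Int)
  have inball: "y \<in> ball z R" if y: "y \<in> cball z' R'" "y \<noteq> x0" for y
  proof (rule ccontr)
    assume "y \<notin> ball z R"
    then have 1: "R \<le> norm (y - z)" by (simp add: dist_norm norm_minus_commute)
    have 2: "norm (y - z') \<le> R'" using y by (simp add: dist_norm norm_minus_commute)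
    have zz: "y - z = (y - z') + (x0 - z')" by (simp add: z'_def algebra_simps scaleR_left_distrib[symmetric])
    have 3: "norm (x0 - z') = R'" using dz' by (simp add: dist_norm)
    have 4: "norm ((y - z') + (x0 - z')) = norm (y - z') + norm (x0 - z')"
      using 1 2 3 zz norm_triangle_ineq[of "y - z'" "x0 - z'"] by (simp add: R'_def)
    have 5: "norm (y - z') = R'" using 1 2 3 4 zz by (simp add: R'_def)
    have "norm (y - z') *\<^sub>R (x0 - z') = norm (x0 - z') *\<^sub>R (y - z')" using 4 norm_triangle_eq by blast
    then have "y - z' = x0 - z'" unfolding 3 5 using R' by simp
    then show False using y by simp
  qed
  have w0: "0 \<le> \<sigma> * (u1 y - u2 y)" if "y \<in> A" for y
    using w[of y] inball[of y] that AO touch by (cases "y = x0") (auto simp: A_def less_imp_le)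
  have cont1: "continuous_on A u1" "continuous_on A u2"
    using du1 du2 AO by (auto intro!: continuous_at_imp_continuous_on dest: has_derivative_continuous)
  have "continuous_on (cball x0 \<delta>) g1"
    using dg1 subO by (auto intro!: continuous_at_imp_continuous_on dest: has_derivative_continuous)
  then have "compact (g1 ` cball x0 \<delta>)" by (intro compact_continuous_image) auto
  then obtain B where B: "0 < B" "\<And>y. y \<in> cball x0 \<delta> \<Longrightarrow> norm (g1 y) \<le> B"
    by (metis bounded_pos compact_imp_bounded imageI)
  have r12: "0 < R' / 2" "R' / 2 \<le> R'" using R' by auto
  obtain \<alpha> \<eta>0 where \<alpha>: "0 < \<alpha>" "0 < \<eta>0"
    "\<And>g H lam y \<eta> \<sigma> H2 mu. norm g \<le> B \<Longrightarrow> symform H \<Longrightarrow> (\<And>v. c * (v \<bullet> v) \<le> H v v) \<Longrightarrow>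
      (\<And>v. H v v \<le> C * (v \<bullet> v)) \<Longrightarrow> eigs (graph_metric g) H lam \<Longrightarrow> Q k lam = \<phi> g \<Longrightarrow>
      R' / 2 \<le> norm y \<Longrightarrow> norm y \<le> R' \<Longrightarrow> 0 < \<eta> \<Longrightarrow> \<eta> < \<eta>0 \<Longrightarrow> \<sigma> = 1 \<or> \<sigma> = -1 \<Longrightarrow>
      symform H2 \<Longrightarrow> (\<And>v. 0 \<le> H2 v v) \<Longrightarrow>
      (\<And>v. \<sigma> * H2 v v \<le> \<sigma> * H v v - \<eta> * (2 * \<alpha> * (y \<bullet> v)\<^sup>2 - v \<bullet> v)) \<Longrightarrow>
      eigs (graph_metric (g + (\<sigma> * \<eta>) *\<^sub>R y)) H2 mu \<Longrightarrow> 0 < S k mu \<Longrightarrow>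
      Q k mu = \<phi> (g + (\<sigma> * \<eta>) *\<^sub>R y) \<Longrightarrow> False"
    using barrier_strict[OF k \<delta>1(2,3) less_imp_le[OF B(1)] r12 lip] by blast
  define v where "v = (\<lambda>y. exp (- \<alpha> * ((y - z') \<bullet> (y - z'))) - exp (- \<alpha> * R'\<^sup>2))"
  have v_le: "v y \<le> 1" for y
  proof -
    have "exp (- \<alpha> * ((y - z') \<bullet> (y - z'))) \<le> 1" using \<alpha> by simp
    then show ?thesis using exp_ge_zero[of "- \<alpha> * R'\<^sup>2"] unfolding v_def by linarith
  qed
  have v_sphere: "v y = 0" if "dist z' y = R'" for y
    using that by (simp add: v_def dot_square_norm dist_norm norm_minus_commute)
  have cv: "continuous_on S v" for S unfolding v_def by (intro continuous_intros)
  \<comment> \<open>The part of the boundary of \<open>A\<close> on which the barrier need not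
    vanish; there compactness gives a positive lower bound \<open>m\<close>.\<close>
  define A' where "A' = cball z' R' \<inter> sphere x0 \<delta>"
  have cA': "compact A'" by (simp add: A'_def compact_Int_closed)
  have A'A: "A' \<subseteq> A" by (auto simp: A'_def A_def)
  obtain m where m: "0 < m" "\<And>y. y \<in> A' \<Longrightarrow> m \<le> \<sigma> * (u1 y - u2 y)"
  proof (cases "A' = {}")
    case False
    have "continuous_on A' (\<lambda>y. \<sigma> * (u1 y - u2 y))"
      using cont1 A'A by (intro continuous_intros) (auto intro: continuous_on_subset)
    from continuous_attains_inf[OF cA' False this] obtain y where
      y: "y \<in> A'" "\<And>x. x \<in> A' \<Longrightarrow> \<sigma> * (u1 y - u2 y) \<le> \<sigma> * (u1 x - u2 x)" by blast
    have "y \<noteq> x0" using y(1) \<delta> by (auto simp: A'_def)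
    then have "0 < \<sigma> * (u1 y - u2 y)" using y(1) A'A AO inball[of y] by (intro w) (auto simp: A'_def)
    then show ?thesis using that y(2) by blast
  qed (use that[of 1] in auto)
  \<comment> \<open>Since \<open>v \<le> 1\<close>, the bound by \<open>m\<close> settles the outer
    boundary part \<open>A'\<close>; the other bound makes \<open>E y\<close> smaller than
    \<open>\<eta>0\<close>.\<close>
  define \<epsilon> where "\<epsilon> = min m (\<eta>0 / (4 * \<alpha>))"
  have \<epsilon>: "0 < \<epsilon>" "\<epsilon> \<le> m" "2 * \<alpha> * \<epsilon> < \<eta>0"
  proof -
    show "0 < \<epsilon>" "\<epsilon> \<le> m" using m \<alpha> by (auto simp: \<epsilon>_def)
    have "2 * \<alpha> * \<epsilon> \<le> 2 * \<alpha> * (\<eta>0 / (4 * \<alpha>))" using \<alpha> by (intro mult_left_mono) (auto simp: \<epsilon>_def)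
    also have "\<dots> < \<eta>0" using \<alpha> by simp
    finally show "2 * \<alpha> * \<epsilon> < \<eta>0" .
  qed
  \<comment> \<open>\<open>E y *\<^sub>R (y - z')\<close> is minus the gradient of
    \<open>\<epsilon> * v\<close>, so \<open>E y\<close> plays the part of \<open>\<eta>\<close> in
    \<open>barrier_strict\<close>.\<close>
  define E where "E = (\<lambda>y. 2 * \<alpha> * \<epsilon> * exp (- \<alpha> * ((y - z') \<bullet> (y - z'))))"
  define p where "p = (\<lambda>y. \<sigma> * (u1 y - u2 y) - \<epsilon> * v y)"
  define P where "P = (\<lambda>y. \<sigma> *\<^sub>R (g1 y - g2 y) + E y *\<^sub>R (y - z'))"
  have dp: "(p has_derivative (\<lambda>\<xi>. P y \<bullet> \<xi>)) (at y)" if "y \<in> \<Omega>" for y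
    unfolding p_def v_def P_def E_def
    by (rule derivative_eq_intros du1[OF that] du2[OF that] refl)+
      (simp add: fun_eq_iff algebra_simps inner_commute)
  have dP: "(P has_derivative (\<lambda>\<xi>. \<sigma> *\<^sub>R (H1 y \<xi> - H2 y \<xi>) +
      E y *\<^sub>R (\<xi> - (2 * \<alpha> * ((y - z') \<bullet> \<xi>)) *\<^sub>R (y - z')))) (at y)" if "y \<in> \<Omega>" for y
    unfolding P_def E_def
    by (rule derivative_eq_intros dg1[OF that] dg2[OF that] refl)+
      (simp add: fun_eq_iff algebra_simps inner_commute)
  have ge: "0 \<le> p y" if yA: "y \<in> A" for y
  proof (rule ccontr)
    assume "\<not> 0 \<le> p y"
    have "continuous_on A p" unfolding p_def by (intro continuous_intros cont1 cv)
    moreover have "A \<noteq> {}" using yA by blast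
    ultimately obtain y1 where y1: "y1 \<in> A" "\<And>x. x \<in> A \<Longrightarrow> p y1 \<le> p x"
      using continuous_attains_inf[OF cA] by blast
    have neg: "p y1 < 0" using y1(2)[OF yA] \<open>\<not> 0 \<le> p y\<close> by linarith
    have "dist z' y1 \<noteq> R'"
    proof
      assume "dist z' y1 = R'"
      then have "p y1 = \<sigma> * (u1 y1 - u2 y1)" by (simp add: p_def v_sphere)
      then show False using w0[OF y1(1)] neg by linarith
    qed
    then have in1: "dist z' y1 < R'" using y1(1) by (simp add: A_def)
    have "dist x0 y1 \<noteq> \<delta>"
    proof
      assume "dist x0 y1 = \<delta>"
      then have "y1 \<in> A'" using y1(1) by (simp add: A_def A'_def)
      then have "m \<le> \<sigma> * (u1 y1 - u2 y1)" by (rule m(2))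
      moreover have "\<epsilon> * v y1 \<le> \<epsilon> * 1" using v_le \<epsilon> by (intro mult_left_mono) auto
      ultimately show False using neg \<epsilon> unfolding p_def by linarith
    qed
    then have in2: "dist x0 y1 < \<delta>" using y1(1) by (simp add: A_def)
    have "open (ball z' R' \<inter> ball x0 \<delta>)" "y1 \<in> ball z' R' \<inter> ball x0 \<delta>" using in1 in2 by auto
    then obtain r where r: "0 < r" "ball y1 r \<subseteq> ball z' R' \<inter> ball x0 \<delta>"
      using open_contains_ball by blast
    have rA: "ball y1 r \<subseteq> A" using r(2) by (force simp: A_def)
    have y1O: "y1 \<in> \<Omega>" using y1(1) AO by blast
    \<comment> \<open>The first-order condition expresses \<open>g2 y1\<close> as
      \<open>g1 y1\<close> plus the barrier term, the second-order condition compares the Hessians: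
      together they are the hypotheses of \<open>barrier_strict\<close>.\<close>
    have so: "P y1 = 0" "\<And>\<xi>. 0 \<le> (\<sigma> *\<^sub>R (H1 y1 \<xi> - H2 y1 \<xi>) + E y1 *\<^sub>R (\<xi> - (2 * \<alpha> * ((y1 - z') \<bullet> \<xi>)) *\<^sub>R (y1 - z'))) \<bullet> \<xi>"
      using second_order_min[OF r(1), of y1 p P] y1(2) rA AO dp dP[OF y1O] by blast+
    have "y1 \<noteq> x0" using in1 dz' by (auto simp: dist_commute)
    then have y1b: "y1 \<in> \<Omega> \<inter> ball z R" using inball[of y1] in1 y1O by auto
    obtain lam where lam: "symform (\<lambda>\<xi> \<eta>. H1 y1 \<xi> \<bullet> \<eta>)" "eigs (graph_metric (g1 y1)) (\<lambda>\<xi> \<eta>. H1 y1 \<xi> \<bullet> \<eta>) lam"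
        "Q k lam = \<phi> (g1 y1)" using eq(1)[OF y1b] unfolding graph_equation_def by blast
    obtain mu where mu: "symform (\<lambda>\<xi> \<eta>. H2 y1 \<xi> \<bullet> \<eta>)" "eigs (graph_metric (g2 y1)) (\<lambda>\<xi> \<eta>. H2 y1 \<xi> \<bullet> \<eta>) mu"
        "\<And>i. 0 \<le> mu $ i" "0 < S k mu" "Q k mu = \<phi> (g2 y1)" using eq(2)[OF y1b] unfolding graph_equation_def by blast
    let ?y = "y1 - z'"
    have \<eta>: "0 < E y1" "E y1 < \<eta>0"
    proof -
      show "0 < E y1" using \<alpha> \<epsilon> by (simp add: E_def)
      have "E y1 \<le> 2 * \<alpha> * \<epsilon> * 1" unfolding E_def using \<alpha> \<epsilon> by (intro mult_left_mono) auto
      then show "E y1 < \<eta>0" using \<epsilon>(3) by linarith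
    qed
    have \<sigma>\<sigma>: "\<sigma> * \<sigma> = 1" using \<sigma> by auto
    have "\<sigma> *\<^sub>R P y1 = (g1 y1 - g2 y1) + (\<sigma> * E y1) *\<^sub>R ?y"
      unfolding P_def scaleR_add_right scaleR_scaleR \<sigma>\<sigma> by simp
    then have g2: "g2 y1 = g1 y1 + (\<sigma> * E y1) *\<^sub>R ?y" using so(1) by (simp add: algebra_simps)
    have y1\<delta>: "y1 \<in> cball x0 \<delta>" "y1 \<in> cball x0 \<delta>1" using in2 \<delta> by auto
    show False
    proof (rule \<alpha>(3)[OF B(2)[OF y1\<delta>(1)] lam(1) \<delta>1(5)[OF y1\<delta>(2)] \<delta>1(6)[OF y1\<delta>(2)] lam(2,3) _ _ \<eta> \<sigma> mu(1) _ _
          mu(2)[unfolded g2] mu(4) mu(5)[unfolded g2]])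
      show "norm ?y \<le> R'" using in1 by (simp add: dist_norm norm_minus_commute)
      have "R' \<le> norm (x0 - y1) + norm (y1 - z')"
        using dz' norm_triangle_ineq[of "x0 - y1" "y1 - z'"] by (simp add: dist_norm)
      then show "R' / 2 \<le> norm ?y" using in2 \<delta> by (simp add: dist_norm)
      show "0 \<le> H2 y1 v \<bullet> v" for v
        using form_nonneg_of_eigs[OF inner_form_graph_metric mu(1,2,3)] .
      show "\<sigma> * (H2 y1 v \<bullet> v) \<le> \<sigma> * (H1 y1 v \<bullet> v) - E y1 * (2 * \<alpha> * (?y \<bullet> v)\<^sup>2 - v \<bullet> v)" for v
        using so(2)[of v] by (simp add: inner_add_left inner_diff_left power2_eq_square algebra_simps)
    qed
  qed
  define n where "n = z' - x0"
  have nn: "n \<bullet> n = R'\<^sup>2" using dz' by (simp add: n_def dot_square_norm dist_norm norm_minus_commute)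
  have Px0: "P x0 \<bullet> n = - (E x0 * R'\<^sup>2)"
  proof -
    have "P x0 = - (E x0 *\<^sub>R n)" by (simp add: P_def touch n_def algebra_simps)
    then show ?thesis by (simp add: nn)
  qed
  \<comment> \<open>With equal gradients only the barrier contributes, so \<open>p\<close> becomes
    negative on entering the small ball.\<close>
  have "P x0 \<bullet> n < 0" unfolding Px0 using \<alpha> \<epsilon> R' by (simp add: E_def)
  moreover have "((\<lambda>t. p (x0 + t *\<^sub>R n)) has_real_derivative P x0 \<bullet> n) (at 0)"
    by (rule gradient_along_line) (use dp[OF x0(1)] in simp)
  ultimately obtain d where d: "0 < d" "\<And>h. 0 < h \<Longrightarrow> h < d \<Longrightarrow> p (x0 + h *\<^sub>R n) < p (x0 + 0 *\<^sub>R n)"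
    using DERIV_neg_dec_right[of "\<lambda>t. p (x0 + t *\<^sub>R n)" "P x0 \<bullet> n" 0] by auto
  have p0: "p x0 = 0" using dz' by (simp add: p_def touch v_sphere dist_commute)
  define h where "h = Min {d / 2, 1, \<delta> / R'}"
  have h_le: "h \<le> d / 2" "h \<le> 1" "h \<le> \<delta> / R'" unfolding h_def by (rule Min_le; simp)+
  have "0 < h" using d \<delta> R' by (simp add: h_def)
  then have h: "0 < h" "h < d" "h \<le> 1" "h \<le> \<delta> / R'" using h_le d by auto
  have "x0 + h *\<^sub>R n \<in> A"
  proof -
    have nR: "norm n = R'" using dz' by (simp add: n_def dist_norm norm_minus_commute)
    have "z' - (x0 + h *\<^sub>R n) = (1 - h) *\<^sub>R n" by (simp add: n_def algebra_simps)
    then have "dist z' (x0 + h *\<^sub>R n) = (1 - h) * R'" using h nR by (simp add: dist_norm)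
    also have "\<dots> \<le> R'" using h R' by (simp add: mult_left_le_one_le)
    finally have 1: "dist z' (x0 + h *\<^sub>R n) \<le> R'" .
    have "dist x0 (x0 + h *\<^sub>R n) = h * R'" using h nR by (simp add: dist_norm)
    also have "\<dots> \<le> \<delta>" using h R' by (simp add: pos_le_divide_eq)
    finally show ?thesis using 1 by (simp add: A_def)
  qed
  then show False using ge d(2)[OF h(1,2)] p0 by force
qed

text \<open>Among the contact points, take one nearest to a hypothetical point \<open>y\<close>
  without contact. The ball around \<open>y\<close> reaching it is free of contact and touches it,
  which is the configuration excluded by \<open>hopf\<close>. For \<open>y\<close> within
  \<open>r / 2\<close> of \<open>q\<close> that ball stays in \<open>ball q r\<close>.\<close>

lemma strong_maximum:
  fixes u1 u2 :: "real ^ 'n::finite \<Rightarrow> real" and \<phi> :: "real ^ 'n \<Rightarrow> real"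
  assumes k: "0 < k" "k \<le> CARD('n) - 1"
    and C2: "C2_graph (ball q r) u1 g1 H1" "C2_graph (ball q r) u2 g2 H2" and r: "0 < r"
    and lip: "0 \<le> \<Lambda>" "\<And>g h. \<bar>\<phi> g - \<phi> h\<bar> \<le> \<Lambda> * norm (g - h)"
    and pos: "\<And>y. y \<in> ball q r \<Longrightarrow> inner_form (\<lambda>\<xi> \<eta>. H1 y \<xi> \<bullet> \<eta>)"
    and eq: "\<And>y. y \<in> ball q r \<Longrightarrow> graph_equation k \<phi> (g1 y) (H1 y)"
            "\<And>y. y \<in> ball q r \<Longrightarrow> graph_equation k \<phi> (g2 y) (H2 y)"
    and \<sigma>: "\<sigma> = 1 \<or> \<sigma> = -1"
    and w: "\<And>y. y \<in> ball q r \<Longrightarrow> 0 \<le> \<sigma> * (u1 y - u2 y)"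
    and touch: "u1 q = u2 q" and y: "y \<in> ball q (r / 2)"
  shows "u1 y = u2 y"
proof (rule ccontr)
  assume ne: "u1 y \<noteq> u2 y"
  let ?\<Omega> = "ball q r"
  have du1: "\<And>y. y \<in> ?\<Omega> \<Longrightarrow> (u1 has_derivative (\<lambda>\<xi>. g1 y \<bullet> \<xi>)) (at y)"
    and du2: "\<And>y. y \<in> ?\<Omega> \<Longrightarrow> (u2 has_derivative (\<lambda>\<xi>. g2 y \<bullet> \<xi>)) (at y)"
    and dg1: "\<And>y. y \<in> ?\<Omega> \<Longrightarrow> (g1 has_derivative H1 y) (at y)"
    and dg2: "\<And>y. y \<in> ?\<Omega> \<Longrightarrow> (g2 has_derivative H2 y) (at y)"
    using C2 by (auto simp: C2_graph_def)
  define Z where "Z = cball y (dist y q) \<inter> {x. u1 x = u2 x}"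
  have sub: "cball y (dist y q) \<subseteq> ball q r"
  proof
    fix x assume "x \<in> cball y (dist y q)"
    then have "dist y x \<le> dist q y" by (simp add: dist_commute)
    then show "x \<in> ball q r" using y dist_triangle[of q x y] by simp
  qed
  have "continuous_on (cball y (dist y q)) (\<lambda>x. u1 x - u2 x)"
    using du1 du2 sub
    by (intro continuous_on_diff continuous_at_imp_continuous_on ballI has_derivative_continuous) blast+
  then have "closedin (top_of_set (cball y (dist y q))) (cball y (dist y q) \<inter> (\<lambda>x. u1 x - u2 x) -` {0})"
    by (rule continuous_closedin_preimage) simp
  moreover have "cball y (dist y q) \<inter> (\<lambda>x. u1 x - u2 x) -` {0} = Z" by (auto simp: Z_def)
  ultimately have "compact Z" using closedin_compact compact_cball by metis
  moreover have "q \<in> Z" using touch by (simp add: Z_def)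
  ultimately obtain x0 where x0: "x0 \<in> Z" "\<And>x. x \<in> Z \<Longrightarrow> dist y x0 \<le> dist y x"
    using distance_attains_inf[of Z y] compact_imp_closed by blast
  have R: "0 < dist x0 y" using x0(1) ne by (auto simp: Z_def)
  have x0O: "x0 \<in> ?\<Omega>" and x0u: "u1 x0 = u2 x0" using x0(1) sub by (auto simp: Z_def)
  have pos': "0 < \<sigma> * (u1 x - u2 x)" if "x \<in> ?\<Omega> \<inter> ball y (dist x0 y)" for x
  proof -
    have "x \<in> cball y (dist y q)" using that x0(1) by (auto simp: Z_def dist_commute)
    moreover have "x \<notin> Z" using x0(2)[of x] that by (auto simp: dist_commute)
    ultimately have "u1 x \<noteq> u2 x" by (simp add: Z_def)
    then show ?thesis using w[of x] that \<sigma> by (auto simp: less_le)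
  qed
  \<comment> \<open>The nonnegative difference attains its minimum 0 at the inner point
    \<open>x0\<close>, so the gradients agree there.\<close>
  have "\<sigma> *\<^sub>R (g1 x0 - g2 x0) = 0"
  proof -
    obtain s where s: "0 < s" "ball x0 s \<subseteq> ?\<Omega>" using openE[OF open_ball x0O] by blast
    show ?thesis
    proof (rule second_order_min(1)[OF s(1), where y=x0 and u="\<lambda>y. \<sigma> * (u1 y - u2 y)" and g="\<lambda>x. \<sigma> *\<^sub>R (g1 x - g2 x)"])
      show "\<sigma> * (u1 x0 - u2 x0) \<le> \<sigma> * (u1 x - u2 x)" if "x \<in> ball x0 s" for x
        using w[of x] that s x0u by auto
      show "((\<lambda>y. \<sigma> * (u1 y - u2 y)) has_derivative (\<lambda>\<xi>. \<sigma> *\<^sub>R (g1 x - g2 x) \<bullet> \<xi>)) (at x)" if "x \<in> ball x0 s" for x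
        using that s by (auto intro!: derivative_eq_intros du1 du2 simp: inner_diff_left)
      show "((\<lambda>x. \<sigma> *\<^sub>R (g1 x - g2 x)) has_derivative (\<lambda>\<xi>. \<sigma> *\<^sub>R (H1 x0 \<xi> - H2 x0 \<xi>))) (at x0)"
        by (intro derivative_intros dg1 dg2 x0O)
    qed
  qed
  then have g: "g1 x0 = g2 x0" using \<sigma> by auto
  show False
    by (rule hopf[OF k C2 x0O refl R lip pos[OF x0O] _ _ \<sigma> pos' x0u g]) (use eq in auto)
qed


subsection \<open>Inverse functions of class two\<close>

text \<open>Continuity of the derivative is required for each fixed direction; in finite dimensions
  this is continuity as an operator, without an operator topology.\<close>

definition C1 :: "'a::euclidean_space set \<Rightarrow> ('a \<Rightarrow> 'b::euclidean_space) \<Rightarrow> bool" where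
  "C1 U f \<longleftrightarrow> (\<exists>f'. (\<forall>s\<in>U. (f has_derivative f' s) (at s)) \<and> (\<forall>v. continuous_on U (\<lambda>s. f' s v)))"

lemma C1I:
  "(\<And>s. s \<in> U \<Longrightarrow> (f has_derivative f' s) (at s)) \<Longrightarrow> (\<And>v. continuous_on U (\<lambda>s. f' s v)) \<Longrightarrow> C1 U f"
  unfolding C1_def by blast

lemma C1_continuous: "C1 U f \<Longrightarrow> continuous_on U f"
  unfolding C1_def by (metis continuous_at_imp_continuous_on has_derivative_continuous)

lemma C1_subset: "C1 U f \<Longrightarrow> V \<subseteq> U \<Longrightarrow> C1 V f"
  unfolding C1_def by (meson continuous_on_subset subsetD)

lemma C1_const: "C1 U (\<lambda>s. c)"
  by (rule C1I[where f'="\<lambda>s v. 0"]) auto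

lemma C1_add:
  assumes "C1 U f" "C1 U g" shows "C1 U (\<lambda>s. f s + g s)"
proof -
  obtain f' g' where "\<And>s. s \<in> U \<Longrightarrow> (f has_derivative f' s) (at s)" "\<And>v. continuous_on U (\<lambda>s. f' s v)"
    "\<And>s. s \<in> U \<Longrightarrow> (g has_derivative g' s) (at s)" "\<And>v. continuous_on U (\<lambda>s. g' s v)"
    using assms unfolding C1_def by blast
  then show ?thesis
    by (intro C1I[where f'="\<lambda>s v. f' s v + g' s v"] has_derivative_add continuous_on_add) auto
qed

lemma C1_mult:
  fixes f g :: "'a::euclidean_space \<Rightarrow> real"
  assumes "C1 U f" "C1 U g" shows "C1 U (\<lambda>s. f s * g s)"
proof -
  obtain f' g' where "\<And>s. s \<in> U \<Longrightarrow> (f has_derivative f' s) (at s)" "\<And>v. continuous_on U (\<lambda>s. f' s v)"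
    "\<And>s. s \<in> U \<Longrightarrow> (g has_derivative g' s) (at s)" "\<And>v. continuous_on U (\<lambda>s. g' s v)"
    using assms unfolding C1_def by blast
  then show ?thesis
    using C1_continuous[OF assms(1)] C1_continuous[OF assms(2)]
    by (intro C1I[where f'="\<lambda>s v. f s * g' s v + f' s v * g s"] has_derivative_mult continuous_on_add continuous_on_mult) auto
qed

lemma C1_sum: "finite A \<Longrightarrow> (\<And>i. i \<in> A \<Longrightarrow> C1 U (f i)) \<Longrightarrow> C1 U (\<lambda>s. \<Sum>i\<in>A. f i s)"
  by (induction A rule: finite_induct) (auto intro: C1_const C1_add)

lemma C1_prod:
  fixes f :: "'i \<Rightarrow> 'a::euclidean_space \<Rightarrow> real"
  shows "finite A \<Longrightarrow> (\<And>i. i \<in> A \<Longrightarrow> C1 U (f i)) \<Longrightarrow> C1 U (\<lambda>s. \<Prod>i\<in>A. f i s)"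
  by (induction A rule: finite_induct) (auto intro: C1_const C1_mult)

lemma C1_divide:
  fixes f g :: "'a::euclidean_space \<Rightarrow> real"
  assumes f: "C1 U f" and g: "C1 U g" and nz: "\<And>s. s \<in> U \<Longrightarrow> g s \<noteq> 0"
  shows "C1 U (\<lambda>s. f s / g s)"
proof -
  obtain g' where g': "\<And>s. s \<in> U \<Longrightarrow> (g has_derivative g' s) (at s)" "\<And>v. continuous_on U (\<lambda>s. g' s v)"
    using g unfolding C1_def by blast
  have "C1 U (\<lambda>s. inverse (g s))"
    using g' nz C1_continuous[OF g]
    by (intro C1I[where f'="\<lambda>s v. - (inverse (g s) * g' s v * inverse (g s))"] Deriv.has_derivative_inverse continuous_intros) auto
  from C1_mult[OF f this] show ?thesis by (simp add: divide_inverse)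
qed

lemma C1_linear:
  assumes "bounded_linear T" "C1 U f" shows "C1 U (\<lambda>s. T (f s))"
proof -
  obtain f' where "\<And>s. s \<in> U \<Longrightarrow> (f has_derivative f' s) (at s)" "\<And>v. continuous_on U (\<lambda>s. f' s v)"
    using assms unfolding C1_def by blast
  then show ?thesis
    by (intro C1I[where f'="\<lambda>s v. T (f' s v)"] bounded_linear.has_derivative[OF assms(1)]
        bounded_linear.continuous_on[OF assms(1)]) auto
qed

lemma C1_vec:
  fixes f :: "'n::finite \<Rightarrow> 'a::euclidean_space \<Rightarrow> real"
  assumes "\<And>i. C1 U (f i)" shows "C1 U (\<lambda>s. \<chi> i. f i s)"
proof -
  have "C1 U (\<lambda>s. \<Sum>i\<in>UNIV. f i s *\<^sub>R axis i (1::real))"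
    by (intro C1_sum C1_linear[OF bounded_linear_scaleR_left] assms) auto
  moreover have "(\<Sum>i\<in>UNIV. f i s *\<^sub>R axis i (1::real)) = (\<chi> i. f i s)" for s
    by (simp add: vec_eq_iff axis_def if_distrib cong: if_cong)
  ultimately show ?thesis by simp
qed

text \<open>Both the base point and the direction in \<open>f' (\<theta> y) (\<theta>' y v)\<close>
  vary; expanding the direction along the axes reduces the continuity to fixed directions.\<close>

lemma C1_compose:
  fixes f :: "real ^ 'n::finite \<Rightarrow> 'b::euclidean_space"
  assumes f: "C1 U f" and th: "C1 V \<theta>" "\<And>y. y \<in> V \<Longrightarrow> \<theta> y \<in> U"
  shows "C1 V (\<lambda>y. f (\<theta> y))"
proof -
  obtain f' where f': "\<And>s. s \<in> U \<Longrightarrow> (f has_derivative f' s) (at s)" "\<And>v. continuous_on U (\<lambda>s. f' s v)"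
    using f unfolding C1_def by blast
  obtain \<theta>' where t': "\<And>y. y \<in> V \<Longrightarrow> (\<theta> has_derivative \<theta>' y) (at y)" "\<And>v. continuous_on V (\<lambda>y. \<theta>' y v)"
    using th(1) unfolding C1_def by blast
  show ?thesis
  proof (rule C1I[where f'="\<lambda>y v. f' (\<theta> y) (\<theta>' y v)"])
    show "((\<lambda>y. f (\<theta> y)) has_derivative (\<lambda>v. f' (\<theta> y) (\<theta>' y v))) (at y)" if "y \<in> V" for y
      using has_derivative_compose[OF t'(1)[OF that] f'(1)[OF th(2)[OF that]]] .
    show "continuous_on V (\<lambda>y. f' (\<theta> y) (\<theta>' y v))" for v
    proof -
      have "continuous_on V (\<lambda>y. \<Sum>i\<in>UNIV. (\<theta>' y v $ i) *\<^sub>R f' (\<theta> y) (axis i 1))"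
        using th(2) by (intro continuous_intros t'(2) continuous_on_compose2[OF f'(2) C1_continuous[OF th(1)]]) auto
      moreover have "f' (\<theta> y) w = (\<Sum>i\<in>UNIV. (w $ i) *\<^sub>R f' (\<theta> y) (axis i 1))" if "y \<in> V" for y w
      proof -
        have lin: "linear (f' (\<theta> y))" using f'(1)[OF th(2)[OF that]] by (rule has_derivative_linear)
        have "f' (\<theta> y) w = f' (\<theta> y) (\<Sum>i\<in>UNIV. w $ i *\<^sub>R axis i 1)"
          using basis_expansion[of w] by (simp add: scalar_mult_eq_scaleR)
        then show ?thesis by (simp add: linear_sum[OF lin] linear_scale[OF lin])
      qed
      ultimately show ?thesis by (simp cong: continuous_on_cong)
    qed
  qed
qed

lemma C1_det:
  fixes M :: "'a::euclidean_space \<Rightarrow> real ^ 'n::finite ^ 'n"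
  assumes "\<And>i j. C1 U (\<lambda>s. M s $ i $ j)" shows "C1 U (\<lambda>s. det (M s))"
  unfolding det_def by (intro C1_sum C1_mult C1_prod C1_const assms) auto

definition C2_map :: "'a::euclidean_space set \<Rightarrow> ('a \<Rightarrow> 'b::euclidean_space) \<Rightarrow> ('a \<Rightarrow> 'a \<Rightarrow> 'b) \<Rightarrow> bool" where
  "C2_map U f f' \<longleftrightarrow> (\<forall>s\<in>U. (f has_derivative f' s) (at s)) \<and> (\<forall>v. C1 U (\<lambda>s. f' s v))"

lemma C2_map_linear: "bounded_linear T \<Longrightarrow> C2_map U f f' \<Longrightarrow> C2_map U (\<lambda>s. T (f s)) (\<lambda>s v. T (f' s v))"
  unfolding C2_map_def by (auto intro: C1_linear bounded_linear.has_derivative)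

text \<open>The inverse function theorem supplies one derivative of \<open>\<theta>\<close>. The
  second comes from Cramer's rule, which makes the inverse of the derivative a quotient of
  determinants of C1 entries. The conclusion concerns \<open>F (\<theta> y)\<close> because height
  functions and boundary functions are used in this form.\<close>

lemma C2_inverse_function:
  fixes \<Phi> :: "real ^ 'n::finite \<Rightarrow> real ^ 'n"
  assumes U: "open U" "u0 \<in> U" and \<Phi>: "C2_map U \<Phi> D" and inj: "inj (D u0)"
  obtains U0 V \<theta> where "open U0" "u0 \<in> U0" "U0 \<subseteq> U" "open V" "homeomorphism U0 V \<Phi> \<theta>"
    "\<And>F F'. C2_map U F F' \<Longrightarrow> \<exists>g H. C2_graph V (\<lambda>y. F (\<theta> y)) g H"
proof -
  have D: "\<And>s. s \<in> U \<Longrightarrow> (\<Phi> has_derivative D s) (at s)" "\<And>v. C1 U (\<lambda>s. D s v)"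
    using \<Phi> by (auto simp: C2_map_def)
  have bl: "bounded_linear (D s)" if "s \<in> U" for s using D(1)[OF that] by (rule has_derivative_bounded_linear)
  define B where "B = (\<lambda>s. Blinfun (D s))"
  have B: "blinfun_apply (B s) = D s" if "s \<in> U" for s
    using bl[OF that] by (simp add: B_def bounded_linear_Blinfun_apply)
  have contB: "continuous_on U B"
  proof (rule continuous_on_blinfun_componentwise)
    fix i :: "real ^ 'n" assume "i \<in> Basis"
    show "continuous_on U (\<lambda>s. blinfun_apply (B s) i)"
      using C1_continuous[OF D(2)[of i]] B by (simp cong: continuous_on_cong)
  qed
  have lin0: "linear (D u0)" using bl[OF U(2)] by (simp add: linear_conv_bounded_linear)
  obtain I where I: "linear I" "\<And>x. I (D u0 x) = x"
    using linear_injective_left_inverse[OF lin0 inj] by (metis comp_apply id_apply)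
  have "Blinfun I o\<^sub>L B u0 = id_blinfun"
    using I B[OF U(2)] by (intro blinfun_eqI) (simp add: bounded_linear_Blinfun_apply linear_conv_bounded_linear)
  then have inv: "Blinfun I o\<^sub>L B u0 = id_blinfun" .
  have derB: "\<And>x. x \<in> U \<Longrightarrow> (\<Phi> has_derivative blinfun_apply (B x)) (at x)" using D(1) B by simp
  obtain U0 V \<theta> \<theta>' where
    IFT: "open U0" "U0 \<subseteq> U" "u0 \<in> U0" "open V" "\<Phi> u0 \<in> V" "homeomorphism U0 V \<Phi> \<theta>"
      "\<And>y. y \<in> V \<Longrightarrow> (\<theta> has_derivative \<theta>' y) (at y)"
      "\<And>y. y \<in> V \<Longrightarrow> \<theta>' y = inv (blinfun_apply (B (\<theta> y)))"
      "\<And>y. y \<in> V \<Longrightarrow> bij (blinfun_apply (B (\<theta> y)))"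
    by (rule inverse_function_theorem[OF U(1) derB contB U(2) inv]) (assumption, (rule that; assumption))
  have \<theta>U0: "\<theta> y \<in> U0" if "y \<in> V" for y using IFT(6) that by (auto simp: homeomorphism_def)
  have bij: "bij (D s)" if "s \<in> U0" for s
  proof -
    have "\<Phi> s \<in> V" "\<theta> (\<Phi> s) = s" using IFT(6) that by (auto simp: homeomorphism_def)
    then show ?thesis using IFT(9)[of "\<Phi> s"] B[of s] that IFT(2) by auto
  qed
  define M where "M = (\<lambda>s. matrix (D s))"
  have Mv: "M s *v x = D s x" if "s \<in> U0" for s x
    unfolding M_def using bl[of s] that IFT(2) by (intro matrix_works) (auto simp: linear_conv_bounded_linear linear_matrix_vector_mul_eq)
  have det: "det (M s) \<noteq> 0" if "s \<in> U0" for s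
  proof -
    have "linear (D s)" using bl[of s] that IFT(2) by (auto simp: linear_conv_bounded_linear)
    then have "inj (D s) \<longleftrightarrow> det (matrix (D s)) \<noteq> 0" using det_nz_iff_inj by blast
    then show ?thesis using bij[OF that] by (simp add: M_def bij_def)
  qed
  have entries: "C1 U (\<lambda>s. M s $ i $ j)" for i j
    unfolding M_def matrix_def using C1_linear[OF bounded_linear_vec_nth D(2)] by simp
  \<comment> \<open>Cramer's formula for the inverse of \<open>D s\<close>, applied to
    \<open>v\<close>.\<close>
  define K where "K = (\<lambda>s v. \<chi> k. det (\<chi> i j. if j = k then v $ i else M s $ i $ j) / det (M s))"
  have K: "K s v = inv (D s) v" if "s \<in> U0" for s v
  proof -
    have "M s *v (inv (D s) v) = v" using Mv[OF that] bij[OF that] by (simp add: bij_is_surj surj_f_inv_f)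
    then have "inv (D s) v = (\<chi> k. det (\<chi> i j. if j = k then v $ i else M s $ i $ j) / det (M s))"
      by (simp only: cramer[OF det[OF that]])
    then show ?thesis by (simp only: K_def)
  qed
  have KC1: "C1 U0 (\<lambda>s. K s v)" for v
    unfolding K_def
  proof (rule C1_vec, rule C1_divide)
    fix k
    show "C1 U0 (\<lambda>s. det (\<chi> i j. if j = k then v $ i else M s $ i $ j))"
    proof (rule C1_det)
      fix i j
      show "C1 U0 (\<lambda>s. (\<chi> i j. if j = k then v $ i else M s $ i $ j) $ i $ j)"
        using C1_subset[OF entries IFT(2)] C1_const by (cases "j = k") simp_all
    qed
    show "C1 U0 (\<lambda>s. det (M s))" by (rule C1_det[OF C1_subset[OF entries IFT(2)]])
  qed (rule det)
  have \<theta>K: "\<theta>' y v = K (\<theta> y) v" if "y \<in> V" for y v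
    using IFT(8)[OF that] K[OF \<theta>U0[OF that]] B[of "\<theta> y"] \<theta>U0[OF that] IFT(2) by auto
  have cont\<theta>: "continuous_on V \<theta>" using IFT(6) by (auto simp: homeomorphism_def)
  have \<theta>C1: "C1 V \<theta>"
  proof (rule C1I[OF IFT(7)])
    fix v
    have "continuous_on V (\<lambda>y. K (\<theta> y) v)"
      using \<theta>U0 by (intro continuous_on_compose2[OF C1_continuous[OF KC1] cont\<theta>]) auto
    then show "continuous_on V (\<lambda>y. \<theta>' y v)" using \<theta>K by (simp cong: continuous_on_cong)
  qed auto
  show ?thesis
  proof (rule that[OF IFT(1,3,2,4,6)])
    fix F :: "real ^ 'n \<Rightarrow> real" and F'
    assume "C2_map U F F'"
    then have F: "\<And>s. s \<in> U \<Longrightarrow> (F has_derivative F' s) (at s)" "\<And>v. C1 U (\<lambda>s. F' s v)"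
      by (auto simp: C2_map_def)
    \<comment> \<open>The gradient of \<open>F (\<theta> y)\<close> written at
      \<open>s = \<theta> y\<close>: its pairing with \<open>v\<close> is \<open>F' s\<close>
      applied to the inverse of \<open>D s\<close> at \<open>v\<close>.\<close>
    define \<gamma> where "\<gamma> = (\<lambda>s. \<chi> i. \<Sum>j\<in>UNIV. K s (axis i 1) $ j * F' s (axis j 1))"
    have \<gamma>C1: "C1 U0 \<gamma>"
      unfolding \<gamma>_def
      by (intro C1_vec C1_sum C1_mult C1_subset[OF F(2) IFT(2)] C1_linear[OF bounded_linear_vec_nth KC1]) auto
    have \<gamma>: "\<gamma> s \<bullet> v = F' s (inv (D s) v)" if s: "s \<in> U0" for s v
    proof -
      have sU: "s \<in> U" using s IFT(2) by blast
      have lin: "linear (F' s)" using F(1)[OF sU] by (rule has_derivative_linear)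
      have "linear (D s)" using bl[OF sU] by (simp add: linear_conv_bounded_linear)
      then have linI: "linear (inv (D s))" using bij[OF s] by (simp add: bij_is_inj inj_linear_imp_inv_linear)
      have ex: "F' s w = (\<Sum>j\<in>UNIV. w $ j * F' s (axis j 1))" for w
      proof -
        have "F' s w = F' s (\<Sum>j\<in>UNIV. w $ j *\<^sub>R axis j 1)"
          using basis_expansion[of w] by (simp add: scalar_mult_eq_scaleR)
        then show ?thesis by (simp add: linear_sum[OF lin] linear_scale[OF lin])
      qed
      have "F' s (inv (D s) v) = F' s (inv (D s) (\<Sum>i\<in>UNIV. v $ i *\<^sub>R axis i 1))"
        using basis_expansion[of v] by (simp add: scalar_mult_eq_scaleR)
      also have "\<dots> = (\<Sum>i\<in>UNIV. v $ i * F' s (inv (D s) (axis i 1)))"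
        by (simp add: linear_sum[OF lin] linear_scale[OF lin] linear_sum[OF linI] linear_scale[OF linI])
      also have "\<dots> = \<gamma> s \<bullet> v"
        unfolding \<gamma>_def inner_vec_def K[OF s] ex[symmetric] by (simp add: mult.commute)
      finally show ?thesis by (rule sym)
    qed
    have "C1 V (\<lambda>y. \<gamma> (\<theta> y))" using \<theta>U0 by (intro C1_compose[OF \<gamma>C1 \<theta>C1])
    then obtain H where H: "\<And>y. y \<in> V \<Longrightarrow> ((\<lambda>y. \<gamma> (\<theta> y)) has_derivative H y) (at y)"
      "\<And>v. continuous_on V (\<lambda>y. H y v)" unfolding C1_def by blast
    have "((\<lambda>y. F (\<theta> y)) has_derivative (\<lambda>v. \<gamma> (\<theta> y) \<bullet> v)) (at y)" if y: "y \<in> V" for y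
    proof -
      have "\<theta> y \<in> U" using \<theta>U0[OF y] IFT(2) by blast
      from has_derivative_compose[OF IFT(7)[OF y] F(1)[OF this]]
      have "((\<lambda>y. F (\<theta> y)) has_derivative (\<lambda>v. F' (\<theta> y) (\<theta>' y v))) (at y)" .
      moreover have "(\<lambda>v. F' (\<theta> y) (\<theta>' y v)) = (\<lambda>v. \<gamma> (\<theta> y) \<bullet> v)"
        using \<theta>K[OF y] K[OF \<theta>U0[OF y]] \<gamma>[OF \<theta>U0[OF y]] by (simp add: fun_eq_iff)
      ultimately show ?thesis by simp
    qed
    then show "\<exists>g H. C2_graph V (\<lambda>y. F (\<theta> y)) g H"
      unfolding C2_graph_def using H IFT(4)
      by (intro exI[of _ "\<lambda>y. \<gamma> (\<theta> y)"] exI[of _ H]) simp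
  qed
qed


subsection \<open>Hypersurfaces as graphs over a tangent hyperplane\<close>

lemma halfspace_0 [simp]: "halfspace 0 = UNIV"
  by (simp add: halfspace_def)

text \<open>From a point of the closed half-space one can move a little in every direction with
  \<open>0 \<le> a \<bullet> \<xi>\<close> without leaving it, so a minimum there has nonnegative
  derivative in these directions, even at the boundary.\<close>

lemma deriv_nonneg:
  fixes f :: "'a::euclidean_space \<Rightarrow> real"
  assumes f: "(f has_derivative f') (at s)" and V: "open V" "s \<in> V" "0 \<le> a \<bullet> s"
    and min: "\<And>x. x \<in> V \<Longrightarrow> 0 \<le> a \<bullet> x \<Longrightarrow> f s \<le> f x" and \<xi>: "0 \<le> a \<bullet> \<xi>"
  shows "0 \<le> f' \<xi>"
proof (rule ccontr)
  assume "\<not> 0 \<le> f' \<xi>"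
  then have neg: "f' \<xi> < 0" by simp
  have lin: "linear f'" using f by (rule has_derivative_linear)
  obtain r where r: "0 < r" "ball s r \<subseteq> V" using V openE by blast
  have \<xi>0: "\<xi> \<noteq> 0" using neg linear_0[OF lin] by auto
  have "((\<lambda>t. s + t *\<^sub>R \<xi>) has_derivative (\<lambda>t. t *\<^sub>R \<xi>)) (at 0)" by (auto intro!: derivative_eq_intros)
  from has_derivative_compose[OF this, of f f'] f
  have "((\<lambda>t. f (s + t *\<^sub>R \<xi>)) has_derivative (\<lambda>t. f' (t *\<^sub>R \<xi>))) (at 0)" by simp
  then have "((\<lambda>t. f (s + t *\<^sub>R \<xi>)) has_real_derivative f' \<xi>) (at 0)"
    by (rule has_derivative_imp_has_field_derivative) (simp add: linear_scale[OF lin])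
  from DERIV_neg_dec_right[OF this neg] obtain d where
    d: "0 < d" "\<And>h. 0 < h \<Longrightarrow> h < d \<Longrightarrow> f (s + h *\<^sub>R \<xi>) < f s" by auto
  define h where "h = min (d / 2) (r / (2 * norm \<xi>))"
  have h: "0 < h" "h < d" using d r \<xi>0 by (auto simp: h_def min_less_iff_disj)
  have "h * norm \<xi> \<le> r / (2 * norm \<xi>) * norm \<xi>" by (intro mult_right_mono) (auto simp: h_def)
  also have "\<dots> < r" using \<xi>0 r by simp
  finally have "s + h *\<^sub>R \<xi> \<in> V" using r(2) h by (auto simp: dist_norm)
  moreover have "0 \<le> a \<bullet> (s + h *\<^sub>R \<xi>)" using V(3) \<xi> h by (simp add: inner_add_right)
  ultimately show False using min d(2)[OF h] by force
qed

text \<open>One of \<open>\<xi>\<close> and \<open>- \<xi>\<close> points into the half-space. Hence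
  identities that hold only on the hypersurface side of a boundary chart may still be differentiated
  in all directions.\<close>

lemma deriv_vanish:
  fixes f :: "'a::euclidean_space \<Rightarrow> real"
  assumes f: "(f has_derivative f') (at s)" and V: "open V" "s \<in> V" "0 \<le> a \<bullet> s"
    and zero: "\<And>x. x \<in> V \<Longrightarrow> 0 \<le> a \<bullet> x \<Longrightarrow> f x = 0"
  shows "f' \<xi> = 0"
proof -
  have lin: "linear f'" using f by (rule has_derivative_linear)
  have *: "f' \<xi> = 0" if "0 \<le> a \<bullet> \<xi>" for \<xi>
    using deriv_nonneg[OF f V _ that] deriv_nonneg[OF has_derivative_minus[OF f] V _ that] zero V by force
  show ?thesis
  proof (cases "0 \<le> a \<bullet> \<xi>")
    case False
    then have "f' (- \<xi>) = 0" by (intro *) simp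
    then show ?thesis by (simp add: linear_neg[OF lin])
  qed (rule *)
qed

section \<open>Charts of an embedded hypersurface and its tangent spaces\<close>

lemma chart_derivatives:
  assumes "parametrization M \<phi> U a"
  shows "s \<in> U \<Longrightarrow> (\<phi> has_derivative frechet_derivative \<phi> (at s)) (at s)"
    and "s \<in> U \<Longrightarrow> (push \<phi> v has_derivative frechet_derivative (push \<phi> v) (at s)) (at s)"
    and "C2_map U \<phi> (\<lambda>s. frechet_derivative \<phi> (at s))"
proof -
  have U: "open U" and "Ck_on 2 U \<phi>" using assms unfolding parametrization_def smooth_on_def by auto
  then have C: "\<phi> differentiable_on U" "\<And>v. push \<phi> v differentiable_on U"
      "\<And>v w. continuous_on U (\<lambda>s. frechet_derivative (push \<phi> v) (at s) w)"
    by (auto simp: numeral_2_eq_2 push_def[abs_def])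
  have at: "f differentiable at s" if "f differentiable_on U" "s \<in> U" for f :: "real ^ 'a \<Rightarrow> (real ^ 'a) \<times> real" and s
    using that U by (metis at_within_open differentiable_on_def)
  show 1: "(\<phi> has_derivative frechet_derivative \<phi> (at s)) (at s)" if "s \<in> U" for s
    using at[OF C(1) that] frechet_derivative_works by blast
  show 2: "(push \<phi> v has_derivative frechet_derivative (push \<phi> v) (at s)) (at s)" if "s \<in> U" for s v
    using at[OF C(2) that] frechet_derivative_works by blast
  have "C1 U (push \<phi> v)" for v by (rule C1I[OF 2 C(3)])
  then show "C2_map U \<phi> (\<lambda>s. frechet_derivative \<phi> (at s))"
    using 1 by (simp add: C2_map_def push_def[abs_def])
qed

lemma chart_linear: "parametrization M \<phi> U a \<Longrightarrow> s \<in> U \<Longrightarrow> linear (frechet_derivative \<phi> (at s))"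
  using chart_derivatives(1) has_derivative_linear by blast

lemma chart_inj: "parametrization M \<phi> U a \<Longrightarrow> s \<in> U \<Longrightarrow> inj (frechet_derivative \<phi> (at s))"
  by (simp add: parametrization_def)

lemma chart_in: "parametrization M \<phi> U a \<Longrightarrow> s \<in> U \<Longrightarrow> 0 \<le> a \<bullet> s \<Longrightarrow> \<phi> s \<in> M"
  unfolding parametrization_def halfspace_def by (auto dest!: openin_imp_subset)

lemma chart_continuous: "parametrization M \<phi> U a \<Longrightarrow> continuous_on U \<phi>"
  using chart_derivatives(3) unfolding C2_map_def
  by (metis continuous_at_imp_continuous_on has_derivative_continuous)

lemma chart_open: "parametrization M \<phi> U a \<Longrightarrow> open U"
  by (simp add: parametrization_def)

lemma chart_openin:
  assumes par: "parametrization M \<phi> U a" and V: "open V" "V \<subseteq> U"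
  obtains N where "open N" "M \<inter> N = \<phi> ` (V \<inter> halfspace a)"
proof -
  obtain \<psi> where h: "homeomorphism (U \<inter> halfspace a) (\<phi> ` (U \<inter> halfspace a)) \<phi> \<psi>"
    and o: "openin (top_of_set M) (\<phi> ` (U \<inter> halfspace a))"
    using par unfolding parametrization_def by blast
  have "openin (top_of_set (U \<inter> halfspace a)) (V \<inter> halfspace a)"
    unfolding openin_open using V by (intro exI[of _ V]) auto
  from homeomorphism_imp_open_map[OF h this] o
  have "openin (top_of_set M) (\<phi> ` (V \<inter> halfspace a))" using openin_trans by blast
  then show ?thesis using that unfolding openin_open by metis
qed

lemma chart_restrict:
  assumes par: "parametrization M \<phi> U a" and V: "open V" "V \<subseteq> U"
    "\<And>s. s \<in> V \<Longrightarrow> 0 \<le> a \<bullet> s"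
  shows "parametrization M \<phi> V 0"
proof -
  obtain \<psi> where h: "homeomorphism (U \<inter> halfspace a) (\<phi> ` (U \<inter> halfspace a)) \<phi> \<psi>"
    using par unfolding parametrization_def by blast
  have eq: "V \<inter> halfspace a = V" using V(3) by (auto simp: halfspace_def)
  have sub: "V \<subseteq> U \<inter> halfspace a" using V by (auto simp: halfspace_def)
  obtain N where N: "open N" "M \<inter> N = \<phi> ` V" using chart_openin[OF par V(1,2)] eq by metis
  have "homeomorphism V (\<phi> ` V) \<phi> \<psi>"
    using N by (intro homeomorphism_of_subsets[OF h sub]) (use sub in auto)
  moreover have "Ck_on m V f" if "Ck_on m U f" for m and f :: "real ^ 'a \<Rightarrow> (real ^ 'a) \<times> real"
    using that
  proof (induction m arbitrary: f)
    case 0 then show ?case using V(2) continuous_on_subset by auto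
  next
    case (Suc m) then show ?case using V(2) differentiable_on_subset by auto
  qed
  ultimately show ?thesis
    using par V N unfolding parametrization_def smooth_on_def openin_open
    by (auto intro!: exI[of _ N])
qed

lemma interior_point_of_chart:
  assumes par: "parametrization M \<phi> U a" and s: "s \<in> U" and a: "a = 0 \<or> 0 < a \<bullet> s"
  shows "\<phi> s \<in> interior_points M"
proof -
  let ?V = "if a = 0 then U else U \<inter> {s. 0 < a \<bullet> s}"
  have "open ?V" using chart_open[OF par] by (auto intro!: open_Int open_halfspace_gt)
  then have "parametrization M \<phi> ?V 0" by (rule chart_restrict[OF par]) (auto split: if_splits)
  moreover have "s \<in> ?V" using s a by auto
  ultimately show ?thesis unfolding interior_points_def by blast
qed

lemma interior_points_subset: "interior_points M \<subseteq> M"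
proof
  fix p assume "p \<in> interior_points M"
  then obtain \<phi> U s where "parametrization M \<phi> U 0" "s \<in> U" "p = \<phi> s" unfolding interior_points_def by blast
  then show "p \<in> M" using chart_in[of M \<phi> U 0 s] by simp
qed

lemma embedded_chart:
  assumes "embedded_hypersurface M" "p \<in> M"
  obtains \<phi> U a s where "parametrization M \<phi> U a" "s \<in> U" "0 \<le> a \<bullet> s" "\<phi> s = p"
proof -
  obtain \<phi> U a where "parametrization M \<phi> U a" "p \<in> \<phi> ` (U \<inter> halfspace a)"
    using assms unfolding embedded_hypersurface_def by blast
  then show ?thesis using that by (auto simp: halfspace_def)
qed

lemma tangent_spaceI: "parametrization M \<phi> U a \<Longrightarrow> s \<in> U \<Longrightarrow> 0 \<le> a \<bullet> s \<Longrightarrow>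
    frechet_derivative \<phi> (at s) v \<in> tangent_space M (\<phi> s)"
  unfolding tangent_space_def halfspace_def by blast

lemma normal_orthogonal: "unit_normal M \<nu> \<Longrightarrow> parametrization M \<phi> U a \<Longrightarrow> s \<in> U \<Longrightarrow> 0 \<le> a \<bullet> s \<Longrightarrow>
    frechet_derivative \<phi> (at s) v \<bullet> \<nu> (\<phi> s) = 0"
  using tangent_spaceI chart_in unfolding unit_normal_def by blast

text \<open>\<open>tangent_space\<close> collects vectors from all charts; a dimension count shows
  that any single chart already fills the hyperplane orthogonal to the normal.\<close>

lemma tangent_space_eq:
  fixes M :: "'n::finite ambient set"
  assumes nu: "unit_normal M \<nu>" and par: "parametrization M \<phi> U a" "s \<in> U" "0 \<le> a \<bullet> s"
  shows "range (frechet_derivative \<phi> (at s)) = {v. v \<bullet> \<nu> (\<phi> s) = 0}" (is "?R = ?T")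
    and "tangent_space M (\<phi> s) = {v. v \<bullet> \<nu> (\<phi> s) = 0}"
proof -
  have pM: "\<phi> s \<in> M" using par by (rule chart_in)
  have n0: "\<nu> (\<phi> s) \<noteq> 0" using nu pM unfolding unit_normal_def by force
  have T: "?T = {v. \<nu> (\<phi> s) \<bullet> v = 0}" by (simp add: inner_commute)
  have lin: "linear (frechet_derivative \<phi> (at s))" using chart_linear par by blast
  have "dim ?T = DIM('n ambient) - 1" unfolding T by (rule dim_hyperplane[OF n0])
  moreover have "dim ?R = dim (UNIV :: (real ^ 'n) set)"
    using chart_inj[OF par(1,2)] by (intro dim_image_eq[OF lin]) (simp add: inj_on_subset)
  ultimately have "dim ?T \<le> dim ?R" by simp
  moreover have "?R \<subseteq> ?T" using normal_orthogonal[OF nu par] by auto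
  moreover have "subspace ?R" by (rule linear_subspace_image[OF lin subspace_UNIV])
  moreover have "subspace ?T" unfolding T by (rule subspace_hyperplane)
  ultimately show R: "?R = ?T" by (intro subspace_dim_equal)
  show "tangent_space M (\<phi> s) = ?T"
  proof
    show "tangent_space M (\<phi> s) \<subseteq> ?T" using nu pM unfolding unit_normal_def by blast
    show "?T \<subseteq> tangent_space M (\<phi> s)" unfolding R[symmetric] using tangent_spaceI[OF par] by blast
  qed
qed

text \<open>Orthogonal coordinates adapted to a unit vector \<open>d\<close>: \<open>A\<close>
  embeds the parameter space isometrically onto the hyperplane orthogonal to \<open>d\<close>, and
  its adjoint \<open>P\<close> is the projection in these coordinates.\<close>

locale frame =
  fixes A :: "real ^ 'n::finite \<Rightarrow> 'n ambient" and P :: "'n ambient \<Rightarrow> real ^ 'n" and d :: "'n ambient"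
  assumes A: "linear A" and P: "linear P" and AA: "A x \<bullet> A y = x \<bullet> y" and AP: "A x \<bullet> z = x \<bullet> P z"
    and Ad: "A x \<bullet> d = 0" and dd: "d \<bullet> d = 1" and decomp: "z = A (P z) + (z \<bullet> d) *\<^sub>R d"

lemma frame_exists:
  fixes d :: "'n::finite ambient"
  assumes "norm d = 1"
  obtains A P where "frame A P d"
proof -
  have d0: "d \<noteq> 0" and dd: "d \<bullet> d = 1" using assms by (auto simp: dot_square_norm)
  have "dim (UNIV :: (real ^ 'n) set) = dim {x. d \<bullet> x = 0}"
    using dim_hyperplane[OF d0] by simp
  note iso = isometries_subspaces[OF subspace_UNIV subspace_hyperplane this]
  obtain f :: "real ^ 'n \<Rightarrow> 'n ambient" where
    f: "linear f" "f ` (UNIV :: (real ^ 'n) set) = {x. d \<bullet> x = 0}" "\<And>x. norm (f x) = norm x"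
  proof (rule iso)
    fix f :: "real ^ 'n \<Rightarrow> 'n ambient"
    assume "linear f" "range f = {x. d \<bullet> x = 0}" "\<And>x. x \<in> UNIV \<Longrightarrow> norm (f x) = norm x"
    then show thesis using that[of f] by simp
  qed
  have fd: "f x \<bullet> d = 0" for x using f(2) by (auto simp: inner_commute)
  have ff: "f x \<bullet> f y = x \<bullet> y" for x y
    using f(3) by (simp add: dot_norm linear_add[OF f(1), symmetric])
  have ad: "f x \<bullet> z = x \<bullet> adjoint f z" for x z using adjoint_works[OF f(1)] by (simp add: inner_commute)
  have dec: "z = f (adjoint f z) + (z \<bullet> d) *\<^sub>R d" for z
  proof -
    have "d \<bullet> (z - (z \<bullet> d) *\<^sub>R d) = 0" by (simp add: inner_diff_right dd inner_commute)
    then obtain x where x: "z - (z \<bullet> d) *\<^sub>R d = f x" using f(2) by blast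
    have "w \<bullet> adjoint f z = w \<bullet> x" for w
    proof -
      have "w \<bullet> adjoint f z = f w \<bullet> (z - (z \<bullet> d) *\<^sub>R d)" by (simp add: ad[symmetric] inner_diff_right fd)
      then show ?thesis by (simp add: x ff)
    qed
    then have "adjoint f z = x" by (metis vector_eq_ldot)
    then show ?thesis using x by (simp add: algebra_simps)
  qed
  have "frame f (adjoint f) d"
    by (intro frame.intro f(1) adjoint_linear[OF f(1)] ff ad fd dd dec)
  then show ?thesis using that by blast
qed

context frame
begin

text \<open>The normal of a graph with gradient \<open>g\<close>, scaled to have component 1 along
  \<open>d\<close>. With this scaling the Hessian of the graph is the second fundamental
  form.\<close>

definition nrm :: "real ^ 'n \<Rightarrow> 'n ambient" where "nrm g = d - A g"

definition point :: "(real ^ 'n \<Rightarrow> real) \<Rightarrow> real ^ 'n \<Rightarrow> 'n ambient" where "point u y = A y + u y *\<^sub>R d"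

text \<open>The right-hand side of the translator equation for a graph, after division by the
  \<open>d\<close>-component of the unit normal: an affine function of the gradient.\<close>

definition slope :: "real ^ 'n \<Rightarrow> real" where "slope g = nrm g \<bullet> e_last"

lemma bA: "bounded_linear A" and bP: "bounded_linear P"
  using A P by (simp_all add: linear_conv_bounded_linear)

lemma PA: "P (A x) = x"
  by (metis AA AP vector_eq_ldot)

lemma Pd: "P d = 0"
  by (metis AP Ad inner_eq_zero_iff)

lemma P_point: "P (point u y) = y"
  by (simp add: point_def linear_add[OF P] linear_scale[OF P] PA Pd)

lemma point_unique: "P x = y \<Longrightarrow> x \<bullet> d = u y \<Longrightarrow> x = point u y"
  unfolding point_def using decomp[of x] by simp

lemma inner_decomp: "x \<bullet> z = P x \<bullet> P z + (x \<bullet> d) * (z \<bullet> d)"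
proof -
  have "x \<bullet> z = (A (P x) + (x \<bullet> d) *\<^sub>R d) \<bullet> z" using decomp[of x] by simp
  also have "\<dots> = P x \<bullet> P z + (x \<bullet> d) * (z \<bullet> d)"
    by (simp only: inner_add_left AP inner_scaleR_left inner_commute[of d z])
  finally show ?thesis .
qed

lemma P_nrm: "P (nrm g) = - g" and nrm_d: "nrm g \<bullet> d = 1"
  by (simp_all add: nrm_def linear_diff[OF P] Pd PA inner_diff_left dd Ad)

lemma slope_lipschitz: "\<bar>slope g - slope h\<bar> \<le> norm (e_last :: 'n ambient) * norm (g - h)"
proof -
  have "slope g - slope h = A (h - g) \<bullet> e_last"
    by (simp add: slope_def nrm_def linear_diff[OF A] inner_diff_left)
  moreover have "norm (A (h - g)) = norm (h - g)" by (simp add: norm_eq_sqrt_inner AA)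
  ultimately show ?thesis
    using Cauchy_Schwarz_ineq2[of "A (h - g)" e_last] norm_minus_commute[of g h] by (simp add: mult.commute)
qed

text \<open>
  Only containment in the graph is required: near a boundary point \<open>M\<close> covers just a part of it,
  and a hypersurface that is contained in another one inherits its graph.
\<close>

definition graph_over :: "'n ambient set \<Rightarrow> 'n ambient set \<Rightarrow> (real ^ 'n) set \<Rightarrow> (real ^ 'n \<Rightarrow> real) \<Rightarrow>
    (real ^ 'n \<Rightarrow> real ^ 'n) \<Rightarrow> (real ^ 'n \<Rightarrow> real ^ 'n \<Rightarrow> real ^ 'n) \<Rightarrow> bool" where
  "graph_over M N V u g H \<longleftrightarrow> open N \<and> C2_graph V u g H \<and> (\<forall>x\<in>M \<inter> N. P x \<in> V \<and> x \<bullet> d = u (P x))"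

text \<open>The graph identity is differentiated once and twice along the chart. It holds only on
  the chart's half-space; \<open>deriv_vanish\<close> makes the derivatives valid up to the
  boundary.\<close>

lemma graph_over_derivatives:
  assumes gr: "graph_over M N V u g H" and par: "parametrization M \<phi> U a" "s0 \<in> U" "0 \<le> a \<bullet> s0" "\<phi> s0 \<in> N"
  defines "y \<equiv> P (\<phi> s0)" and "D \<equiv> frechet_derivative \<phi> (at s0)"
  shows "D \<xi> \<bullet> d = g y \<bullet> P (D \<xi>)"
    and "frechet_derivative (push \<phi> \<eta>) (at s0) \<xi> \<bullet> nrm (g y) = H y (P (D \<xi>)) \<bullet> P (D \<eta>)"
proof -
  have N: "open N" and V: "open V"
    and du: "\<And>y. y \<in> V \<Longrightarrow> (u has_derivative (\<lambda>\<xi>. g y \<bullet> \<xi>)) (at y)"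
    and dg: "\<And>y. y \<in> V \<Longrightarrow> (g has_derivative H y) (at y)"
    and inV: "\<And>x. x \<in> M \<Longrightarrow> x \<in> N \<Longrightarrow> P x \<in> V \<and> x \<bullet> d = u (P x)"
    using gr unfolding graph_over_def C2_graph_def by auto
  define U' where "U' = U \<inter> \<phi> -` N"
  have U': "open U'" "s0 \<in> U'"
    unfolding U'_def using par chart_continuous[OF par(1)] chart_open[OF par(1)] N
    by (auto intro: continuous_open_preimage)
  have M: "\<phi> s \<in> M" "\<phi> s \<in> N" "s \<in> U" if "s \<in> U'" "0 \<le> a \<bullet> s" for s
    using that chart_in[OF par(1)] by (auto simp: U'_def)
  have dPphi: "((\<lambda>s. P (\<phi> s)) has_derivative (\<lambda>\<xi>. P (frechet_derivative \<phi> (at s) \<xi>))) (at s)" if "s \<in> U" for s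
    using bounded_linear.has_derivative[OF bP chart_derivatives(1)[OF par(1) that]] .
  have first: "frechet_derivative \<phi> (at s) \<xi> \<bullet> d - g (P (\<phi> s)) \<bullet> P (frechet_derivative \<phi> (at s) \<xi>) = 0"
    if s: "s \<in> U'" "0 \<le> a \<bullet> s" for s \<xi>
  proof (rule deriv_vanish[where f="\<lambda>s. \<phi> s \<bullet> d - u (P (\<phi> s))" and V=U' and a=a and s=s and \<xi>=\<xi> and
        f'="\<lambda>\<xi>. frechet_derivative \<phi> (at s) \<xi> \<bullet> d - g (P (\<phi> s)) \<bullet> P (frechet_derivative \<phi> (at s) \<xi>)"])
    have "P (\<phi> s) \<in> V" using inV M[OF s] by blast
    from has_derivative_compose[OF dPphi[OF M(3)[OF s]] du[OF this]]
    show "((\<lambda>s. \<phi> s \<bullet> d - u (P (\<phi> s))) has_derivative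
        (\<lambda>\<xi>. frechet_derivative \<phi> (at s) \<xi> \<bullet> d - g (P (\<phi> s)) \<bullet> P (frechet_derivative \<phi> (at s) \<xi>))) (at s)"
      by (intro has_derivative_diff has_derivative_inner_left chart_derivatives(1)[OF par(1) M(3)[OF s]])
    show "\<phi> x \<bullet> d - u (P (\<phi> x)) = 0" if "x \<in> U'" "0 \<le> a \<bullet> x" for x using inV M[OF that] by simp
  qed (use U' s in auto)
  show "D \<xi> \<bullet> d = g y \<bullet> P (D \<xi>)" using first[OF U'(2) par(3)] by (simp add: D_def y_def)
  let ?D2 = "frechet_derivative (push \<phi> \<eta>) (at s0)"
  have yV: "y \<in> V" unfolding y_def using inV M[OF U'(2) par(3)] by blast
  have "?D2 \<xi> \<bullet> d - (g y \<bullet> P (?D2 \<xi>) + H y (P (D \<xi>)) \<bullet> P (push \<phi> \<eta> s0)) = 0"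
  proof (rule deriv_vanish[where f="\<lambda>s. push \<phi> \<eta> s \<bullet> d - g (P (\<phi> s)) \<bullet> P (push \<phi> \<eta> s)" and V=U' and a=a and s=s0 and \<xi>=\<xi> and
        f'="\<lambda>\<xi>. ?D2 \<xi> \<bullet> d - (g y \<bullet> P (?D2 \<xi>) + H y (P (D \<xi>)) \<bullet> P (push \<phi> \<eta> s0))"])
    note p = chart_derivatives(2)[OF par(1) par(2), of \<eta>]
    have "((\<lambda>s. g (P (\<phi> s))) has_derivative (\<lambda>\<xi>. H y (P (D \<xi>)))) (at s0)"
      using has_derivative_compose[OF dPphi[OF par(2)] dg] yV unfolding y_def D_def by blast
    then show "((\<lambda>s. push \<phi> \<eta> s \<bullet> d - g (P (\<phi> s)) \<bullet> P (push \<phi> \<eta> s)) has_derivative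
        (\<lambda>\<xi>. ?D2 \<xi> \<bullet> d - (g y \<bullet> P (?D2 \<xi>) + H y (P (D \<xi>)) \<bullet> P (push \<phi> \<eta> s0)))) (at s0)"
      unfolding y_def
      by (intro has_derivative_diff has_derivative_inner_left has_derivative_inner p bounded_linear.has_derivative[OF bP p])
    show "push \<phi> \<eta> x \<bullet> d - g (P (\<phi> x)) \<bullet> P (push \<phi> \<eta> x) = 0" if "x \<in> U'" "0 \<le> a \<bullet> x" for x
      using first[OF that] by (simp add: push_def)
  qed (use U' par in auto)
  then show "?D2 \<xi> \<bullet> nrm (g y) = H y (P (D \<xi>)) \<bullet> P (D \<eta>)"
    unfolding inner_decomp[of "?D2 \<xi>" "nrm (g y)"] P_nrm nrm_d
    by (simp add: push_def D_def inner_commute[of "P (?D2 \<xi>)"])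
qed

text \<open>A tangent vector killed by \<open>P\<close> has no \<open>d\<close>-component either,
  because of the graph identity, so \<open>P\<close> is injective on the tangent space.\<close>

lemma graph_over_projection_surj:
  assumes gr: "graph_over M N V u g H" and par: "parametrization M \<phi> U a" "s0 \<in> U" "0 \<le> a \<bullet> s0" "\<phi> s0 \<in> N"
  shows "surj (\<lambda>\<xi>. P (frechet_derivative \<phi> (at s0) \<xi>))"
proof -
  let ?D = "frechet_derivative \<phi> (at s0)"
  have lin: "linear ?D" using chart_linear par by blast
  then have lin': "linear (\<lambda>\<xi>. P (?D \<xi>))" using linear_compose[OF lin P] by (simp add: o_def)
  have "\<xi> = 0" if "P (?D \<xi>) = 0" for \<xi>
  proof -
    have "?D \<xi> \<bullet> d = 0" using graph_over_derivatives(1)[OF gr par, of \<xi>] that by simp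
    then have "?D \<xi> = 0" using decomp[of "?D \<xi>"] that linear_0[OF A] by simp
    then show ?thesis using chart_inj[OF par(1,2)] linear_0[OF lin] by (metis injD)
  qed
  then have "inj (\<lambda>\<xi>. P (?D \<xi>))" using linear_injective_0[OF lin'] by blast
  then show ?thesis using linear_injective_imp_surjective[OF lin'] by blast
qed

lemma graph_over_normal:
  assumes gr: "graph_over M N V u g H" and M: "embedded_hypersurface M" "unit_normal M \<nu>" and r: "r \<in> M" "r \<in> N"
  shows "\<nu> r = (\<nu> r \<bullet> d) *\<^sub>R nrm (g (P r))"
proof -
  obtain \<phi> U a s where par: "parametrization M \<phi> U a" "s \<in> U" "0 \<le> a \<bullet> s" "\<phi> s = r"
    using embedded_chart[OF M(1) r(1)] .
  let ?D = "frechet_derivative \<phi> (at s)" and ?t = "\<nu> r \<bullet> d"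
  have rN: "\<phi> s \<in> N" using r par by simp
  have "P (\<nu> r) \<bullet> \<zeta> = (- ?t *\<^sub>R g (P r)) \<bullet> \<zeta>" for \<zeta>
  proof -
    obtain \<xi> where \<xi>: "\<zeta> = P (?D \<xi>)" using graph_over_projection_surj[OF gr par(1-3) rN] by (metis surjD)
    have "0 = \<nu> r \<bullet> ?D \<xi>" using normal_orthogonal[OF M(2) par(1-3), of \<xi>] par(4) by (simp add: inner_commute)
    then show ?thesis
      using graph_over_derivatives(1)[OF gr par(1-3) rN, of \<xi>]
      unfolding inner_decomp[of "\<nu> r" "?D \<xi>"] \<xi> par(4) by simp
  qed
  then have "P (\<nu> r) = - ?t *\<^sub>R g (P r)" by (metis vector_eq_rdot)
  then have "\<nu> r = A (- ?t *\<^sub>R g (P r)) + ?t *\<^sub>R d" using decomp[of "\<nu> r"] by simp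
  then show ?thesis by (simp add: nrm_def linear_scale[OF A] linear_neg[OF A] algebra_simps)
qed

text \<open>The projected principal frame diagonalizes the Hessian. The factor
  \<open>1 / (\<nu> r \<bullet> d)\<close> converts the unit normal into \<open>nrm\<close>.\<close>

lemma graph_over_eigs:
  assumes gr: "graph_over M N V u g H" and M: "embedded_hypersurface M" "unit_normal M \<nu>" and r: "r \<in> N"
    and pos: "0 < \<nu> r \<bullet> d" and pc: "principal_curvatures M \<nu> r lam"
  shows "eigs (graph_metric (g (P r))) (\<lambda>\<xi> \<eta>. H (P r) \<xi> \<bullet> \<eta>) ((1 / (\<nu> r \<bullet> d)) *\<^sub>R lam)"
proof -
  obtain \<phi> U a s b where par: "parametrization M \<phi> U a" "s \<in> U \<inter> halfspace a" "\<phi> s = r"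
    and b: "\<And>i j. push \<phi> (b i) s \<bullet> push \<phi> (b j) s = (if i = j then 1 else 0)"
    and c: "\<And>i j. second_fundamental_form \<phi> \<nu> s (b i) (b j) = (if i = j then lam $ i else 0)"
    using pc unfolding principal_curvatures_def by blast
  have s: "s \<in> U" "0 \<le> a \<bullet> s" "\<phi> s \<in> N" using par r by (auto simp: halfspace_def)
  have rM: "r \<in> M" using chart_in[OF par(1) s(1,2)] par(3) by simp
  let ?D = "frechet_derivative \<phi> (at s)" and ?g = "g (P r)" and ?t = "\<nu> r \<bullet> d"
  note der = graph_over_derivatives[OF gr par(1) s, unfolded par(3)]
  show ?thesis
    unfolding eigs_def
  proof (intro exI[of _ "\<lambda>i. P (?D (b i))"] allI conjI)
    fix i j
    show "graph_metric ?g (P (?D (b i))) (P (?D (b j))) = (if i = j then 1 else 0)"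
      using b[of i j] unfolding push_def inner_decomp[of "?D (b i)" "?D (b j)"] der(1) graph_metric_def .
    have "(if i = j then lam $ i else 0) = ?t * (H (P r) (P (?D (b i))) \<bullet> P (?D (b j)))"
      unfolding c[symmetric] second_fundamental_form_def par(3)
      by (subst graph_over_normal[OF gr M rM r]) (simp add: der(2))
    then show "H (P r) (P (?D (b i))) \<bullet> P (?D (b j)) = (if i = j then ((1 / ?t) *\<^sub>R lam) $ i else 0)"
      using pos by (simp add: field_simps split: if_splits)
  qed
qed

text \<open>If the tangent space at \<open>s\<close> is orthogonal to \<open>d\<close>, then
  \<open>P\<close> composed with the chart is a local diffeomorphism. Besides the height, the
  function \<open>a \<bullet> s\<close> is carried to the graph domain, where it describes the
  boundary.\<close>

lemma local_graph:
  assumes par: "parametrization M \<phi> U a" "s \<in> U" "0 \<le> a \<bullet> s"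
    and orth: "\<And>\<xi>. frechet_derivative \<phi> (at s) \<xi> \<bullet> d = 0"
  obtains U0 V \<theta> g H gf Hf N where
    "open U0" "s \<in> U0" "U0 \<subseteq> U" "homeomorphism U0 V (\<lambda>s. P (\<phi> s)) \<theta>"
    "graph_over M N V (\<lambda>y. \<phi> (\<theta> y) \<bullet> d) g H" "C2_graph V (\<lambda>y. a \<bullet> \<theta> y) gf Hf"
    "M \<inter> N = \<phi> ` (U0 \<inter> halfspace a)" "\<phi> s \<in> N"
proof -
  let ?D = "\<lambda>s. frechet_derivative \<phi> (at s)"
  have lin: "linear (?D s)" using chart_linear par by blast
  have inj: "inj (\<lambda>\<xi>. P (?D s \<xi>))"
  proof -
    have "\<xi> = 0" if "P (?D s \<xi>) = 0" for \<xi>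
    proof -
      have "?D s \<xi> = 0" using decomp[of "?D s \<xi>"] that orth linear_0[OF A] by simp
      then show ?thesis using chart_inj[OF par(1,2)] linear_0[OF lin] by (metis injD)
    qed
    moreover have "linear (\<lambda>\<xi>. P (?D s \<xi>))" using linear_compose[OF lin P] by (simp add: o_def)
    ultimately show ?thesis using linear_injective_0 by blast
  qed
  have C2: "C2_map U (\<lambda>s. P (\<phi> s)) (\<lambda>s \<xi>. P (?D s \<xi>))"
    using C2_map_linear[OF bP chart_derivatives(3)[OF par(1)]] .
  obtain U0 V \<theta> where IFT: "open U0" "s \<in> U0" "U0 \<subseteq> U" "open V" "homeomorphism U0 V (\<lambda>s. P (\<phi> s)) \<theta>"
    "\<And>F F'. C2_map U F F' \<Longrightarrow> \<exists>g H. C2_graph V (\<lambda>y. F (\<theta> y)) g H"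
    using C2_inverse_function[OF chart_open[OF par(1)] par(2) C2 inj] by metis
  have "C2_map U (\<lambda>s. \<phi> s \<bullet> d) (\<lambda>s \<xi>. ?D s \<xi> \<bullet> d)"
    using C2_map_linear[OF bounded_linear_inner_left chart_derivatives(3)[OF par(1)]] .
  from IFT(6)[OF this] obtain g H where g: "C2_graph V (\<lambda>y. \<phi> (\<theta> y) \<bullet> d) g H" by blast
  have "C2_map U (\<lambda>s. a \<bullet> s) (\<lambda>s \<xi>. a \<bullet> \<xi>)"
    by (auto simp: C2_map_def C1_const intro!: derivative_eq_intros)
  from IFT(6)[OF this] obtain gf Hf where gf: "C2_graph V (\<lambda>y. a \<bullet> \<theta> y) gf Hf" by blast
  obtain N where N: "open N" "M \<inter> N = \<phi> ` (U0 \<inter> halfspace a)" using chart_openin[OF par(1) IFT(1,3)] .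
  have "P x \<in> V \<and> x \<bullet> d = \<phi> (\<theta> (P x)) \<bullet> d" if "x \<in> M \<inter> N" for x
    using that IFT(5) unfolding N(2) homeomorphism_def by auto
  then have "graph_over M N V (\<lambda>y. \<phi> (\<theta> y) \<bullet> d) g H" using N(1) g by (simp add: graph_over_def)
  moreover have "\<phi> s \<in> N" using N(2) IFT(2) par(3) by (auto simp: halfspace_def)
  ultimately show ?thesis using that IFT gf N(2) by blast
qed

end


subsection \<open>The local interior principle\<close>

text \<open>A form that is diagonal in an orthonormal basis is visibly symmetric. This stands in for
  the symmetry of second derivatives.\<close>

lemma eigs_imp_symform:
  assumes bil: "bilinear B" and G: "inner_form G" and e: "eigs G B lam"
  shows "symform B"
proof -
  have bb: "bounded_bilinear B" using bil by (simp add: bilinear_conv_bounded_bilinear)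
  obtain b where b: "\<And>i j. G (b i) (b j) = (if i = j then 1 else 0)"
      "\<And>i j. B (b i) (b j) = (if i = j then lam $ i else 0)" using e unfolding eigs_def by blast
  have "B x y = (\<Sum>i\<in>UNIV. lam $ i * (G x (b i) * G y (b i)))" for x y
  proof -
    have "B (\<Sum>i\<in>UNIV. G x (b i) *\<^sub>R b i) (\<Sum>i\<in>UNIV. G y (b i) *\<^sub>R b i) = (\<Sum>i\<in>UNIV. lam $ i * (G x (b i) * G y (b i)))"
      by (simp add: bounded_bilinear.sum_left[OF bb] bounded_bilinear.scaleR_left[OF bb] b(2)
          bounded_bilinear.sum_right[OF bb] bounded_bilinear.scaleR_right[OF bb] if_distrib mult.left_commute mult.commute cong: if_cong)
    then show ?thesis
      using arg_cong2[OF inner_form_expand[OF G b(1), of x] inner_form_expand[OF G b(1), of y], of B] by (rule trans[rotated])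
  qed
  then show ?thesis using bil by (simp add: symform_def mult.commute)
qed

lemma inner_form_of_eigs:
  assumes G: "inner_form G" and H: "symform H" and e: "eigs G H lam" and pos: "\<And>i. 0 < lam $ i"
  shows "inner_form H"
  unfolding inner_form_def
proof (intro conjI H allI impI)
  fix v :: "real ^ 'a" assume "v \<noteq> 0"
  obtain b where b: "\<And>i j. G (b i) (b j) = (if i = j then 1 else 0)"
      "\<And>i j. H (b i) (b j) = (if i = j then lam $ i else 0)" using e unfolding eigs_def by blast
  have "0 < G v v" using G \<open>v \<noteq> 0\<close> by (simp add: inner_form_def)
  then obtain i where i: "(G v (b i))\<^sup>2 \<noteq> 0"
    unfolding norm_expand[OF G b(1), of v] by (metis less_irrefl sum.neutral)
  show "0 < H v v"
    unfolding form_expand[OF G b(1) H b(2), of v]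
  proof (rule sum_pos2[of _ i])
    show "0 < lam $ i * (G v (b i))\<^sup>2" using i pos by simp
    show "0 \<le> lam $ j * (G v (b j))\<^sup>2" for j using pos[of j] by simp
  qed auto
qed

text \<open>The properties shared by both hypersurfaces: strict convexity of one and the cone
  condition on the other each give nonnegative curvatures with \<open>S (Suc k)\<close>
  positive.\<close>

definition convex_translator ::
  "nat \<Rightarrow> 'n::finite ambient set \<Rightarrow> ('n ambient \<Rightarrow> 'n ambient) \<Rightarrow> bool" where
  "convex_translator k M \<nu> \<longleftrightarrow> embedded_hypersurface M \<and> unit_normal M \<nu> \<and> translator k M \<nu> \<and>
     (\<forall>r\<in>M. \<exists>lam. principal_curvatures M \<nu> r lam \<and> (\<forall>i. 0 \<le> lam $ i) \<and> 0 < S (Suc k) lam)"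

context frame
begin

lemma graph_over_bilinear:
  assumes "graph_over M N V u g H" "r \<in> M" "r \<in> N"
  shows "bilinear (\<lambda>\<xi> \<eta>. H (P r) \<xi> \<bullet> \<eta>)"
proof -
  have "P r \<in> V" "\<And>y. y \<in> V \<Longrightarrow> (g has_derivative H y) (at y)"
    using assms unfolding graph_over_def C2_graph_def by auto
  then have "linear (H (P r))" using has_derivative_linear by blast
  then show ?thesis
    by (auto simp: bilinear_def linear_add linear_scale algebra_simps intro!: linearI)
qed

lemma graph_over_posdef:
  assumes gr: "graph_over M N V u g H" and M: "convex_translator k M \<nu>" "strictly_convex M \<nu>"
    and r: "r \<in> M" "r \<in> N" "0 < \<nu> r \<bullet> d"
  shows "inner_form (\<lambda>\<xi> \<eta>. H (P r) \<xi> \<bullet> \<eta>)"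
proof -
  obtain lam where lam: "principal_curvatures M \<nu> r lam" "\<And>i. 0 < lam $ i"
    using M(2) r unfolding strictly_convex_def by blast
  have e: "eigs (graph_metric (g (P r))) (\<lambda>\<xi> \<eta>. H (P r) \<xi> \<bullet> \<eta>) ((1 / (\<nu> r \<bullet> d)) *\<^sub>R lam)"
    using graph_over_eigs[OF gr _ _ r(2,3) lam(1)] M(1) unfolding convex_translator_def by blast
  show ?thesis
    using lam(2) r(3)
    by (intro inner_form_of_eigs[OF inner_form_graph_metric _ e]
        eigs_imp_symform[OF graph_over_bilinear[OF gr r(1,2)] inner_form_graph_metric e]) simp
qed

text \<open>The curvature vector witnessing convexity and the one witnessing the translator equation
  are chosen independently. Both are eigenvalue vectors of the same pair of forms, so the signs pass
  from the first to the second.\<close>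

lemma graph_over_equation:
  assumes gr: "graph_over M N V u g H" and k: "0 < k" and M: "convex_translator k M \<nu>"
    and r: "r \<in> M" "r \<in> N" "0 < \<nu> r \<bullet> d"
  shows "graph_equation k slope (g (P r)) (H (P r))" "0 < slope (g (P r))"
proof -
  let ?B = "\<lambda>\<xi> \<eta>. H (P r) \<xi> \<bullet> \<eta>" and ?t = "\<nu> r \<bullet> d" and ?G = "graph_metric (g (P r))"
  have emb: "embedded_hypersurface M" "unit_normal M \<nu>" using M by (auto simp: convex_translator_def)
  note iG = inner_form_graph_metric[of "g (P r)"]
  obtain lam where lam: "principal_curvatures M \<nu> r lam" "\<And>i. 0 \<le> lam $ i" "0 < S (Suc k) lam"
    using M r unfolding convex_translator_def by blast
  obtain mu where mu: "principal_curvatures M \<nu> r mu" "S k mu \<noteq> 0" "Q k mu = \<nu> r \<bullet> e_last"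
    using M r unfolding convex_translator_def translator_def by blast
  have e1: "eigs ?G ?B ((1 / ?t) *\<^sub>R lam)" using graph_over_eigs[OF gr emb r(2,3) lam(1)] .
  have e2: "eigs ?G ?B ((1 / ?t) *\<^sub>R mu)" using graph_over_eigs[OF gr emb r(2,3) mu(1)] .
  have sym: "symform ?B" using eigs_imp_symform[OF graph_over_bilinear[OF gr r(1,2)] iG e1] .
  have lam0: "0 \<le> ((1 / ?t) *\<^sub>R lam) $ i" for i using lam(2) r(3) by simp
  have B0: "0 \<le> ?B v v" for v using form_nonneg_of_eigs[OF iG sym e1 lam0] .
  have mu0: "0 \<le> ((1 / ?t) *\<^sub>R mu) $ i" for i using eigs_nonneg[OF e2 B0] .
  \<comment> \<open>Comparing the Hessian with itself: an inequality up to permutation in one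
    direction suffices to transfer \<open>S (Suc k) > 0\<close>.\<close>
  obtain \<pi> where p: "\<pi> permutes UNIV" "\<And>i. ((1 / ?t) *\<^sub>R lam) $ \<pi> i \<le> ((1 / ?t) *\<^sub>R mu) $ i"
    using eigs_mono[OF iG iG order_refl sym sym order_refl e2 e1 lam0] by blast
  have "0 < S (Suc k) ((1 / ?t) *\<^sub>R lam)" using lam(3) r(3) by (simp add: S_scale)
  also have "\<dots> = S (Suc k) (\<chi> i. ((1 / ?t) *\<^sub>R lam) $ \<pi> i)" using S_permute[OF p(1)] by metis
  also have "\<dots> \<le> S (Suc k) ((1 / ?t) *\<^sub>R mu)" using p(2) lam0 by (intro S_mono) auto
  finally have Sk1: "0 < S (Suc k) ((1 / ?t) *\<^sub>R mu)" .
  have "S k ((1 / ?t) *\<^sub>R mu) \<noteq> 0" using mu(2) r(3) by (simp add: S_scale)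
  then have Sk: "0 < S k ((1 / ?t) *\<^sub>R mu)" using S_nonneg[of "(1 / ?t) *\<^sub>R mu" k] mu0 by (simp add: less_le)
  have nu: "\<nu> r = ?t *\<^sub>R nrm (g (P r))" using graph_over_normal[OF gr emb r(1,2)] .
  have "\<nu> r \<bullet> e_last = ?t * slope (g (P r))" unfolding slope_def by (subst nu) simp
  then have q: "Q k ((1 / ?t) *\<^sub>R mu) = slope (g (P r))" using mu(3) r(3) by (simp add: Q_scale)
  show "graph_equation k slope (g (P r)) (H (P r))"
    unfolding graph_equation_def using sym e2 mu0 Sk q by blast
  show "0 < slope (g (P r))" using Sk Sk1 unfolding q[symmetric] Q_def by simp
qed

lemma graph_exists:
  assumes M: "embedded_hypersurface M" "unit_normal M \<nu>" and r: "r \<in> M" "\<nu> r = d"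
  obtains N V u g H where "graph_over M N V u g H" "r \<in> N"
proof -
  obtain \<phi> U a s where par: "parametrization M \<phi> U a" "s \<in> U" "0 \<le> a \<bullet> s" "\<phi> s = r"
    using embedded_chart[OF M(1) r(1)] .
  have "frechet_derivative \<phi> (at s) \<xi> \<bullet> d = 0" for \<xi>
    using normal_orthogonal[OF M(2) par(1-3)] par(4) r(2) by simp
  from local_graph[OF par(1-3) this] show ?thesis using that par(4) by metis
qed

end

section \<open>Orientation of the normals\<close>

lemma unit_normal_norm: "unit_normal M \<nu> \<Longrightarrow> r \<in> M \<Longrightarrow> norm (\<nu> r) = 1"
  by (simp add: unit_normal_def)

text \<open>Over the tangent hyperplane at \<open>r\<close> itself,
  \<open>\<nu> r \<bullet> e_last\<close> is the \<open>slope\<close> of the graph, which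
  \<open>graph_over_equation\<close> shows to be positive.\<close>

lemma normal_upward:
  assumes k: "0 < k" and M: "convex_translator k M \<nu>" and r: "r \<in> M"
  shows "0 < \<nu> r \<bullet> e_last"
proof -
  have emb: "embedded_hypersurface M" "unit_normal M \<nu>" using M by (auto simp: convex_translator_def)
  have n: "norm (\<nu> r) = 1" using unit_normal_norm[OF emb(2) r] .
  obtain A P where "frame A P (\<nu> r)" using frame_exists[OF n] .
  then interpret frame A P "\<nu> r" .
  obtain N V u g H where gr: "graph_over M N V u g H" "r \<in> N" using graph_exists[OF emb r refl] .
  have pos: "0 < \<nu> r \<bullet> \<nu> r" using dd by simp
  have "\<nu> r \<bullet> e_last = (\<nu> r \<bullet> \<nu> r) * slope (g (P r))"
    unfolding slope_def by (subst graph_over_normal[OF gr(1) emb r gr(2)]) simp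
  then show ?thesis using graph_over_equation(2)[OF gr(1) k M r gr(2) pos] dd by simp
qed

lemma unit_eqI:
  assumes "x = t *\<^sub>R w" "y = t' *\<^sub>R w" "norm x = 1" "norm y = 1" "0 < x \<bullet> e" "0 < y \<bullet> (e :: 'a::real_inner)"
  shows "x = y"
proof -
  have "\<bar>t\<bar> * norm w = \<bar>t'\<bar> * norm w" "w \<noteq> 0" using assms by auto
  then have abs: "\<bar>t\<bar> = \<bar>t'\<bar>" by simp
  have "0 < t * (w \<bullet> e)" "0 < t' * (w \<bullet> e)" using assms by simp_all
  then have "0 < t \<longleftrightarrow> 0 < t'" by (metis zero_less_mult_iff order_less_asym)
  then have "t = t'" using abs by (auto simp: abs_if split: if_splits)
  then show ?thesis using assms by simp
qed

lemma normal_eq_of_tangent_space_eq: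
  fixes M1 M2 :: "'n::finite ambient set"
  assumes k: "0 < k" and M: "convex_translator k M1 \<nu>1" "convex_translator k M2 \<nu>2"
    and r: "r \<in> M1" "r \<in> M2" and T: "tangent_space M1 r = tangent_space M2 r"
  shows "\<nu>1 r = \<nu>2 r"
proof -
  have T': "tangent_space M r = {v. v \<bullet> \<nu> r = 0}" if hM: "convex_translator k M \<nu>" "r \<in> M"
    for M and \<nu> :: "'n ambient \<Rightarrow> 'n ambient"
  proof -
    have emb: "embedded_hypersurface M" "unit_normal M \<nu>" using hM by (auto simp: convex_translator_def)
    obtain \<phi> U a s where "parametrization M \<phi> U a" "s \<in> U" "0 \<le> a \<bullet> s" "\<phi> s = r"
      using embedded_chart[OF emb(1) hM(2)] .
    then show ?thesis using tangent_space_eq(2)[OF emb(2)] by blast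
  qed
  let ?a = "\<nu>1 r" and ?b = "\<nu>2 r"
  have n: "norm ?a = 1" "norm ?b = 1" using M r unit_normal_norm unfolding convex_translator_def by blast+
  have na: "?a \<bullet> ?a = 1" using n by (simp add: dot_square_norm)
  let ?v = "?b - (?a \<bullet> ?b) *\<^sub>R ?a"
  have va: "?v \<bullet> ?a = 0" by (simp add: inner_diff_left na inner_commute[of ?b ?a])
  then have vb: "?v \<bullet> ?b = 0" using T T'[OF M(1) r(1)] T'[OF M(2) r(2)] by blast
  have "?v \<bullet> ?v = ?v \<bullet> ?b - (?a \<bullet> ?b) * (?v \<bullet> ?a)" by (simp only: inner_diff_right inner_scaleR_right)
  then have "?v = 0" using va vb by simp
  then have "?b = (?a \<bullet> ?b) *\<^sub>R ?a" "?a = 1 *\<^sub>R ?a" by simp_all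
  then show ?thesis using unit_eqI[of ?a 1 ?a ?b "?a \<bullet> ?b"] n normal_upward[OF k] M r by blast
qed

text \<open>A graph containing \<open>M2\<close> near \<open>r\<close> contains \<open>M1\<close>
  too, so both normals are multiples of the same \<open>nrm\<close> and point upward. The argument
  covers boundary points as well.\<close>

lemma normal_eq_of_local_subset:
  assumes k: "0 < k" and M: "convex_translator k M1 \<nu>1" "convex_translator k M2 \<nu>2"
    and W: "open W" "r \<in> W" "M1 \<inter> W \<subseteq> M2" and r: "r \<in> M1"
  shows "\<nu>1 r = \<nu>2 r"
proof -
  have emb: "embedded_hypersurface M1" "unit_normal M1 \<nu>1" "embedded_hypersurface M2" "unit_normal M2 \<nu>2"
    using M by (auto simp: convex_translator_def)
  have r2: "r \<in> M2" using W r by blast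
  have n: "norm (\<nu>1 r) = 1" "norm (\<nu>2 r) = 1" using unit_normal_norm emb r r2 by blast+
  obtain A P where "frame A P (\<nu>2 r)" using frame_exists[OF n(2)] .
  then interpret frame A P "\<nu>2 r" .
  obtain N V u g H where gr: "graph_over M2 N V u g H" "r \<in> N" using graph_exists[OF emb(3,4) r2 refl] .
  have gr1: "graph_over M1 (N \<inter> W) V u g H" using gr(1) W unfolding graph_over_def by (auto simp: open_Int)
  show ?thesis
    using unit_eqI[OF graph_over_normal[OF gr1 emb(1,2) r] graph_over_normal[OF gr(1) emb(3,4) r2 gr(2)] n]
      normal_upward[OF k M(1) r] normal_upward[OF k M(2) r2] gr(2) W(2) by blast
qed

lemma C2_graph_subset: "C2_graph V u g H \<Longrightarrow> open V' \<Longrightarrow> V' \<subseteq> V \<Longrightarrow> C2_graph V' u g H"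
  unfolding C2_graph_def by (meson continuous_on_subset subsetD)

lemma normal_direction_open:
  assumes nu: "unit_normal M \<nu>" and q: "q \<in> M" "\<nu> q = d"
  obtains T where "open T" "q \<in> T" "\<And>x. x \<in> M \<Longrightarrow> x \<in> T \<Longrightarrow> 0 < \<nu> x \<bullet> d"
proof -
  have "continuous_on M (\<lambda>x. \<nu> x \<bullet> d)"
    using nu unfolding unit_normal_def by (intro continuous_intros) blast
  then have "openin (top_of_set M) (M \<inter> (\<lambda>x. \<nu> x \<bullet> d) -` {0<..})"
    by (rule continuous_openin_preimage_gen) simp
  then obtain T where T: "open T" "M \<inter> (\<lambda>x. \<nu> x \<bullet> d) -` {0<..} = M \<inter> T" unfolding openin_open by blast
  have "\<nu> q \<bullet> d = 1" using nu q unfolding unit_normal_def by (metis dot_square_norm one_power2)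
  then have "q \<in> M \<inter> T" using q unfolding T(2)[symmetric] by simp
  then show ?thesis using that[of T] T by blast
qed

context frame
begin

lemma point_open:
  assumes C2: "C2_graph V u g H" and T: "open T"
  shows "open {y \<in> V. point u y \<in> T}"
proof -
  have V: "open V" and "continuous_on V u"
    using C2 unfolding C2_graph_def
    by (auto intro!: continuous_at_imp_continuous_on dest: has_derivative_continuous)
  then have "continuous_on V (point u)"
    unfolding point_def[abs_def] by (intro continuous_intros bounded_linear.continuous_on[OF bA])
  then have "open (V \<inter> point u -` T)" using V T by (rule continuous_open_preimage)
  moreover have "V \<inter> point u -` T = {y \<in> V. point u y \<in> T}" by auto
  ultimately show ?thesis by simp
qed

text \<open>At an interior point the chart fills a whole neighbourhood, so the graph points belong
  to \<open>M\<close>, beyond the containment stated by \<open>graph_over\<close>.\<close>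

lemma interior_graph:
  assumes nu: "unit_normal M \<nu>" and q: "q \<in> interior_points M" "\<nu> q = d"
  obtains N V u g H where "graph_over M N V u g H" "q \<in> N" "\<And>y. y \<in> V \<Longrightarrow> point u y \<in> M"
proof -
  obtain \<phi> U s where par: "parametrization M \<phi> U 0" "s \<in> U" "\<phi> s = q"
    using q(1) unfolding interior_points_def by blast
  have s0: "0 \<le> 0 \<bullet> s" by simp
  have "frechet_derivative \<phi> (at s) \<xi> \<bullet> d = 0" for \<xi>
    using normal_orthogonal[OF nu par(1,2) s0] par(3) q(2) by simp
  from local_graph[OF par(1,2) s0 this] obtain U0 V \<theta> g H N where
    lg: "U0 \<subseteq> U" "homeomorphism U0 V (\<lambda>s. P (\<phi> s)) \<theta>"
    "graph_over M N V (\<lambda>y. \<phi> (\<theta> y) \<bullet> d) g H" "\<phi> s \<in> N" by metis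
  have "point (\<lambda>y. \<phi> (\<theta> y) \<bullet> d) y \<in> M" if "y \<in> V" for y
  proof -
    have "\<theta> y \<in> U0" "P (\<phi> (\<theta> y)) = y" using lg(2) that by (auto simp: homeomorphism_def)
    then have "\<phi> (\<theta> y) = point (\<lambda>y. \<phi> (\<theta> y) \<bullet> d) y" "\<phi> (\<theta> y) \<in> M"
      using point_unique[of "\<phi> (\<theta> y)" y] chart_in[OF par(1)] lg(1) by auto
    then show ?thesis by simp
  qed
  then show ?thesis using that lg(3,4) par(3) by blast
qed

end

lemma at_one_sideD:
  assumes "at_one_side M N \<nu>" "q \<in> M" "q \<in> N"
  obtains \<sigma> W where "\<sigma> = 1 \<or> \<sigma> = -1" "open W" "q \<in> W"
    "\<And>x y t. x \<in> M \<inter> W \<Longrightarrow> y \<in> N \<inter> W \<Longrightarrow> x = y + t *\<^sub>R \<nu> q \<Longrightarrow> 0 \<le> \<sigma> * t"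
proof -
  obtain \<sigma> where \<sigma>: "\<sigma> \<in> {-1, 1::real}" and *: "\<forall>q\<in>M \<inter> N. \<exists>W. open W \<and> q \<in> W \<and>
        (\<forall>x\<in>M \<inter> W. \<forall>y\<in>N \<inter> W. \<forall>t. x = y + t *\<^sub>R \<nu> q \<longrightarrow> 0 \<le> \<sigma> * t)"
    using assms(1) unfolding at_one_side_def by (elim bexE)
  have "q \<in> M \<inter> N" using assms by simp
  from *[rule_format, OF this] obtain W where "open W" "q \<in> W"
    "\<forall>x\<in>M \<inter> W. \<forall>y\<in>N \<inter> W. \<forall>t. x = y + t *\<^sub>R \<nu> q \<longrightarrow> 0 \<le> \<sigma> * t" by (elim exE conjE)
  then show ?thesis using \<sigma> by (intro that[of \<sigma> W]) (auto simp del: Int_iff)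
qed

text \<open>Over the common tangent hyperplane, the lines parallel to \<open>\<nu>2 q\<close> are
  the vertical lines, so \<open>at_one_side\<close> says that
  \<open>\<sigma> * (u1 y - u2 y)\<close> is nonnegative, and \<open>strong_maximum\<close> applies
  with \<open>slope\<close> as right-hand side.\<close>

lemma local_interior_principle:
  fixes M1 M2 :: "'n::finite ambient set"
  assumes k: "0 < k" "k \<le> CARD('n) - 1"
    and M: "convex_translator k M1 \<nu>1" "convex_translator k M2 \<nu>2" "strictly_convex M1 \<nu>1"
    and side: "at_one_side M1 M2 \<nu>2"
    and q: "q \<in> interior_points M1" "q \<in> interior_points M2" "\<nu>1 q = \<nu>2 q"
  obtains W where "open W" "q \<in> W" "M1 \<inter> W = M2 \<inter> W"
proof -
  have emb: "embedded_hypersurface M1" "unit_normal M1 \<nu>1" "embedded_hypersurface M2" "unit_normal M2 \<nu>2"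
    using M by (auto simp: convex_translator_def)
  have qM: "q \<in> M1" "q \<in> M2" using q interior_points_subset by blast+
  have n: "norm (\<nu>2 q) = 1" using unit_normal_norm emb qM by blast
  obtain A P where "frame A P (\<nu>2 q)" using frame_exists[OF n] .
  then interpret frame A P "\<nu>2 q" .
  obtain N1 V1 u1 g1 H1 where gr1: "graph_over M1 N1 V1 u1 g1 H1" "q \<in> N1" "\<And>y. y \<in> V1 \<Longrightarrow> point u1 y \<in> M1"
    using interior_graph[OF emb(2) q(1,3)] by blast
  obtain N2 V2 u2 g2 H2 where gr2: "graph_over M2 N2 V2 u2 g2 H2" "q \<in> N2" "\<And>y. y \<in> V2 \<Longrightarrow> point u2 y \<in> M2"
    using interior_graph[OF emb(4) q(2) refl] by blast
  obtain T1 where T1: "open T1" "q \<in> T1" "\<And>x. x \<in> M1 \<Longrightarrow> x \<in> T1 \<Longrightarrow> 0 < \<nu>1 x \<bullet> \<nu>2 q"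
    using normal_direction_open[OF emb(2) qM(1) q(3)] by blast
  obtain T2 where T2: "open T2" "q \<in> T2" "\<And>x. x \<in> M2 \<Longrightarrow> x \<in> T2 \<Longrightarrow> 0 < \<nu>2 x \<bullet> \<nu>2 q"
    using normal_direction_open[OF emb(4) qM(2) refl] by blast
  obtain \<sigma> W0 where \<sigma>: "\<sigma> = 1 \<or> \<sigma> = -1" and W0: "open W0" "q \<in> W0"
    and one: "\<And>x y t. x \<in> M1 \<inter> W0 \<Longrightarrow> y \<in> M2 \<inter> W0 \<Longrightarrow> x = y + t *\<^sub>R \<nu>2 q \<Longrightarrow> 0 \<le> \<sigma> * t"
    using at_one_sideD[OF side qM] by metis
  have C2: "C2_graph V1 u1 g1 H1" "C2_graph V2 u2 g2 H2" and N: "open N1" "open N2"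
    and in1: "\<And>x. x \<in> M1 \<Longrightarrow> x \<in> N1 \<Longrightarrow> P x \<in> V1 \<and> x \<bullet> \<nu>2 q = u1 (P x)"
    and in2: "\<And>x. x \<in> M2 \<Longrightarrow> x \<in> N2 \<Longrightarrow> P x \<in> V2 \<and> x \<bullet> \<nu>2 q = u2 (P x)"
    using gr1(1) gr2(1) unfolding graph_over_def by blast+
  define T where "T = N1 \<inter> N2 \<inter> T1 \<inter> T2 \<inter> W0"
  have T: "open T" "q \<in> T" using N T1 T2 W0 gr1 gr2 by (auto simp: T_def)
  \<comment> \<open>Over \<open>\<Omega>\<close> both graph points lie where the representations,
    the positive normal components and the one-sidedness are all valid.\<close>
  define \<Omega> where "\<Omega> = {y \<in> V1. point u1 y \<in> T} \<inter> {y \<in> V2. point u2 y \<in> T}"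
  have oO: "open \<Omega>" unfolding \<Omega>_def using point_open C2 T(1) by blast
  have pq: "point u1 (P q) = q" "point u2 (P q) = q"
    using point_unique[of q "P q" u1] point_unique[of q "P q" u2] in1[OF qM(1) gr1(2)] in2[OF qM(2) gr2(2)] by auto
  have "P q \<in> \<Omega>" using pq T(2) in1[OF qM(1) gr1(2)] in2[OF qM(2) gr2(2)] by (simp add: \<Omega>_def)
  then obtain r where r: "0 < r" "ball (P q) r \<subseteq> \<Omega>" using openE[OF oO] by blast
  have V: "y \<in> V1" "y \<in> V2" "point u1 y \<in> T" "point u2 y \<in> T" if "y \<in> ball (P q) r" for y
    using that r(2) by (auto simp: \<Omega>_def)
  have pM: "point u1 y \<in> M1" "point u2 y \<in> M2" if "y \<in> ball (P q) r" for y
    using V[OF that] gr1(3) gr2(3) by auto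
  have C2b: "C2_graph (ball (P q) r) u1 g1 H1" "C2_graph (ball (P q) r) u2 g2 H2"
    using C2_graph_subset[OF C2(1)] C2_graph_subset[OF C2(2)] V by blast+
  have d1: "0 < \<nu>1 (point u1 y) \<bullet> \<nu>2 q" and d2: "0 < \<nu>2 (point u2 y) \<bullet> \<nu>2 q" if "y \<in> ball (P q) r" for y
    using T1(3)[OF pM(1)[OF that]] T2(3)[OF pM(2)[OF that]] V[OF that] by (auto simp: T_def)
  have eq1: "graph_equation k slope (g1 y) (H1 y)" and pos: "inner_form (\<lambda>\<xi> \<eta>. H1 y \<xi> \<bullet> \<eta>)"
    if "y \<in> ball (P q) r" for y
    using graph_over_equation(1)[OF gr1(1) k(1) M(1) pM(1)[OF that] _ d1[OF that]]
      graph_over_posdef[OF gr1(1) M(1,3) pM(1)[OF that] _ d1[OF that]] V[OF that] by (auto simp: P_point T_def)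
  have eq2: "graph_equation k slope (g2 y) (H2 y)" if "y \<in> ball (P q) r" for y
    using graph_over_equation(1)[OF gr2(1) k(1) M(2) pM(2)[OF that] _ d2[OF that]] V[OF that]
    by (auto simp: P_point T_def)
  have w: "0 \<le> \<sigma> * (u1 y - u2 y)" if "y \<in> ball (P q) r" for y
    using V[OF that] pM[OF that] by (intro one[of "point u1 y" "point u2 y"]) (auto simp: T_def point_def algebra_simps)
  have "u1 (P q) = u2 (P q)" using in1[OF qM(1) gr1(2)] in2[OF qM(2) gr2(2)] by simp
  then have eq: "u1 y = u2 y" if "y \<in> ball (P q) (r / 2)" for y
    using strong_maximum[OF k C2b r(1) norm_ge_zero slope_lipschitz pos eq1 eq2 \<sigma> w _ that] by blast
  define W where "W = N1 \<inter> N2 \<inter> P -` ball (P q) (r / 2)"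
  have sub: "ball (P q) (r / 2) \<subseteq> ball (P q) r" using r(1) by auto
  have "open (P -` ball (P q) (r / 2))"
    by (intro open_vimage open_ball bounded_linear.continuous_on[OF bP] continuous_on_id)
  then have "open W" using N by (auto simp: W_def)
  moreover have "q \<in> W" using gr1 gr2 r by (simp add: W_def)
  moreover have "M1 \<inter> W = M2 \<inter> W"
  proof (intro equalityI subsetI IntI)
    fix x assume x: "x \<in> M1 \<inter> W"
    then have "P x \<in> ball (P q) (r / 2)" "x \<bullet> \<nu>2 q = u1 (P x)" using in1 by (auto simp: W_def)
    then have "x = point u2 (P x)" "P x \<in> ball (P q) r" using point_unique[of x "P x" u2] eq sub by auto
    then show "x \<in> M2" using pM(2) by metis
  next
    fix x assume x: "x \<in> M2 \<inter> W"
    then have "P x \<in> ball (P q) (r / 2)" "x \<bullet> \<nu>2 q = u2 (P x)" using in2 by (auto simp: W_def)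
    then have "x = point u1 (P x)" "P x \<in> ball (P q) r" using point_unique[of x "P x" u1] eq sub by auto
    then show "x \<in> M1" using pM(1) by metis
  qed auto
  ultimately show ?thesis using that by blast
qed


subsection \<open>Continuation of coincidence\<close>

text \<open>A compact half-ball in a chart has compact, hence closed image, which contains all of
  \<open>N\<close> near \<open>q\<close>.\<close>

lemma locally_closed:
  assumes "embedded_hypersurface N" "q \<in> N"
  obtains W where "open W" "q \<in> W" "closure N \<inter> W \<subseteq> N"
proof -
  obtain \<phi> U a s where par: "parametrization N \<phi> U a" "s \<in> U" "0 \<le> a \<bullet> s" "\<phi> s = q"
    using embedded_chart[OF assms] .
  obtain \<rho> where \<rho>: "0 < \<rho>" "cball s \<rho> \<subseteq> U" using open_contains_cball chart_open[OF par(1)] par(2) by blast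
  let ?K = "\<phi> ` (cball s \<rho> \<inter> halfspace a)"
  have "closed (halfspace a)" unfolding halfspace_def by (rule closed_halfspace_ge)
  then have "compact (cball s \<rho> \<inter> halfspace a)" by (intro compact_Int_closed) auto
  then have "compact ?K"
    using \<rho>(2) by (intro compact_continuous_image continuous_on_subset[OF chart_continuous[OF par(1)]]) auto
  then have "closed ?K" by (rule compact_imp_closed)
  obtain W where W: "open W" "N \<inter> W = \<phi> ` (ball s \<rho> \<inter> halfspace a)"
    using chart_openin[OF par(1), of "ball s \<rho>"] \<rho>(2) by (metis ball_subset_cball open_ball order_trans)
  have "N \<inter> W \<subseteq> ?K" unfolding W(2) by auto
  then have "closure (N \<inter> W) \<subseteq> ?K" using \<open>closed ?K\<close> by (rule closure_minimal)
  moreover have "closure N \<inter> W \<subseteq> closure (N \<inter> W)"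
    using open_Int_closure_subset[OF W(1), of N] by (simp add: Int_commute)
  moreover have "?K \<subseteq> N" using \<rho>(2) chart_in[OF par(1)] by (auto simp: halfspace_def)
  moreover have "s \<in> ball s \<rho> \<inter> halfspace a" using \<rho>(1) par(3) by (simp add: halfspace_def)
  then have "q \<in> W" using W(2) par(4) by blast
  ultimately show ?thesis using that W(1) by blast
qed

text \<open>This is closedness of the edge: interior points form a relatively open set, and near
  them \<open>N\<close> is closed.\<close>

lemma edge_avoiding_neighborhood:
  assumes N: "embedded_hypersurface N" and q: "q \<notin> edge N"
  obtains W where "open W" "q \<in> W" "W \<inter> edge N = {}"
proof (cases "q \<in> closure N")
  case False
  then show ?thesis using that[of "- closure N"] by (auto simp: edge_def)
next
  case True
  then have qi: "q \<in> interior_points N" using q by (simp add: edge_def)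
  then have qN: "q \<in> N" using interior_points_subset by blast
  obtain \<phi> U where par: "parametrization N \<phi> U 0" "q \<in> \<phi> ` U"
    using qi unfolding interior_points_def by blast
  have sub: "\<phi> ` U \<subseteq> interior_points N" using interior_point_of_chart[OF par(1)] by blast
  obtain N1 where N1: "open N1" "N \<inter> N1 = \<phi> ` U"
    using chart_openin[OF par(1) chart_open[OF par(1)] order_refl] by (metis Int_UNIV_right halfspace_0)
  obtain W where W: "open W" "q \<in> W" "closure N \<inter> W \<subseteq> N" using locally_closed[OF N qN] .
  have "q \<in> W \<inter> N1" using W N1(2) par(2) by blast
  moreover have "(W \<inter> N1) \<inter> edge N = {}"
  proof (intro equals0I)
    fix x assume "x \<in> (W \<inter> N1) \<inter> edge N"
    then have x: "x \<in> W" "x \<in> N1" "x \<in> closure N" "x \<notin> interior_points N" by (auto simp: edge_def)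
    then have "x \<in> N \<inter> N1" using W(3) by blast
    then show False using x(4) sub N1(2) by blast
  qed
  ultimately show ?thesis using that[of "W \<inter> N1"] W(1) N1(1) by blast
qed

text \<open>Even at a boundary point the open half-ball of a chart has a connected image of interior
  points, dense in \<open>M\<close> near \<open>q\<close>. Agreement can thus be spread through
  interior points and passed to the others by closure.\<close>

lemma connected_interior_piece:
  fixes M :: "'n::finite ambient set"
  assumes M: "embedded_hypersurface M" "q \<in> M" and W: "open W" "q \<in> W"
  obtains T Mo where "open T" "q \<in> T" "T \<subseteq> W" "connected Mo" "Mo \<subseteq> interior_points M" "Mo \<subseteq> T"
    "M \<inter> T \<subseteq> closure Mo"
proof -
  obtain \<phi> U a s where par: "parametrization M \<phi> U a" "s \<in> U" "0 \<le> a \<bullet> s" "\<phi> s = q"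
    using embedded_chart[OF M] .
  note cont = chart_continuous[OF par(1)] and oU = chart_open[OF par(1)]
  have "open (U \<inter> \<phi> -` W)" using cont oU W(1) by (rule continuous_open_preimage)
  moreover have "s \<in> U \<inter> \<phi> -` W" using par W(2) by simp
  ultimately obtain \<rho> where \<rho>: "0 < \<rho>" "cball s \<rho> \<subseteq> U \<inter> \<phi> -` W"
    unfolding open_contains_cball by blast
  define B where "B = ball s \<rho> \<inter> {x. a = 0 \<or> 0 < a \<bullet> x}"
  have Bc: "closure B \<subseteq> cball s \<rho>" unfolding B_def by (intro closure_minimal) auto
  have BU: "B \<subseteq> U" using \<rho>(2) by (auto simp: B_def)
  have contB: "continuous_on (closure B) \<phi>" using Bc \<rho>(2) by (intro continuous_on_subset[OF cont]) auto
  obtain N1 where N1: "open N1" "M \<inter> N1 = \<phi> ` (ball s \<rho> \<inter> halfspace a)"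
    using chart_openin[OF par(1), of "ball s \<rho>"] \<rho>(2) by (metis Int_subset_iff ball_subset_cball open_ball order_trans)
  have "convex {x. a = 0 \<or> 0 < a \<bullet> x}" by (cases "a = 0") (auto simp: convex_halfspace_gt)
  then have "convex B" unfolding B_def by (intro convex_Int) auto
  then have conn: "connected (\<phi> ` B)"
    using BU by (intro connected_continuous_image continuous_on_subset[OF cont] convex_connected) auto
  have int: "\<phi> ` B \<subseteq> interior_points M"
    using interior_point_of_chart[OF par(1)] BU by (auto simp: B_def)
  have inT: "\<phi> ` B \<subseteq> N1 \<inter> W"
  proof -
    have "\<phi> ` B \<subseteq> \<phi> ` (ball s \<rho> \<inter> halfspace a)" by (intro image_mono) (auto simp: B_def halfspace_def)
    moreover have "B \<subseteq> cball s \<rho>" by (auto simp: B_def)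
    then have "\<phi> ` B \<subseteq> W" using \<rho>(2) by blast
    ultimately show ?thesis using N1(2) by blast
  qed
  have "ball s \<rho> \<inter> halfspace a \<subseteq> closure B"
  proof
    fix x assume x: "x \<in> ball s \<rho> \<inter> halfspace a"
    show "x \<in> closure B"
    proof (cases "a = 0 \<or> 0 < a \<bullet> x")
      case True
      then have "x \<in> B" using x by (simp add: B_def)
      then show ?thesis using closure_subset by blast
    next
      case False
      then have a: "a \<noteq> 0" "a \<bullet> x = 0" using x by (auto simp: halfspace_def)
      show ?thesis
        unfolding closure_approachable
      proof (intro allI impI)
        fix e :: real assume e: "0 < e"
        obtain \<delta> where \<delta>: "0 < \<delta>" "ball x \<delta> \<subseteq> ball s \<rho>" using x openE[OF open_ball, of x s \<rho>] by blast
        \<comment> \<open>A step along \<open>a\<close> moves a point of the bounding hyperplane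
          into the open half-space; its length is half of \<open>min e \<delta>\<close>.\<close>
        define t where "t = min e \<delta> / (2 * norm a)"
        have t: "0 < t" using e \<delta> a by (simp add: t_def)
        have "norm (t *\<^sub>R a) = min e \<delta> / 2" "0 < min e \<delta>" using e \<delta> a by (simp_all add: t_def)
        then have nt: "norm (t *\<^sub>R a) < min e \<delta>" by linarith
        have "x + t *\<^sub>R a \<in> ball x \<delta>" using nt by (simp add: dist_norm)
        then have "x + t *\<^sub>R a \<in> ball s \<rho>" using \<delta>(2) by blast
        moreover have "0 < a \<bullet> (x + t *\<^sub>R a)" using a t by (simp add: inner_add_right)
        ultimately have "x + t *\<^sub>R a \<in> B" by (simp add: B_def)
        moreover have "dist (x + t *\<^sub>R a) x < e" using nt by (simp add: dist_norm)
        ultimately show "\<exists>y\<in>B. dist y x < e" by blast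
      qed
    qed
  qed
  moreover have "\<phi> ` closure B \<subseteq> closure (\<phi> ` B)"
    using contB by (rule image_closure_subset) (auto intro: closure_subset[THEN subsetD])
  ultimately have cl: "M \<inter> (N1 \<inter> W) \<subseteq> closure (\<phi> ` B)" using N1(2) by blast
  have "s \<in> ball s \<rho> \<inter> halfspace a" using \<rho>(1) par(3) by (simp add: halfspace_def)
  then have "q \<in> N1 \<inter> W" using N1(2) par(4) W(2) by blast
  then show ?thesis using that[of "N1 \<inter> W" "\<phi> ` B"] N1(1) W(1) conn int inT cl by blast
qed

lemma connected_clopen_argument:
  assumes C: "connected C" and A: "A \<subseteq> C" "A \<noteq> {}"
    and op: "openin (top_of_set C) A" and cl: "C \<inter> closure A \<subseteq> A"
  shows "A = C"
proof -
  have "A = C \<inter> closure A" using A(1) cl closure_subset by blast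
  then have "closedin (top_of_set C) A" using closedin_closed closed_closure by metis
  then show ?thesis using C op A(2) connected_clopen by blast
qed

text \<open>One-sided, to be used with both orders of the hypersurfaces: \<open>loc\<close> is the
  local interior principle, and \<open>neq\<close> returns equality of the normals, which survives
  in the limit and allows \<open>loc\<close> to be applied again.\<close>

locale continuation =
  fixes M N :: "'n::finite ambient set" and \<nu> \<nu>' :: "'n ambient \<Rightarrow> 'n ambient"
  assumes emb: "embedded_hypersurface M" "embedded_hypersurface N"
    and cont: "continuous_on M \<nu>" "continuous_on N \<nu>'"
    and loc: "\<And>q. q \<in> interior_points M \<Longrightarrow> q \<in> interior_points N \<Longrightarrow> \<nu> q = \<nu>' q \<Longrightarrow>
      \<exists>W. open W \<and> q \<in> W \<and> M \<inter> W \<subseteq> N"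
    and neq: "\<And>r W. open W \<Longrightarrow> r \<in> W \<Longrightarrow> r \<in> M \<Longrightarrow> M \<inter> W \<subseteq> N \<Longrightarrow> \<nu> r = \<nu>' r"
begin

definition locally_inside :: "'n ambient set" where
  "locally_inside = \<Union>{W. open W \<and> M \<inter> W \<subseteq> N}"

lemma open_locally_inside: "open locally_inside"
  by (auto simp: locally_inside_def)

lemma locally_inside_subset: "M \<inter> locally_inside \<subseteq> N"
  by (auto simp: locally_inside_def)

lemma locally_insideI: "open W \<Longrightarrow> q \<in> W \<Longrightarrow> M \<inter> W \<subseteq> N \<Longrightarrow> q \<in> locally_inside"
  by (auto simp: locally_inside_def)

text \<open>A clopen argument in \<open>Mo\<close>. A limit of points locally inside
  \<open>N\<close> lies in the closure of \<open>N\<close> off its edge, hence is interior to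
  \<open>N\<close>; the normals agree there by continuity, so \<open>loc\<close> applies.\<close>

lemma interior_piece_subset:
  assumes Mo: "connected Mo" "Mo \<subseteq> interior_points M" "Mo \<inter> edge N = {}" and r0: "r0 \<in> Mo" "r0 \<in> locally_inside"
  shows "Mo \<subseteq> N"
proof -
  have MoM: "Mo \<subseteq> M" using Mo(2) interior_points_subset by blast
  define A where "A = Mo \<inter> locally_inside"
  have AN: "A \<subseteq> N" using locally_inside_subset MoM by (auto simp: A_def)
  have "A = Mo"
  proof (rule connected_clopen_argument[OF Mo(1)])
    show "openin (top_of_set Mo) A" unfolding A_def using open_locally_inside by (simp add: openin_open_Int)
    show "Mo \<inter> closure A \<subseteq> A"
    proof
      fix r assume r: "r \<in> Mo \<inter> closure A"
      then have "r \<in> closure N" using closure_mono[OF AN] by blast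
      then have rN: "r \<in> interior_points N" using r Mo(3) by (auto simp: edge_def)
      then have rMN: "r \<in> M \<inter> N" using r MoM interior_points_subset by blast
      have "continuous_on (M \<inter> N) (\<lambda>x. \<nu> x - \<nu>' x)"
        using cont by (intro continuous_on_diff) (auto intro: continuous_on_subset)
      then have "closedin (top_of_set (M \<inter> N)) (M \<inter> N \<inter> (\<lambda>x. \<nu> x - \<nu>' x) -` {0})"
        by (rule continuous_closedin_preimage) simp
      \<comment> \<open>A closed set that cuts out of \<open>M \<inter> N\<close> the points with
        equal normals.\<close>
      then obtain Z where Z: "closed Z" "M \<inter> N \<inter> (\<lambda>x. \<nu> x - \<nu>' x) -` {0} = M \<inter> N \<inter> Z"
        unfolding closedin_closed by blast
      have "A \<subseteq> Z"
      proof
        fix x assume x: "x \<in> A"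
        then have "x \<in> locally_inside" "x \<in> M" using MoM by (auto simp: A_def)
        then have "\<nu> x = \<nu>' x" by (rule neq[OF open_locally_inside _ _ locally_inside_subset])
        moreover have "x \<in> M \<inter> N" using x AN MoM by (auto simp: A_def)
        ultimately show "x \<in> Z" using Z(2) by auto
      qed
      then have "r \<in> Z" using closure_minimal[OF _ Z(1)] r by blast
      then have "\<nu> r = \<nu>' r" using rMN Z(2) by auto
      then obtain W where "open W" "r \<in> W" "M \<inter> W \<subseteq> N" using loc[of r] rN r Mo(2) by blast
      then show "r \<in> A" using r locally_insideI by (auto simp: A_def)
    qed
  qed (use r0 in \<open>auto simp: A_def\<close>)
  then show ?thesis using AN by simp
qed

lemma locally_inside_closed:
  assumes q: "q \<in> M" and W: "open W" "q \<in> W" "interior_points M \<inter> W \<inter> edge N = {}" "M \<inter> W \<inter> closure N \<subseteq> N"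
    and lim: "\<And>T. open T \<Longrightarrow> q \<in> T \<Longrightarrow> M \<inter> T \<inter> locally_inside \<noteq> {}"
  shows "q \<in> locally_inside"
proof -
  obtain T Mo where T: "open T" "q \<in> T" "T \<subseteq> W" and Mo: "connected Mo" "Mo \<subseteq> interior_points M" "Mo \<subseteq> T"
    "M \<inter> T \<subseteq> closure Mo"
    using connected_interior_piece[OF emb(1) q W(1,2)] .
  obtain r where r: "r \<in> M" "r \<in> T" "r \<in> locally_inside" using lim[OF T(1,2)] by blast
  then have "r \<in> closure Mo" using Mo(4) by blast
  then obtain r' where r': "r' \<in> Mo" "r' \<in> locally_inside"
    using open_locally_inside r(3) open_Int_closure_eq_empty[of locally_inside Mo] by blast
  have "Mo \<inter> edge N = {}" using Mo(2,3) T(3) W(3) by blast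
  then have "Mo \<subseteq> N" using interior_piece_subset[OF Mo(1,2) _ r'] by blast
  then have "M \<inter> T \<subseteq> closure N" using Mo(4) closure_mono by blast
  then have "M \<inter> T \<subseteq> N" using W(4) T(3) by blast
  then show ?thesis using locally_insideI T(1,2) by blast
qed

lemma connected_subset:
  assumes C: "connected C" "C \<subseteq> M" and x0: "x0 \<in> C" "x0 \<in> locally_inside"
    and W: "\<And>q. q \<in> C \<Longrightarrow> \<exists>W. open W \<and> q \<in> W \<and> interior_points M \<inter> W \<inter> edge N = {} \<and> M \<inter> W \<inter> closure N \<subseteq> N"
  shows "C \<subseteq> N"
proof -
  have "C \<inter> locally_inside = C"
  proof (rule connected_clopen_argument[OF C(1)])
    show "openin (top_of_set C) (C \<inter> locally_inside)" using open_locally_inside by (simp add: openin_open_Int)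
    show "C \<inter> closure (C \<inter> locally_inside) \<subseteq> C \<inter> locally_inside"
    proof
      fix q assume q: "q \<in> C \<inter> closure (C \<inter> locally_inside)"
      obtain W where W': "open W" "q \<in> W" "interior_points M \<inter> W \<inter> edge N = {}" "M \<inter> W \<inter> closure N \<subseteq> N"
        using W[of q] q by blast
      have "q \<in> locally_inside"
      proof (rule locally_inside_closed[OF _ W'])
        show "M \<inter> T \<inter> locally_inside \<noteq> {}" if "open T" "q \<in> T" for T
          using open_Int_closure_eq_empty[OF that(1), of "C \<inter> locally_inside"] q that(2) C(2) by blast
      qed (use q C in auto)
      then show "q \<in> C \<inter> locally_inside" using q by blast
    qed
  qed (use x0 in auto)
  then show ?thesis using locally_inside_subset C(2) by blast
qed

lemma connected_subset_off_edge:
  assumes W: "open W" "M \<inter> W \<subseteq> N" and C: "connected C" "C \<inter> W \<noteq> {}" "C \<subseteq> M - edge N"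
  shows "C \<subseteq> N"
proof -
  obtain x0 where x0: "x0 \<in> C" "x0 \<in> W" using C(2) by blast
  show ?thesis
  proof (rule connected_subset[OF C(1) _ x0(1)])
    show "C \<subseteq> M" using C(3) by blast
    show "x0 \<in> locally_inside" using locally_insideI W x0 by blast
    fix q assume "q \<in> C"
    then have "q \<notin> edge N" using C(3) by blast
    then obtain W' where W': "open W'" "q \<in> W'" "W' \<inter> edge N = {}"
      using edge_avoiding_neighborhood[OF emb(2)] by blast
    moreover have "W' \<inter> closure N \<subseteq> N" using W'(3) interior_points_subset unfolding edge_def by blast
    ultimately show "\<exists>W. open W \<and> q \<in> W \<and> interior_points M \<inter> W \<inter> edge N = {} \<and> M \<inter> W \<inter> closure N \<subseteq> N"
      by (intro exI[of _ W']) blast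
  qed
qed

text \<open>For closed \<open>N\<close> the edge is the boundary, so the local condition of
  \<open>connected_subset\<close> holds with the whole space as neighbourhood.\<close>

lemma closed_subset:
  assumes "connected M" "p \<in> M" "open W" "p \<in> W" "M \<inter> W \<subseteq> N" "closed N"
    "interior_points M \<inter> boundary_points N = {}"
  shows "M \<subseteq> N"
proof (rule connected_subset[OF assms(1) order_refl assms(2)])
  show "p \<in> locally_inside" using locally_insideI assms by blast
  have "edge N = boundary_points N" using assms(6) by (simp add: edge_def boundary_points_def)
  then show "\<exists>W. open W \<and> q \<in> W \<and> interior_points M \<inter> W \<inter> edge N = {} \<and> M \<inter> W \<inter> closure N \<subseteq> N" for q
    using assms(6,7) by (intro exI[of _ UNIV]) auto
qed

end

section \<open>From agreement near one point to coincidence\<close>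

lemma coincideI:
  assumes MN: "continuation M N \<nu> \<nu>'" and NM: "continuation N M \<nu>' \<nu>"
    and conn: "connected M" "connected N" and p: "p \<in> M" "p \<in> N"
    and W: "open W" "p \<in> W" "M \<inter> W = N \<inter> W"
  shows "coincide p M N"
proof -
  have sub: "M \<inter> W \<subseteq> N" "N \<inter> W \<subseteq> M" using W(3) by blast+
  show ?thesis
    unfolding coincide_def
  proof (intro conjI impI)
    show "\<exists>W. open W \<and> p \<in> W \<and> M \<inter> W = N \<inter> W \<and>
        (\<forall>C. connected C \<and> C \<inter> W \<noteq> {} \<and> C \<subseteq> M - edge N \<longrightarrow> C \<subseteq> N) \<and>
        (\<forall>C. connected C \<and> C \<inter> W \<noteq> {} \<and> C \<subseteq> N - edge M \<longrightarrow> C \<subseteq> M)"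
      using W continuation.connected_subset_off_edge[OF MN W(1) sub(1)]
        continuation.connected_subset_off_edge[OF NM W(1) sub(2)] by (intro exI[of _ W]) blast
    assume "closed M \<and> closed N \<and> interior_points M \<inter> boundary_points N = {} \<and>
        interior_points N \<inter> boundary_points M = {}"
    then show "M = N"
      using continuation.closed_subset[OF MN conn(1) p(1) W(1,2) sub(1)]
        continuation.closed_subset[OF NM conn(2) p(2) W(1,2) sub(2)] by blast
  qed
qed

lemma translators_continuation:
  fixes M1 M2 :: "'n::finite ambient set"
  assumes k: "0 < k" "k \<le> CARD('n) - 1"
    and M: "convex_translator k M1 \<nu>1" "convex_translator k M2 \<nu>2" "strictly_convex M1 \<nu>1"
    and side: "at_one_side M1 M2 \<nu>2"
  shows "continuation M1 M2 \<nu>1 \<nu>2" "continuation M2 M1 \<nu>2 \<nu>1"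
proof -
  have emb: "embedded_hypersurface M1" "embedded_hypersurface M2" "continuous_on M1 \<nu>1" "continuous_on M2 \<nu>2"
    using M by (auto simp: convex_translator_def unit_normal_def)
  have loc: "\<exists>W. open W \<and> q \<in> W \<and> M1 \<inter> W = M2 \<inter> W"
    if "q \<in> interior_points M1" "q \<in> interior_points M2" "\<nu>1 q = \<nu>2 q" for q
    by (rule local_interior_principle[OF k M side that]) blast
  show "continuation M1 M2 \<nu>1 \<nu>2"
  proof
    show "\<nu>1 r = \<nu>2 r" if "open W" "r \<in> W" "r \<in> M1" "M1 \<inter> W \<subseteq> M2" for r W
      using normal_eq_of_local_subset[OF k(1) M(1,2) that(1,2,4,3)] .
    show "\<exists>W. open W \<and> q \<in> W \<and> M1 \<inter> W \<subseteq> M2"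
      if "q \<in> interior_points M1" "q \<in> interior_points M2" "\<nu>1 q = \<nu>2 q" for q
      using loc[OF that] by blast
  qed (rule emb)+
  show "continuation M2 M1 \<nu>2 \<nu>1"
  proof
    show "\<nu>2 r = \<nu>1 r" if "open W" "r \<in> W" "r \<in> M2" "M2 \<inter> W \<subseteq> M1" for r W
      using normal_eq_of_local_subset[OF k(1) M(2,1) that(1,2,4,3)] .
    show "\<exists>W. open W \<and> q \<in> W \<and> M2 \<inter> W \<subseteq> M1"
      if "q \<in> interior_points M2" "q \<in> interior_points M1" "\<nu>2 q = \<nu>1 q" for q
      using loc[OF that(2,1) that(3)[symmetric]] by blast
  qed (rule emb)+
qed


subsection \<open>The boundary principle\<close>

lemma interior_ball_of_superlevel:
  fixes f :: "'a::euclidean_space \<Rightarrow> real"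
  assumes C2: "C2_graph V f gf Hf" and y0: "y0 \<in> V" "f y0 = 0" and n: "gf y0 = \<kappa> *\<^sub>R n" "0 < \<kappa>" "norm n = 1"
  obtains \<rho>0 where "0 < \<rho>0" "\<And>\<rho>. 0 < \<rho> \<Longrightarrow> \<rho> < \<rho>0 \<Longrightarrow> ball (y0 + \<rho> *\<^sub>R n) \<rho> \<subseteq> {y \<in> V. 0 < f y}"
proof -
  have V: "open V" and df: "\<And>y. y \<in> V \<Longrightarrow> (f has_derivative (\<lambda>\<xi>. gf y \<bullet> \<xi>)) (at y)"
    and dg: "(gf has_derivative Hf y0) (at y0)"
    using C2 y0 unfolding C2_graph_def by auto
  obtain K0 where K0: "\<And>h. norm (Hf y0 h) \<le> norm h * K0" "0 < K0"
    using bounded_linear.pos_bounded[OF has_derivative_bounded_linear[OF dg]] by blast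
  obtain \<delta>1 where \<delta>1: "0 < \<delta>1"
    "\<And>y. norm (y - y0) < \<delta>1 \<Longrightarrow> norm (gf y - gf y0 - Hf y0 (y - y0)) \<le> 1 * norm (y - y0)"
    using dg unfolding has_derivative_at_alt by (metis zero_less_one)
  obtain \<delta>2 where \<delta>2: "0 < \<delta>2" "ball y0 \<delta>2 \<subseteq> V" using openE[OF V y0(1)] .
  define K where "K = K0 + 1"
  define \<delta> where "\<delta> = min \<delta>1 \<delta>2"
  have K: "0 < K" and \<delta>: "0 < \<delta>" using K0 \<delta>1 \<delta>2 by (auto simp: K_def \<delta>_def)
  have lip: "norm (gf y - gf y0) \<le> K * norm (y - y0)" if "norm (y - y0) < \<delta>" for y
  proof -
    have "norm (gf y - gf y0 - Hf y0 (y - y0)) \<le> norm (y - y0)" using \<delta>1(2)[of y] that by (simp add: \<delta>_def)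
    then show ?thesis
      using K0(1)[of "y - y0"] norm_triangle_ineq[of "gf y - gf y0 - Hf y0 (y - y0)" "Hf y0 (y - y0)"]
      by (simp add: K_def algebra_simps)
  qed
  have inV: "y0 + h \<in> V" if "norm h < \<delta>" for h using \<delta>2(2) that by (auto simp: \<delta>_def dist_norm)
  have low: "\<kappa> * (n \<bullet> h) - K * (norm h)\<^sup>2 \<le> f (y0 + h)" if h: "norm h < \<delta>" for h
  proof -
    have th: "norm (t *\<^sub>R h) \<le> norm h" if "0 \<le> t" "t \<le> 1" for t using that by (simp add: mult_left_le_one_le)
    have "\<exists>z>0. z < 1 \<and> f (y0 + 1 *\<^sub>R h) - f (y0 + 0 *\<^sub>R h) = (1 - 0) * (gf (y0 + z *\<^sub>R h) \<bullet> h)"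
    proof (rule MVT2)
      fix t :: real assume "0 \<le> t" "t \<le> 1"
      then have "y0 + t *\<^sub>R h \<in> V" using th[of t] h by (intro inV) simp
      then show "((\<lambda>t. f (y0 + t *\<^sub>R h)) has_real_derivative gf (y0 + t *\<^sub>R h) \<bullet> h) (at t)"
        by (intro gradient_along_line df)
    qed simp
    then obtain t where t: "0 < t" "t < 1" "f (y0 + h) = gf (y0 + t *\<^sub>R h) \<bullet> h" using y0(2) by auto
    have tn: "norm (t *\<^sub>R h) \<le> norm h" using th t by simp
    then have "norm (gf (y0 + t *\<^sub>R h) - gf y0) \<le> K * norm (t *\<^sub>R h)" using lip[of "y0 + t *\<^sub>R h"] h by simp
    also have "\<dots> \<le> K * norm h" using tn K by (intro mult_left_mono) auto
    finally have "\<bar>(gf (y0 + t *\<^sub>R h) - gf y0) \<bullet> h\<bar> \<le> K * norm h * norm h" by (rule inner_bound)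
    then have "- (K * (norm h)\<^sup>2) \<le> gf (y0 + t *\<^sub>R h) \<bullet> h - gf y0 \<bullet> h"
      by (simp add: inner_diff_left power2_eq_square abs_le_iff)
    then show ?thesis unfolding t(3) n(1) by simp
  qed
  \<comment> \<open>The first bound keeps the ball within distance \<open>\<delta>\<close> of
    \<open>y0\<close>, the second makes \<open>\<kappa> - 2 * K * \<rho>\<close> positive.\<close>
  define \<rho>0 where "\<rho>0 = min (\<delta> / 2) (\<kappa> / (2 * K))"
  have "0 < \<rho>0" using \<delta> n K by (simp add: \<rho>0_def)
  moreover have "ball (y0 + \<rho> *\<^sub>R n) \<rho> \<subseteq> {y \<in> V. 0 < f y}" if \<rho>: "0 < \<rho>" "\<rho> < \<rho>0" for \<rho>
  proof
    fix y assume y: "y \<in> ball (y0 + \<rho> *\<^sub>R n) \<rho>"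
    define h where "h = y - y0"
    have yh: "y = y0 + h" by (simp add: h_def)
    have nh: "norm (h - \<rho> *\<^sub>R n) < \<rho>" using y by (simp add: h_def dist_norm norm_minus_commute algebra_simps)
    have "(norm (h - \<rho> *\<^sub>R n))\<^sup>2 < \<rho>\<^sup>2" using nh \<rho>(1) by (intro power_strict_mono) auto
    moreover have "(norm (h - \<rho> *\<^sub>R n))\<^sup>2 = (norm h)\<^sup>2 - 2 * \<rho> * (n \<bullet> h) + \<rho>\<^sup>2"
      using n(3) by (simp add: power2_norm_eq_inner algebra_simps inner_commute)
        (simp add: power2_eq_square norm_eq_sqrt_inner)
    ultimately have sq: "(norm h)\<^sup>2 < 2 * \<rho> * (n \<bullet> h)" by simp
    then have "0 < 2 * \<rho> * (n \<bullet> h)" by (rule le_less_trans[OF zero_le_power2])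
    then have nh0: "0 < n \<bullet> h" using \<rho>(1) by (simp add: zero_less_mult_iff)
    have "norm h \<le> norm (h - \<rho> *\<^sub>R n) + norm (\<rho> *\<^sub>R n)" using norm_triangle_ineq[of "h - \<rho> *\<^sub>R n" "\<rho> *\<^sub>R n"] by simp
    then have h\<delta>: "norm h < \<delta>" using nh \<rho> n(3) by (simp add: \<rho>0_def)
    have "2 * K * \<rho> < \<kappa>"
    proof -
      have "\<rho> < \<kappa> / (2 * K)" using \<rho>(2) by (simp add: \<rho>0_def)
      then show ?thesis using K by (simp add: pos_less_divide_eq mult.commute)
    qed
    then have "0 < (\<kappa> - 2 * K * \<rho>) * (n \<bullet> h)" using nh0 by simp
    also have "\<dots> = \<kappa> * (n \<bullet> h) - K * (2 * \<rho> * (n \<bullet> h))" by (simp add: algebra_simps)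
    also have "\<dots> \<le> \<kappa> * (n \<bullet> h) - K * (norm h)\<^sup>2" using sq K by simp
    also have "\<dots> \<le> f y" using low[OF h\<delta>] by (simp add: yh)
    finally show "y \<in> {y \<in> V. 0 < f y}" using inV[OF h\<delta>] by (simp add: yh)
  qed
  ultimately show ?thesis using that by blast
qed

lemma transversal_tangent:
  assumes tr: "transversal M a c" "a \<noteq> 0" and nu: "unit_normal M \<nu>"
    and par: "parametrization M \<phi> U b" "s \<in> U" "0 \<le> b \<bullet> s" and c: "a \<bullet> \<phi> s = c"
  obtains \<xi> where "a \<bullet> frechet_derivative \<phi> (at s) \<xi> \<noteq> 0"
proof -
  have "\<phi> s \<in> M \<inter> hyperplane a c" using chart_in[OF par] c by (simp add: hyperplane_def)
  then have "a \<in> {v + w | v w. v \<in> tangent_space M (\<phi> s) \<and> a \<bullet> w = 0}"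
    using tr(1) unfolding transversal_def by blast
  then obtain v w where v: "a = v + w" "v \<in> tangent_space M (\<phi> s)" "a \<bullet> w = 0" by blast
  have "a \<bullet> v = a \<bullet> (v + w)" using v(3) by (simp add: inner_add_right)
  then have "a \<bullet> v \<noteq> 0" using v(1) tr(2) by simp
  moreover have "v \<in> range (frechet_derivative \<phi> (at s))" using v(2) tangent_space_eq[OF nu par] by simp
  ultimately show ?thesis using that by blast
qed

text \<open>At an interior point on the hyperplane \<open>a \<bullet> x\<close> would be minimal on
  \<open>M\<close>, so \<open>a\<close> would annihilate the tangent space, against
  transversality.\<close>

lemma interior_point_off_hyperplane:
  assumes tr: "transversal M a c" "a \<noteq> 0" and nu: "unit_normal M \<nu>"
    and W: "open W" "x \<in> W" "M \<inter> W \<subseteq> {x. c \<le> a \<bullet> x}" and x: "x \<in> interior_points M"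
  shows "a \<bullet> x \<noteq> c"
proof
  assume c: "a \<bullet> x = c"
  obtain \<phi> U s where par: "parametrization M \<phi> U 0" "s \<in> U" "\<phi> s = x"
    using x unfolding interior_points_def by blast
  have s0: "0 \<le> 0 \<bullet> s" by simp
  obtain \<xi> where \<xi>: "a \<bullet> frechet_derivative \<phi> (at s) \<xi> \<noteq> 0"
    using transversal_tangent[OF tr nu par(1,2) s0] c par(3) by blast
  have lin: "linear (frechet_derivative \<phi> (at s))" using chart_linear par by blast
  have nn: "0 \<le> a \<bullet> frechet_derivative \<phi> (at s) \<xi>" for \<xi>
  proof (rule deriv_nonneg[where f="\<lambda>s. a \<bullet> \<phi> s" and f'="\<lambda>\<xi>. a \<bullet> frechet_derivative \<phi> (at s) \<xi>"
        and V="U \<inter> \<phi> -` W" and a=0 and s=s])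
    show "((\<lambda>s. a \<bullet> \<phi> s) has_derivative (\<lambda>\<xi>. a \<bullet> frechet_derivative \<phi> (at s) \<xi>)) (at s)"
      by (intro has_derivative_inner_right chart_derivatives(1)[OF par(1,2)])
    show "open (U \<inter> \<phi> -` W)"
      using chart_continuous[OF par(1)] chart_open[OF par(1)] W(1) by (rule continuous_open_preimage)
    show "s \<in> U \<inter> \<phi> -` W" using par W by simp
    show "a \<bullet> \<phi> s \<le> a \<bullet> \<phi> y" if y: "y \<in> U \<inter> \<phi> -` W" for y
    proof -
      have "\<phi> y \<in> M \<inter> W" using y chart_in[OF par(1)] by simp
      then show ?thesis using W(3) c par(3) by auto
    qed
  qed auto
  have "0 \<le> a \<bullet> frechet_derivative \<phi> (at s) (- \<xi>)" by (rule nn)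
  then show False using nn[of \<xi>] \<xi> by (simp add: linear_neg[OF lin])
qed

context frame
begin

text \<open>The boundary of the graph domain is the zero set of \<open>f\<close>, the chart's
  half-space function. Near \<open>p\<close> the chart maps its half-space to the side
  \<open>c \<le> a \<bullet> x\<close>, which forces the inner normal of the domain to be a positive
  multiple of \<open>P a\<close>, a direction independent of the hypersurface.\<close>

lemma boundary_graph:
  assumes nu: "unit_normal M \<nu>" "\<nu> p = d" and p: "p \<in> boundary_points M" and emb: "embedded_hypersurface M"
    and tr: "transversal M a c" "a \<noteq> 0" "a \<bullet> p = c" and W: "open W" "p \<in> W" "M \<inter> W \<subseteq> {x. c \<le> a \<bullet> x}"
  obtains N V u g H f gf Hf \<kappa> where "graph_over M N V u g H" "p \<in> N" "C2_graph V f gf Hf" "f (P p) = 0"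
    "\<And>y. y \<in> V \<Longrightarrow> 0 < f y \<Longrightarrow> point u y \<in> interior_points M"
    "gf (P p) = \<kappa> *\<^sub>R P a" "0 < \<kappa>" "P a \<noteq> 0"
proof -
  have pM: "p \<in> M" "p \<notin> interior_points M" using p by (auto simp: boundary_points_def)
  obtain \<phi> U b s where par: "parametrization M \<phi> U b" "s \<in> U" "0 \<le> b \<bullet> s" "\<phi> s = p"
    using embedded_chart[OF emb pM(1)] .
  let ?D = "frechet_derivative \<phi> (at s)"
  have b: "b \<noteq> 0" "b \<bullet> s = 0"
    using interior_point_of_chart[OF par(1,2)] pM(2) par(3,4) by (auto simp: less_le)
  have orth: "?D \<xi> \<bullet> d = 0" for \<xi> using normal_orthogonal[OF nu(1) par(1-3)] par(4) nu(2) by simp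
  obtain U0 V \<theta> g H gf Hf N where lg: "open U0" "s \<in> U0" "U0 \<subseteq> U" "homeomorphism U0 V (\<lambda>s. P (\<phi> s)) \<theta>"
    "graph_over M N V (\<lambda>y. \<phi> (\<theta> y) \<bullet> d) g H" "C2_graph V (\<lambda>y. b \<bullet> \<theta> y) gf Hf" "\<phi> s \<in> N"
    using local_graph[OF par(1-3) orth] by metis
  have \<theta>: "\<And>x. x \<in> U0 \<Longrightarrow> P (\<phi> x) \<in> V" "\<And>x. x \<in> U0 \<Longrightarrow> \<theta> (P (\<phi> x)) = x"
    "\<And>y. y \<in> V \<Longrightarrow> \<theta> y \<in> U0" "\<And>y. y \<in> V \<Longrightarrow> P (\<phi> (\<theta> y)) = y"
    using lg(4) unfolding homeomorphism_def by blast+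
  let ?G = "gf (P p)"
  have pV: "P p \<in> V" using \<theta>(1)[OF lg(2)] par(4) by simp
  have grad: "?G \<bullet> P (?D \<xi>) = b \<bullet> \<xi>" for \<xi>
  proof -
    have dP: "((\<lambda>s. P (\<phi> s)) has_derivative (\<lambda>\<xi>. P (?D \<xi>))) (at s)"
      using bounded_linear.has_derivative[OF bP chart_derivatives(1)[OF par(1,2)]] .
    have "((\<lambda>y. b \<bullet> \<theta> y) has_derivative (\<lambda>\<xi>. ?G \<bullet> \<xi>)) (at (P (\<phi> s)))"
      using lg(6) pV par(4) unfolding C2_graph_def by simp
    from has_derivative_compose[OF dP this]
    have "((\<lambda>x. b \<bullet> \<theta> (P (\<phi> x))) has_derivative (\<lambda>\<xi>. ?G \<bullet> P (?D \<xi>))) (at s)" .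
    then have "((\<lambda>x. b \<bullet> x) has_derivative (\<lambda>\<xi>. ?G \<bullet> P (?D \<xi>))) (at s)"
      by (rule has_derivative_transform_within_open[OF _ lg(1,2)]) (simp add: \<theta>(2))
    moreover have "((\<lambda>x. b \<bullet> x) has_derivative (\<lambda>\<xi>. b \<bullet> \<xi>)) (at s)"
      by (auto intro!: derivative_eq_intros)
    ultimately have "(\<lambda>\<xi>. ?G \<bullet> P (?D \<xi>)) = (\<lambda>\<xi>. b \<bullet> \<xi>)" by (rule has_derivative_unique)
    then show ?thesis by (rule fun_cong)
  qed
  have aD: "a \<bullet> ?D \<xi> = P a \<bullet> P (?D \<xi>)" for \<xi>
    unfolding inner_decomp[of a "?D \<xi>"] by (simp add: orth)
  have nn: "0 \<le> P a \<bullet> P (?D \<xi>)" if "0 \<le> b \<bullet> \<xi>" for \<xi>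
    unfolding aD[symmetric]
  proof (rule deriv_nonneg[where f="\<lambda>s. a \<bullet> \<phi> s" and f'="\<lambda>\<xi>. a \<bullet> ?D \<xi>" and V="U \<inter> \<phi> -` W" and a=b and s=s])
    show "((\<lambda>s. a \<bullet> \<phi> s) has_derivative (\<lambda>\<xi>. a \<bullet> ?D \<xi>)) (at s)"
      by (intro has_derivative_inner_right chart_derivatives(1)[OF par(1,2)])
    show "open (U \<inter> \<phi> -` W)"
      using chart_continuous[OF par(1)] chart_open[OF par(1)] W(1) by (rule continuous_open_preimage)
    show "s \<in> U \<inter> \<phi> -` W" using par W by simp
    show "a \<bullet> \<phi> s \<le> a \<bullet> \<phi> y" if y: "y \<in> U \<inter> \<phi> -` W" "0 \<le> b \<bullet> y" for y
    proof -
      have "\<phi> y \<in> M \<inter> W" using y chart_in[OF par(1)] by simp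
      then show ?thesis using W(3) tr(3) par(4) by auto
    qed
  qed (use that par in auto)
  have surj: "\<exists>\<xi>. \<zeta> = P (?D \<xi>)" for \<zeta>
    using graph_over_projection_surj[OF lg(5) par(1-3) lg(7)] by (metis surjD)
  have cone: "0 \<le> P a \<bullet> \<zeta>" if "0 \<le> ?G \<bullet> \<zeta>" for \<zeta>
    using surj[of \<zeta>] grad nn that by force
  have G0: "?G \<noteq> 0" using grad[of b] b by auto
  have Pa0: "P a \<noteq> 0"
    using transversal_tangent[OF tr(1,2) nu(1) par(1-3)] tr(3) par(4) aD by (metis inner_zero_left)
  \<comment> \<open>\<open>?w\<close> is the part of \<open>P a\<close> orthogonal to
    \<open>?G\<close>. The cone condition applies to \<open>?w\<close> and to \<open>- ?w\<close>,
    so \<open>P a \<bullet> ?w = 0\<close> and \<open>?w\<close> vanishes.\<close>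
  define \<tau> where "\<tau> = (P a \<bullet> ?G) / (?G \<bullet> ?G)"
  have GG: "0 < ?G \<bullet> ?G" using G0 by simp
  let ?w = "P a - \<tau> *\<^sub>R ?G"
  have wG: "?G \<bullet> ?w = 0" using GG by (simp add: \<tau>_def inner_diff_right inner_commute)
  have "0 \<le> P a \<bullet> ?w" by (rule cone) (simp only: wG order_refl)
  moreover have "0 \<le> P a \<bullet> (- ?w)" by (rule cone) (simp only: inner_minus_right wG neg_equal_0_iff_equal order_refl minus_zero)
  then have "P a \<bullet> ?w \<le> 0" by (simp only: inner_minus_right neg_0_le_iff_le)
  ultimately have "P a \<bullet> ?w = 0" by (rule antisym[rotated])
  then have "?w \<bullet> ?w = 0" using wG by (simp only: inner_diff_left inner_scaleR_left)
  then have Pa: "P a = \<tau> *\<^sub>R ?G" by simp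
  have "0 \<le> \<tau>" unfolding \<tau>_def using cone[of ?G] GG by simp
  moreover have "\<tau> \<noteq> 0" using Pa Pa0 by auto
  ultimately have \<tau>: "0 < \<tau>" by simp
  have G: "?G = (1 / \<tau>) *\<^sub>R P a" using Pa \<tau> by simp
  have "point (\<lambda>y. \<phi> (\<theta> y) \<bullet> d) y \<in> interior_points M" if "y \<in> V" "0 < b \<bullet> \<theta> y" for y
  proof -
    have "point (\<lambda>y. \<phi> (\<theta> y) \<bullet> d) y = \<phi> (\<theta> y)"
      using point_unique[of "\<phi> (\<theta> y)" y "\<lambda>y. \<phi> (\<theta> y) \<bullet> d"] \<theta>(4)[OF that(1)] by simp
    then show ?thesis using interior_point_of_chart[OF par(1), of "\<theta> y"] \<theta>(3)[OF that(1)] lg(3) that(2) by auto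
  qed
  moreover have "b \<bullet> \<theta> (P p) = 0" using \<theta>(2)[OF lg(2)] par(4) b(2) by simp
  ultimately show ?thesis
    using that[OF lg(5) _ lg(6) _ _ G _ Pa0] \<tau> lg(7) par(4) by simp
qed

end

text \<open>Both graph domains have inner normal \<open>n\<close> at \<open>P p\<close>, so small
  tangent balls lie in both. Without contact in such a ball, \<open>hopf\<close> at
  \<open>P p\<close> gives a contradiction; a contact point is interior to both hypersurfaces and
  has equal normals.\<close>

lemma local_boundary_contact:
  fixes M1 M2 :: "'n::finite ambient set"
  assumes k: "0 < k" "k \<le> CARD('n) - 1"
    and M: "convex_translator k M1 \<nu>1" "convex_translator k M2 \<nu>2" "strictly_convex M1 \<nu>1"
    and side: "at_one_side M1 M2 \<nu>2"
    and p: "p \<in> boundary_points M1" "p \<in> boundary_points M2" "\<nu>1 p = \<nu>2 p"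
    and tr: "transversal M1 a c" "transversal M2 a c" "a \<noteq> 0" "a \<bullet> p = c"
    and W: "open W" "p \<in> W" "(M1 \<union> M2) \<inter> W \<subseteq> {x. c \<le> a \<bullet> x}"
    and T: "open T" "p \<in> T"
  obtains r W' where "r \<in> M1 \<inter> M2 \<inter> T" "open W'" "r \<in> W'" "M1 \<inter> W' = M2 \<inter> W'"
proof -
  have emb: "embedded_hypersurface M1" "unit_normal M1 \<nu>1" "embedded_hypersurface M2" "unit_normal M2 \<nu>2"
    using M by (auto simp: convex_translator_def)
  have pM: "p \<in> M1" "p \<in> M2" using p by (auto simp: boundary_points_def)
  have n: "norm (\<nu>2 p) = 1" using unit_normal_norm emb pM by blast
  obtain A P where "frame A P (\<nu>2 p)" using frame_exists[OF n] .
  then interpret frame A P "\<nu>2 p" .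
  have W12: "M1 \<inter> W \<subseteq> {x. c \<le> a \<bullet> x}" "M2 \<inter> W \<subseteq> {x. c \<le> a \<bullet> x}" using W(3) by blast+
  obtain N1 V1 u1 g1 H1 f1 gf1 Hf1 \<kappa>1 where gr1: "graph_over M1 N1 V1 u1 g1 H1" "p \<in> N1"
    "C2_graph V1 f1 gf1 Hf1" "f1 (P p) = 0" "\<And>y. y \<in> V1 \<Longrightarrow> 0 < f1 y \<Longrightarrow> point u1 y \<in> interior_points M1"
    "gf1 (P p) = \<kappa>1 *\<^sub>R P a" "0 < \<kappa>1" "P a \<noteq> 0"
    by (rule boundary_graph[OF emb(2) p(3,1) emb(1) tr(1,3,4) W(1,2) W12(1)]) (rule that; assumption)
  obtain N2 V2 u2 g2 H2 f2 gf2 Hf2 \<kappa>2 where gr2: "graph_over M2 N2 V2 u2 g2 H2" "p \<in> N2"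
    "C2_graph V2 f2 gf2 Hf2" "f2 (P p) = 0" "\<And>y. y \<in> V2 \<Longrightarrow> 0 < f2 y \<Longrightarrow> point u2 y \<in> interior_points M2"
    "gf2 (P p) = \<kappa>2 *\<^sub>R P a" "0 < \<kappa>2" "P a \<noteq> 0"
    by (rule boundary_graph[OF emb(4) refl p(2) emb(3) tr(2,3,4) W(1,2) W12(2)]) (rule that; assumption)
  obtain T1 where T1: "open T1" "p \<in> T1" "\<And>x. x \<in> M1 \<Longrightarrow> x \<in> T1 \<Longrightarrow> 0 < \<nu>1 x \<bullet> \<nu>2 p"
    using normal_direction_open[OF emb(2) pM(1) p(3)] by blast
  obtain T2 where T2: "open T2" "p \<in> T2" "\<And>x. x \<in> M2 \<Longrightarrow> x \<in> T2 \<Longrightarrow> 0 < \<nu>2 x \<bullet> \<nu>2 p"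
    using normal_direction_open[OF emb(4) pM(2) refl] by blast
  obtain \<sigma> W0 where \<sigma>: "\<sigma> = 1 \<or> \<sigma> = -1" and W0: "open W0" "p \<in> W0"
    and one: "\<And>x y t. x \<in> M1 \<inter> W0 \<Longrightarrow> y \<in> M2 \<inter> W0 \<Longrightarrow> x = y + t *\<^sub>R \<nu>2 p \<Longrightarrow> 0 \<le> \<sigma> * t"
    using at_one_sideD[OF side pM] by metis
  have C2: "C2_graph V1 u1 g1 H1" "C2_graph V2 u2 g2 H2" and N: "open N1" "open N2"
    and in1: "\<And>x. x \<in> M1 \<Longrightarrow> x \<in> N1 \<Longrightarrow> P x \<in> V1 \<and> x \<bullet> \<nu>2 p = u1 (P x)"
    and in2: "\<And>x. x \<in> M2 \<Longrightarrow> x \<in> N2 \<Longrightarrow> P x \<in> V2 \<and> x \<bullet> \<nu>2 p = u2 (P x)"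
    using gr1(1) gr2(1) unfolding graph_over_def by blast+
  define T0 where "T0 = N1 \<inter> N2 \<inter> T1 \<inter> T2 \<inter> W0 \<inter> T"
  have T0: "open T0" "p \<in> T0" using N T1(1,2) T2(1,2) W0 gr1(2) gr2(2) T by (auto simp: T0_def intro!: open_Int)
  define \<Omega> where "\<Omega> = {y \<in> V1. point u1 y \<in> T0} \<inter> {y \<in> V2. point u2 y \<in> T0}"
  have oO: "open \<Omega>" unfolding \<Omega>_def using point_open C2 T0(1) by blast
  have Pp: "P p \<in> V1" "P p \<in> V2" "u1 (P p) = u2 (P p)"
    using in1[OF pM(1) gr1(2)] in2[OF pM(2) gr2(2)] by auto
  have pq: "point u1 (P p) = p" "point u2 (P p) = p"
    using point_unique[of p "P p" u1] point_unique[of p "P p" u2] in1[OF pM(1) gr1(2)] in2[OF pM(2) gr2(2)] by auto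
  have PO: "P p \<in> \<Omega>" using pq T0(2) Pp by (simp add: \<Omega>_def)
  define n where "n = P a /\<^sub>R norm (P a)"
  have nn: "norm n = 1" "P a = norm (P a) *\<^sub>R n" and Pa: "0 < norm (P a)" using gr1(8) by (auto simp: n_def)
  have gn: "gf1 (P p) = (\<kappa>1 * norm (P a)) *\<^sub>R n" "gf2 (P p) = (\<kappa>2 * norm (P a)) *\<^sub>R n"
    using gr1(6) gr2(6) nn(2) by (metis scaleR_scaleR)+
  obtain \<rho>1 where \<rho>1: "0 < \<rho>1" "\<And>\<rho>. 0 < \<rho> \<Longrightarrow> \<rho> < \<rho>1 \<Longrightarrow> ball (P p + \<rho> *\<^sub>R n) \<rho> \<subseteq> {y \<in> V1. 0 < f1 y}"
    using interior_ball_of_superlevel[OF gr1(3) Pp(1) gr1(4) gn(1) mult_pos_pos[OF gr1(7) Pa] nn(1)] by blast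
  obtain \<rho>2 where \<rho>2: "0 < \<rho>2" "\<And>\<rho>. 0 < \<rho> \<Longrightarrow> \<rho> < \<rho>2 \<Longrightarrow> ball (P p + \<rho> *\<^sub>R n) \<rho> \<subseteq> {y \<in> V2. 0 < f2 y}"
    using interior_ball_of_superlevel[OF gr2(3) Pp(2) gr2(4) gn(2) mult_pos_pos[OF gr2(7) Pa] nn(1)] by blast
  obtain \<rho>3 where \<rho>3: "0 < \<rho>3" "ball (P p) \<rho>3 \<subseteq> \<Omega>" using openE[OF oO PO] .
  \<comment> \<open>Halving ensures \<open>2 * \<rho> \<le> \<rho>3\<close>: the tangent ball
    reaches at most that far from \<open>P p\<close> and stays in \<open>\<Omega>\<close>.\<close>
  define \<rho> where "\<rho> = Min {\<rho>1, \<rho>2, \<rho>3} / 2"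
  have \<rho>: "0 < \<rho>" "\<rho> < \<rho>1" "\<rho> < \<rho>2" "2 * \<rho> \<le> \<rho>3"
    using \<rho>1(1) \<rho>2(1) \<rho>3(1) by (auto simp: \<rho>_def min_def)
  define B where "B = ball (P p + \<rho> *\<^sub>R n) \<rho>"
  have BO: "B \<subseteq> \<Omega>"
  proof -
    have "B \<subseteq> ball (P p) \<rho>3"
    proof
      fix y assume "y \<in> B"
      then have "dist (P p + \<rho> *\<^sub>R n) y < \<rho>" by (simp add: B_def)
      moreover have "dist (P p) (P p + \<rho> *\<^sub>R n) = \<rho>" using nn(1) \<rho>(1) by (simp add: dist_norm)
      ultimately show "y \<in> ball (P p) \<rho>3" using dist_triangle[of "P p" y "P p + \<rho> *\<^sub>R n"] \<rho>(4) by simp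
    qed
    then show ?thesis using \<rho>3(2) by blast
  qed
  have V: "y \<in> V1" "y \<in> V2" "point u1 y \<in> T0" "point u2 y \<in> T0" if "y \<in> B" for y
    using that BO by (auto simp: \<Omega>_def)
  have pI: "point u1 y \<in> interior_points M1" "point u2 y \<in> interior_points M2" if "y \<in> B" for y
    using gr1(5)[of y] gr2(5)[of y] \<rho>1(2)[OF \<rho>(1,2)] \<rho>2(2)[OF \<rho>(1,3)] that by (auto simp: B_def)
  have pM': "point u1 y \<in> M1" "point u2 y \<in> M2" if "y \<in> B" for y
    using pI[OF that] interior_points_subset by blast+
  have TN: "x \<in> N1" "x \<in> N2" "x \<in> T1" "x \<in> T2" "x \<in> W0" "x \<in> T" if "x \<in> T0" for x
    using that by (auto simp: T0_def)
  have d1: "0 < \<nu>1 (point u1 y) \<bullet> \<nu>2 p" and d2: "0 < \<nu>2 (point u2 y) \<bullet> \<nu>2 p" if "y \<in> B" for y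
    using T1(3)[OF pM'(1)[OF that]] T2(3)[OF pM'(2)[OF that]] V[OF that] TN by blast+
  have eq1: "graph_equation k slope (g1 y) (H1 y)" if "y \<in> B" for y
    using graph_over_equation(1)[OF gr1(1) k(1) M(1) pM'(1)[OF that] _ d1[OF that]] V(3)[OF that] TN
    by (simp add: P_point)
  have eq2: "graph_equation k slope (g2 y) (H2 y)" if "y \<in> B" for y
    using graph_over_equation(1)[OF gr2(1) k(1) M(2) pM'(2)[OF that] _ d2[OF that]] V(4)[OF that] TN
    by (simp add: P_point)
  have w: "0 \<le> \<sigma> * (u1 y - u2 y)" if "y \<in> B" for y
  proof (rule one[of "point u1 y" "point u2 y"])
    show "point u1 y = point u2 y + (u1 y - u2 y) *\<^sub>R \<nu>2 p" by (simp add: point_def algebra_simps)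
  qed (use V[OF that] pM'[OF that] TN in blast)+
  have dp: "0 < \<nu>1 p \<bullet> \<nu>2 p" using p(3) dd by simp
  have pos: "inner_form (\<lambda>\<xi> \<eta>. H1 (P p) \<xi> \<bullet> \<eta>)"
    using graph_over_posdef[OF gr1(1) M(1,3) pM(1) gr1(2) dp] .
  \<comment> \<open>The frame is adapted to the common normal at \<open>p\<close>, so both gradients
    are zero at \<open>P p\<close>.\<close>
  have nrm: "nrm (g1 (P p)) = \<nu>2 p" "nrm (g2 (P p)) = \<nu>2 p"
    using graph_over_normal[OF gr1(1) emb(1,2) pM(1) gr1(2)] graph_over_normal[OF gr2(1) emb(3,4) pM(2) gr2(2)]
      p(3) dd by simp_all
  have g0: "g1 (P p) = g2 (P p)" using P_nrm[of "g1 (P p)"] P_nrm[of "g2 (P p)"] nrm by simp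
  have C2O: "C2_graph \<Omega> u1 g1 H1" "C2_graph \<Omega> u2 g2 H2"
    using C2_graph_subset[OF C2(1) oO] C2_graph_subset[OF C2(2) oO] by (auto simp: \<Omega>_def)
  have "\<exists>y\<in>B. u1 y = u2 y"
  proof (rule ccontr)
    assume "\<not> ?thesis"
    then have pos': "0 < \<sigma> * (u1 y - u2 y)" if "y \<in> \<Omega> \<inter> ball (P p + \<rho> *\<^sub>R n) \<rho>" for y
      using w[of y] that \<sigma> by (auto simp: B_def less_le)
    have dist: "dist (P p) (P p + \<rho> *\<^sub>R n) = \<rho>" using nn(1) \<rho>(1) by (simp add: dist_norm)
    show False
      by (rule hopf[OF k C2O PO dist \<rho>(1) norm_ge_zero slope_lipschitz pos _ _ \<sigma> pos' Pp(3) g0])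
        (use eq1 eq2 in \<open>auto simp: B_def\<close>)
  qed
  then obtain y where y: "y \<in> B" "u1 y = u2 y" by blast
  obtain r where r: "0 < r" "ball y r \<subseteq> B" using y(1) openE[OF open_ball] unfolding B_def by blast
  have yO: "y \<in> \<Omega>" using y(1) BO by blast
  have du: "\<And>y. y \<in> \<Omega> \<Longrightarrow> (u1 has_derivative (\<lambda>\<xi>. g1 y \<bullet> \<xi>)) (at y)"
    "\<And>y. y \<in> \<Omega> \<Longrightarrow> (u2 has_derivative (\<lambda>\<xi>. g2 y \<bullet> \<xi>)) (at y)"
    "(g1 has_derivative H1 y) (at y)" "(g2 has_derivative H2 y) (at y)"
    using C2O yO by (auto simp: C2_graph_def)
  have "\<sigma> *\<^sub>R (g1 y - g2 y) = 0"
  proof (rule second_order_min(1)[OF r(1), where y=y and u="\<lambda>y. \<sigma> * (u1 y - u2 y)" and g="\<lambda>x. \<sigma> *\<^sub>R (g1 x - g2 x)"])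
    show "\<sigma> * (u1 y - u2 y) \<le> \<sigma> * (u1 x - u2 x)" if "x \<in> ball y r" for x
      using w[of x] that r(2) y(2) by auto
    show "((\<lambda>y. \<sigma> * (u1 y - u2 y)) has_derivative (\<lambda>\<xi>. \<sigma> *\<^sub>R (g1 x - g2 x) \<bullet> \<xi>)) (at x)" if "x \<in> ball y r" for x
    proof -
      have "x \<in> \<Omega>" using that r(2) BO by blast
      then show ?thesis by (auto intro!: derivative_eq_intros du simp: inner_diff_left)
    qed
    show "((\<lambda>x. \<sigma> *\<^sub>R (g1 x - g2 x)) has_derivative (\<lambda>\<xi>. \<sigma> *\<^sub>R (H1 y \<xi> - H2 y \<xi>))) (at y)"
      by (intro derivative_intros du)
  qed
  then have gy: "g1 y = g2 y" using \<sigma> by auto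
  let ?r = "point u1 y"
  have rr: "?r = point u2 y" using y(2) by (simp add: point_def)
  have rM: "?r \<in> M1" "?r \<in> M2" using pM'[OF y(1)] rr by auto
  have rN: "?r \<in> N1" "?r \<in> N2" "?r \<in> T" using V(3)[OF y(1)] TN by auto
  have "\<nu>1 ?r = (\<nu>1 ?r \<bullet> \<nu>2 p) *\<^sub>R nrm (g1 y)" "\<nu>2 ?r = (\<nu>2 ?r \<bullet> \<nu>2 p) *\<^sub>R nrm (g1 y)"
    using graph_over_normal[OF gr1(1) emb(1,2) rM(1) rN(1)] graph_over_normal[OF gr2(1) emb(3,4) rM(2) rN(2)] gy
    by (simp_all add: P_point)
  then have "\<nu>1 ?r = \<nu>2 ?r"
    using unit_eqI unit_normal_norm[OF emb(2) rM(1)] unit_normal_norm[OF emb(4) rM(2)]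
      normal_upward[OF k(1) M(1) rM(1)] normal_upward[OF k(1) M(2) rM(2)] by blast
  then obtain W' where "open W'" "?r \<in> W'" "M1 \<inter> W' = M2 \<inter> W'"
    using local_interior_principle[OF k M side pI(1)[OF y(1)]] pI(2)[OF y(1)] rr by metis
  then show ?thesis using that[of ?r W'] rM rN by blast
qed

text \<open>Boundary points of \<open>N\<close> lie on the hyperplane, interior points of
  \<open>M\<close> near \<open>p\<close> do not, so the edge of \<open>N\<close> does not obstruct
  the passage to the limit at \<open>p\<close>.\<close>

lemma (in continuation) locally_inside_at_boundary:
  assumes p: "p \<in> M" "p \<in> N" and bd: "boundary_points N \<subseteq> hyperplane a c"
    and tr: "transversal M a c" "a \<noteq> 0" and nu: "unit_normal M \<nu>"
    and W: "open W" "p \<in> W" "M \<inter> W \<subseteq> {x. c \<le> a \<bullet> x}"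
    and contact: "\<And>T. open T \<Longrightarrow> p \<in> T \<Longrightarrow> M \<inter> T \<inter> locally_inside \<noteq> {}"
  shows "p \<in> locally_inside"
proof -
  obtain W' where W': "open W'" "p \<in> W'" "closure N \<inter> W' \<subseteq> N" using locally_closed[OF emb(2) p(2)] .
  show ?thesis
  proof (rule locally_inside_closed[OF p(1), of "W \<inter> W'"])
    show "interior_points M \<inter> (W \<inter> W') \<inter> edge N = {}"
    proof (intro equals0I)
      fix x assume "x \<in> interior_points M \<inter> (W \<inter> W') \<inter> edge N"
      then have x: "x \<in> interior_points M" "x \<in> W" "x \<in> N" "x \<notin> interior_points N"
        using W'(3) by (auto simp: edge_def)
      then have "a \<bullet> x = c" using bd by (auto simp: boundary_points_def hyperplane_def)
      then show False using interior_point_off_hyperplane[OF tr nu W(1) x(2) W(3) x(1)] by blast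
    qed
  qed (use W W' contact in auto)
qed

theorem theorem1p2:
  fixes M1 M2 :: "'n::finite ambient set"
    and \<nu>1 \<nu>2 :: "'n ambient \<Rightarrow> 'n ambient"
    and k :: nat
  assumes "0 < k" and "k \<le> CARD('n) - 1"
    and "embedded_hypersurface M1" and "connected M1"
    and "unit_normal M1 \<nu>1" and "translator k M1 \<nu>1"
    and "embedded_hypersurface M2" and "connected M2"
    and "unit_normal M2 \<nu>2" and "translator k M2 \<nu>2"
    and "strictly_convex M1 \<nu>1"
    and "curvatures_in M2 \<nu>2 (Gamma (k + 1) \<inter> {lam. \<forall>i. 0 \<le> lam $ i})"
  shows
    "(\<forall>p. p \<in> interior_points M1 \<inter> interior_points M2 \<and>
          tangent_space M1 p = tangent_space M2 p \<and>
          at_one_side M1 M2 \<nu>2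
        \<longrightarrow> coincide p M1 M2)
     \<and>
     (\<forall>a c p. a \<noteq> 0 \<and>
          boundary_points M1 \<subseteq> hyperplane a c \<and> boundary_points M2 \<subseteq> hyperplane a c \<and>
          transversal M1 a c \<and> transversal M2 a c \<and>
          at_one_side M1 M2 \<nu>2 \<and>
          p \<in> boundary_points M1 \<inter> boundary_points M2 \<and>
          tangent_space M1 p = tangent_space M2 p \<and>
          (\<exists>W. open W \<and> p \<in> W \<and> (M1 \<union> M2) \<inter> W \<subseteq> {x. c \<le> a \<bullet> x})
        \<longrightarrow> coincide p M1 M2)"
proof -
  note k = assms(1,2) and conn = assms(4,8)
  have n: "Suc k \<le> CARD('n)" using k by linarith
  have "\<exists>lam. principal_curvatures M1 \<nu>1 r lam \<and> (\<forall>i. 0 \<le> lam $ i) \<and> 0 < S (Suc k) lam" if "r \<in> M1" for r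
    using assms(11) that S_pos[OF _ n] unfolding strictly_convex_def by (meson less_imp_le)
  then have M1: "convex_translator k M1 \<nu>1" using assms unfolding convex_translator_def by blast
  have "\<exists>lam. principal_curvatures M2 \<nu>2 r lam \<and> (\<forall>i. 0 \<le> lam $ i) \<and> 0 < S (Suc k) lam" if "r \<in> M2" for r
    using assms(12) that unfolding curvatures_in_def Gamma_def by fastforce
  then have M2: "convex_translator k M2 \<nu>2" using assms unfolding convex_translator_def by blast
  note M = M1 M2 assms(11)
  show ?thesis
  proof (intro conjI allI impI; elim conjE)
    fix p
    assume p: "p \<in> interior_points M1 \<inter> interior_points M2" and T: "tangent_space M1 p = tangent_space M2 p"
      and side: "at_one_side M1 M2 \<nu>2"
    have pM: "p \<in> M1" "p \<in> M2" using p interior_points_subset by blast+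
    have "\<nu>1 p = \<nu>2 p" using normal_eq_of_tangent_space_eq[OF k(1) M(1,2) pM T] .
    then obtain W where "open W" "p \<in> W" "M1 \<inter> W = M2 \<inter> W"
      using local_interior_principle[OF k M side] p by blast
    then show "coincide p M1 M2" using coincideI[OF translators_continuation[OF k M side] conn pM] by blast
  next
    fix a c p
    assume a: "a \<noteq> 0" and bd: "boundary_points M1 \<subseteq> hyperplane a c" "boundary_points M2 \<subseteq> hyperplane a c"
      and tr: "transversal M1 a c" "transversal M2 a c" and side: "at_one_side M1 M2 \<nu>2"
      and p: "p \<in> boundary_points M1 \<inter> boundary_points M2"
      and T: "tangent_space M1 p = tangent_space M2 p"
      and "\<exists>W. open W \<and> p \<in> W \<and> (M1 \<union> M2) \<inter> W \<subseteq> {x. c \<le> a \<bullet> x}"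
    then obtain W where W: "open W" "p \<in> W" "(M1 \<union> M2) \<inter> W \<subseteq> {x. c \<le> a \<bullet> x}" by blast
    have W12: "M1 \<inter> W \<subseteq> {x. c \<le> a \<bullet> x}" "M2 \<inter> W \<subseteq> {x. c \<le> a \<bullet> x}" using W(3) by blast+
    have pM: "p \<in> M1" "p \<in> M2" and pb: "p \<in> boundary_points M1" "p \<in> boundary_points M2"
      using p by (auto simp: boundary_points_def)
    have ap: "a \<bullet> p = c" using pb bd by (auto simp: hyperplane_def)
    have \<nu>: "\<nu>1 p = \<nu>2 p" using normal_eq_of_tangent_space_eq[OF k(1) M(1,2) pM T] .
    interpret c12: continuation M1 M2 \<nu>1 \<nu>2 using translators_continuation(1)[OF k M side] .
    interpret c21: continuation M2 M1 \<nu>2 \<nu>1 using translators_continuation(2)[OF k M side] .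
    have contact: "\<exists>r W'. r \<in> M1 \<inter> M2 \<inter> T \<and> open W' \<and> r \<in> W' \<and> M1 \<inter> W' = M2 \<inter> W'"
      if "open T" "p \<in> T" for T
      by (rule local_boundary_contact[OF k M side pb \<nu> tr a ap W that]) blast
    \<comment> \<open>The contact points accumulate at \<open>p\<close> without reaching it; each
      inclusion is therefore continued to \<open>p\<close> separately, and the two neighbourhoods
      are intersected.\<close>
    have "p \<in> c12.locally_inside"
    proof (rule c12.locally_inside_at_boundary[OF pM bd(2) tr(1) a assms(5) W(1,2) W12(1)])
      fix T :: "'n ambient set" assume "open T" "p \<in> T"
      from contact[OF this] obtain r W' where "r \<in> M1 \<inter> M2 \<inter> T" "open W'" "r \<in> W'" "M1 \<inter> W' = M2 \<inter> W'" by blast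
      then show "M1 \<inter> T \<inter> c12.locally_inside \<noteq> {}" using c12.locally_insideI[of W' r] by blast
    qed
    moreover have "p \<in> c21.locally_inside"
    proof (rule c21.locally_inside_at_boundary[OF pM(2,1) bd(1) tr(2) a assms(9) W(1,2) W12(2)])
      fix T :: "'n ambient set" assume "open T" "p \<in> T"
      from contact[OF this] obtain r W' where "r \<in> M1 \<inter> M2 \<inter> T" "open W'" "r \<in> W'" "M1 \<inter> W' = M2 \<inter> W'" by blast
      then show "M2 \<inter> T \<inter> c21.locally_inside \<noteq> {}" using c21.locally_insideI[of W' r] by blast
    qed
    ultimately have "p \<in> c12.locally_inside \<inter> c21.locally_inside" "open (c12.locally_inside \<inter> c21.locally_inside)"
      using c12.open_locally_inside c21.open_locally_inside by auto
    moreover have "M1 \<inter> (c12.locally_inside \<inter> c21.locally_inside) = M2 \<inter> (c12.locally_inside \<inter> c21.locally_inside)"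
      using c12.locally_inside_subset c21.locally_inside_subset by blast
    ultimately show "coincide p M1 M2"
      using coincideI[OF translators_continuation[OF k M side] conn pM] by blast
  qed
qed

end
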